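(* Let $G$ be a residually finite group with a subnormal series $\{1_G\} = H_0 \triangleleft H_1 \triangleleft \cdots \triangleleft H_n = G$, where each factor $H_{k+1} / H_k$ is locally virtually abelian. Then $G$ is nil-rigid on $\mathfrak{C}_3$.
   Context: All groups are discrete. A group is locally virtually abelian if each of its finitely generated subgroups has an abelian subgroup of finite index. **Pointed systems.** A pointed dynamical system $(G,X)$ consists of a group $G$, a compact metric space $(X,d_X)$, a continuous left action of $G$ on $X$, and a point $0\in X$ with $g\cdot 0=0$ for all $g\in G$. It is expansive if there is $0<\Delta\le1$ such that $d_X(g\cdot x,g\cdot y)\le\Delta$ for all $g\in G$ implies $x=y$. A point $x\in X$ is homoclinic in $(G,X)$ if for every $\epsilon>0$ there is a finite $E\subseteq G$ with $d_X(g\cdot x,0)<\epsilon$ for all $g\in G\setminus E$. For $A,E\subseteq G$ let $\partial_EA=\{g\in A: Eg\not\subseteq A\}$. A designation in $(G,X)$ is a family $(A_i,x_i)_{i\in I}$ with $x_i\in X$ and $(A_i)_{i\in I}$ a partition of $G$; it is a $(\delta,E)$-designation if $d_X(g\cdot x_i,0)<\delta$ for all $i\in I$, $g\in\partial_EA_i$. An $\epsilon$-realization of it is a point $y\in X$ with $d_X(g\cdot y,g\cdot x_i)<\epsilon$ whenever $g\in A_i$. **Tiered systems.** A tiered dynamical system (TDS) $\mathcal{X}=(X,(G_t,X_t)_{t\in\mathcal{T}},(\phi^{t'}_t)_{t\le t'})$ consists of: a compact metric space $X$ (the ambient space) with a special point $0$; a directed set $\mathcal{T}$ with least element $t_0$;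 for each $t\in\mathcal{T}$ an expansive pointed dynamical system $(G_t,X_t)$ with $0\in X_t\subseteq X$ (special point $0$, metric restricted from $X$), where $X_t\subseteq X_{t'}$ whenever $t\le t'$; and for all $t\le t'$ a finite-to-one surjective homomorphism $\phi^{t'}_t:G_{t'}\to G_t$ with $\phi^t_t=\mathrm{id}$, $\phi^{t'}_t\circ\phi^{t''}_{t'}=\phi^{t''}_t$ for $t\le t'\le t''$, and $\phi^{t'}_t(g)\cdot x=g\cdot x$ for all $x\in X_t$, $g\in G_{t'}$. Its base group is $G_{t_0}$. The indices $t$ (or the sets $X_t$) are called tiers. An evolution of $\mathcal{X}$ is a continuous $f:X\to X$ such that for all $t\le t'$ and $x\in X_t$, if $f(x)\in X_{t'}$ then $f(\phi^{t'}_t(g)\cdot x)=g\cdot f(x)$ for all $g\in G_{t'}$. The pair $(\mathcal{X},f)$ is called an ETDS. **Properties.** $\mathcal{X}$ is $f$-stabilizing if for every $t$ there is $s(t)\ge t$ with $f^k(X_t)\subseteq X_{s(t)}$ for all $k\in\mathbb{N}$. $\mathcal{X}$ is weakly $0$-gluing if for every $t$ there is $w(t)\ge t$ such that for all $\epsilon>0$ there exist $\delta>0$ and a finite $E\subseteq G_{w(t)}$ such that every $(\delta,E)$-designation $(A_i,x_i)_{i\in I}$ in $(G_{w(t)},X_{w(t)})$ with all $x_i\in X_t$ has an $\epsilon$-realization in $X_{w(t)}$. $\mathcal{X}$ has weakly dense homoclinic points if for all $t$, $x\in X_t$, $\epsilon>0$ there are $t'\ge t$ and $y\in X_{t'}$,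 homoclinic in $(G_{t'},X_{t'})$, with $d_X(x,y)<\epsilon$. **Classes.** $\mathfrak{C}_2$ is the class of ETDSs $(\mathcal{X},f)$ such that $\mathcal{X}$ is $f$-stabilizing, weakly $0$-gluing and has weakly dense homoclinic points. $\mathfrak{C}_3$ is the class of those $(\mathcal{X},f)\in\mathfrak{C}_2$ for which every group $G_t$ is residually finite. **Nil-rigidity.** An evolution $f$ is asymptotically nilpotent if $\lim_{n\to\infty}f^n(x)=0$ for all $x$ in the ambient space $X$, and nilpotent on $Y\subseteq X$ if there is $n\in\mathbb{N}$ with $f^n(x)=0$ for all $x\in Y$. A group $G$ is nil-rigid on a class $\mathfrak{C}$ of ETDSs if for every $(\mathcal{X},f)\in\mathfrak{C}$ with base group $G$ and $f$ asymptotically nilpotent, $f$ is nilpotent on each tier $X_t$. *)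

theory Defs
  imports "HOL-Analysis.Analysis" "HOL-Algebra.Group_Action" "HOL-Algebra.Generated_Groups"
begin

section \<open>Groups\<close>

definition residually_finite :: "('g, 'm) monoid_scheme \<Rightarrow> bool" where
  "residually_finite G \<longleftrightarrow>
     (\<forall>g\<in>carrier G. g \<noteq> \<one>\<^bsub>G\<^esub> \<longrightarrow> (\<exists>N. N \<lhd> G \<and> finite (rcosets\<^bsub>G\<^esub> N) \<and> g \<notin> N))"

definition virtually_abelian :: "('g, 'm) monoid_scheme \<Rightarrow> bool" where
  "virtually_abelian G \<longleftrightarrow>
     (\<exists>K. subgroup K G \<and> comm_group (G\<lparr>carrier := K\<rparr>) \<and> finite (rcosets\<^bsub>G\<^esub> K))"

definition locally_virtually_abelian :: "('g, 'm) monoid_scheme \<Rightarrow> bool" where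
  "locally_virtually_abelian G \<longleftrightarrow>
     (\<forall>S. finite S \<and> S \<subseteq> carrier G \<longrightarrow> virtually_abelian (G\<lparr>carrier := generate G S\<rparr>))"

definition subnormal_series :: "('g, 'm) monoid_scheme \<Rightarrow> nat \<Rightarrow> (nat \<Rightarrow> 'g set) \<Rightarrow> bool" where
  "subnormal_series G n H \<longleftrightarrow>
     H 0 = {\<one>\<^bsub>G\<^esub>} \<and> H n = carrier G \<and> (\<forall>k\<le>n. subgroup (H k) G) \<and>
     (\<forall>k<n. H k \<lhd> G\<lparr>carrier := H (Suc k)\<rparr>)"


section \<open>Pointed dynamical systems\<close>

text \<open>
  A pointed system is given by a group \<open>G\<close>, a space \<open>X\<close> (a subset of an ambient metric type), the
  action \<open>\<alpha>\<close> and the fixed point \<open>z\<close> (written 0 in the text). The group is discrete, so the action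
  is continuous iff every \<open>\<alpha> g\<close> is. The predicate \<open>group_action\<close> makes every \<open>\<alpha> g\<close> a bijection of
  \<open>X\<close> taking the value \<open>undefined\<close> off \<open>X\<close>.
\<close>

definition pointed_system ::
    "('g, 'm) monoid_scheme \<Rightarrow> 'x::metric_space set \<Rightarrow> ('g \<Rightarrow> 'x \<Rightarrow> 'x) \<Rightarrow> 'x \<Rightarrow> bool" where
  "pointed_system G X \<alpha> z \<longleftrightarrow>
     compact X \<and> group_action G X \<alpha> \<and> (\<forall>g\<in>carrier G. continuous_on X (\<alpha> g)) \<and>
     z \<in> X \<and> (\<forall>g\<in>carrier G. \<alpha> g z = z)"

definition expansive ::
    "('g, 'm) monoid_scheme \<Rightarrow> 'x::metric_space set \<Rightarrow> ('g \<Rightarrow> 'x \<Rightarrow> 'x) \<Rightarrow> bool" where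
  "expansive G X \<alpha> \<longleftrightarrow>
     (\<exists>\<Delta>. 0 < \<Delta> \<and> \<Delta> \<le> 1 \<and>
        (\<forall>x\<in>X. \<forall>y\<in>X. (\<forall>g\<in>carrier G. dist (\<alpha> g x) (\<alpha> g y) \<le> \<Delta>) \<longrightarrow> x = y))"

definition homoclinic ::
    "('g, 'm) monoid_scheme \<Rightarrow> 'x::metric_space set \<Rightarrow> ('g \<Rightarrow> 'x \<Rightarrow> 'x) \<Rightarrow> 'x \<Rightarrow> 'x \<Rightarrow> bool" where
  "homoclinic G X \<alpha> z x \<longleftrightarrow>
     x \<in> X \<and>
     (\<forall>\<epsilon>>0. \<exists>E. finite E \<and> E \<subseteq> carrier G \<and> (\<forall>g\<in>carrier G - E. dist (\<alpha> g x) z < \<epsilon>))"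

definition boundary :: "('g, 'm) monoid_scheme \<Rightarrow> 'g set \<Rightarrow> 'g set \<Rightarrow> 'g set" where
  "boundary G E A = {g \<in> A. \<not> E #>\<^bsub>G\<^esub> g \<subseteq> A}"

text \<open>Cells \<open>A i\<close> are allowed to be empty; such a cell constrains neither the designation (beyond
  \<open>x i \<in> X\<close>) nor its realizations.\<close>

definition designation ::
    "('g, 'm) monoid_scheme \<Rightarrow> 'x set \<Rightarrow> 'i set \<Rightarrow> ('i \<Rightarrow> 'g set) \<Rightarrow> ('i \<Rightarrow> 'x) \<Rightarrow> bool" where
  "designation G X I A x \<longleftrightarrow>
     disjoint_family_on A I \<and> (\<Union>i\<in>I. A i) = carrier G \<and> (\<forall>i\<in>I. x i \<in> X)"

definition de_designation ::
    "('g, 'm) monoid_scheme \<Rightarrow> 'x::metric_space set \<Rightarrow> ('g \<Rightarrow> 'x \<Rightarrow> 'x) \<Rightarrow> 'x \<Rightarrow> real \<Rightarrow> 'g set \<Rightarrow>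
     'i set \<Rightarrow> ('i \<Rightarrow> 'g set) \<Rightarrow> ('i \<Rightarrow> 'x) \<Rightarrow> bool" where
  "de_designation G X \<alpha> z \<delta> E I A x \<longleftrightarrow>
     designation G X I A x \<and> (\<forall>i\<in>I. \<forall>g\<in>boundary G E (A i). dist (\<alpha> g (x i)) z < \<delta>)"

definition realization ::
    "'x::metric_space set \<Rightarrow> ('g \<Rightarrow> 'x \<Rightarrow> 'x) \<Rightarrow> real \<Rightarrow>
     'i set \<Rightarrow> ('i \<Rightarrow> 'g set) \<Rightarrow> ('i \<Rightarrow> 'x) \<Rightarrow> 'x \<Rightarrow> bool" where
  "realization X \<alpha> \<epsilon> I A x y \<longleftrightarrow>
     y \<in> X \<and> (\<forall>i\<in>I. \<forall>g\<in>A i. dist (\<alpha> g y) (\<alpha> g (x i)) < \<epsilon>)"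


section \<open>Tiered dynamical systems\<close>

text \<open>
  All groups \<open>grp S t\<close> have their carriers in one type \<open>'g\<close>; up to relabelling every family of groups
  is of this form. The field \<open>conn S t t'\<close> is the map \<open>\<phi>\<close> from \<open>grp S t'\<close> to \<open>grp S t\<close>.
\<close>

record ('t, 'g, 'x) tds =
  ambient :: "'x set"
  origin :: 'x
  tiers :: "'t set"
  tle :: "'t \<Rightarrow> 't \<Rightarrow> bool"
  base :: 't
  grp :: "'t \<Rightarrow> 'g monoid"
  tier :: "'t \<Rightarrow> 'x set"
  act :: "'t \<Rightarrow> 'g \<Rightarrow> 'x \<Rightarrow> 'x"
  conn :: "'t \<Rightarrow> 't \<Rightarrow> 'g \<Rightarrow> 'g"

definition directed_with_least :: "'t set \<Rightarrow> ('t \<Rightarrow> 't \<Rightarrow> bool) \<Rightarrow> 't \<Rightarrow> bool" where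
  "directed_with_least T R t0 \<longleftrightarrow>
     (\<forall>t\<in>T. R t t) \<and>
     (\<forall>t\<in>T. \<forall>t'\<in>T. \<forall>t''\<in>T. R t t' \<longrightarrow> R t' t'' \<longrightarrow> R t t'') \<and>
     (\<forall>t\<in>T. \<forall>t'\<in>T. \<exists>u\<in>T. R t u \<and> R t' u) \<and>
     t0 \<in> T \<and> (\<forall>t\<in>T. R t0 t)"

definition is_tds :: "('t, 'g, 'x::metric_space) tds \<Rightarrow> bool" where
  "is_tds S \<longleftrightarrow>
     compact (ambient S) \<and> origin S \<in> ambient S \<and>
     directed_with_least (tiers S) (tle S) (base S) \<and>
     (\<forall>t\<in>tiers S. tier S t \<subseteq> ambient S \<and>
        pointed_system (grp S t) (tier S t) (act S t) (origin S) \<and>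
        expansive (grp S t) (tier S t) (act S t)) \<and>
     (\<forall>t\<in>tiers S. \<forall>t'\<in>tiers S. tle S t t' \<longrightarrow>
        tier S t \<subseteq> tier S t' \<and>
        conn S t t' \<in> hom (grp S t') (grp S t) \<and>
        conn S t t' ` carrier (grp S t') = carrier (grp S t) \<and>
        (\<forall>h\<in>carrier (grp S t). finite {g \<in> carrier (grp S t'). conn S t t' g = h}) \<and>
        (\<forall>g\<in>carrier (grp S t'). \<forall>x\<in>tier S t. act S t (conn S t t' g) x = act S t' g x)) \<and>
     (\<forall>t\<in>tiers S. \<forall>g\<in>carrier (grp S t). conn S t t g = g) \<and>
     (\<forall>t\<in>tiers S. \<forall>t'\<in>tiers S. \<forall>t''\<in>tiers S. tle S t t' \<longrightarrow> tle S t' t'' \<longrightarrow>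
        (\<forall>g\<in>carrier (grp S t''). conn S t t' (conn S t' t'' g) = conn S t t'' g))"

definition evolution :: "('t, 'g, 'x::metric_space) tds \<Rightarrow> ('x \<Rightarrow> 'x) \<Rightarrow> bool" where
  "evolution S f \<longleftrightarrow>
     f \<in> ambient S \<rightarrow> ambient S \<and> continuous_on (ambient S) f \<and>
     (\<forall>t\<in>tiers S. \<forall>t'\<in>tiers S. tle S t t' \<longrightarrow>
        (\<forall>x\<in>tier S t. f x \<in> tier S t' \<longrightarrow>
           (\<forall>g\<in>carrier (grp S t'). f (act S t (conn S t t' g) x) = act S t' g (f x))))"

definition stabilizing :: "('t, 'g, 'x) tds \<Rightarrow> ('x \<Rightarrow> 'x) \<Rightarrow> bool" where
  "stabilizing S f \<longleftrightarrow>
     (\<forall>t\<in>tiers S. \<exists>s\<in>tiers S. tle S t s \<and> (\<forall>k. (f ^^ k) ` tier S t \<subseteq> tier S s))"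

text \<open>
  In HOL the index type of the designations has to be fixed. Index sets of type \<open>'g set set\<close> lose no
  generality: after dropping empty cells, a partition of the group can be indexed by its own cells.
\<close>

definition weakly_zero_gluing :: "('t, 'g, 'x::metric_space) tds \<Rightarrow> bool" where
  "weakly_zero_gluing S \<longleftrightarrow>
     (\<forall>t\<in>tiers S. \<exists>w\<in>tiers S. tle S t w \<and>
        (\<forall>\<epsilon>>0. \<exists>\<delta>>0. \<exists>E. finite E \<and> E \<subseteq> carrier (grp S w) \<and>
           (\<forall>(I :: 'g set set) A x.
              de_designation (grp S w) (tier S w) (act S w) (origin S) \<delta> E I A x \<and>
              (\<forall>i\<in>I. x i \<in> tier S t) \<longrightarrow>
              (\<exists>y. realization (tier S w) (act S w) \<epsilon> I A x y))))"

definition weakly_dense_homoclinic :: "('t, 'g, 'x::metric_space) tds \<Rightarrow> bool" where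
  "weakly_dense_homoclinic S \<longleftrightarrow>
     (\<forall>t\<in>tiers S. \<forall>x\<in>tier S t. \<forall>\<epsilon>>0. \<exists>t'\<in>tiers S. tle S t t' \<and>
        (\<exists>y. homoclinic (grp S t') (tier S t') (act S t') (origin S) y \<and> dist x y < \<epsilon>))"

definition class_C2 :: "(('t, 'g, 'x::metric_space) tds \<times> ('x \<Rightarrow> 'x)) set" where
  "class_C2 = {(S, f). is_tds S \<and> evolution S f \<and> stabilizing S f \<and>
                       weakly_zero_gluing S \<and> weakly_dense_homoclinic S}"

definition class_C3 :: "(('t, 'g, 'x::metric_space) tds \<times> ('x \<Rightarrow> 'x)) set" where
  "class_C3 = {(S, f) \<in> class_C2. \<forall>t\<in>tiers S. residually_finite (grp S t)}"


section \<open>Nil-rigidity\<close>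

definition asymptotically_nilpotent ::
    "('t, 'g, 'x::metric_space) tds \<Rightarrow> ('x \<Rightarrow> 'x) \<Rightarrow> bool" where
  "asymptotically_nilpotent S f \<longleftrightarrow>
     (\<forall>x\<in>ambient S. (\<lambda>n. (f ^^ n) x) \<longlonglongrightarrow> origin S)"

definition nilpotent_on :: "('t, 'g, 'x) tds \<Rightarrow> ('x \<Rightarrow> 'x) \<Rightarrow> 'x set \<Rightarrow> bool" where
  "nilpotent_on S f Y \<longleftrightarrow> (\<exists>n. \<forall>x\<in>Y. (f ^^ n) x = origin S)"

text \<open>
  ``With base group \<open>G\<close>'' is read up to isomorphism, so that \<open>G\<close> need not live in the type carrying
  the groups of the system.
\<close>

definition nil_rigid ::
    "('a, 'm) monoid_scheme \<Rightarrow> (('t, 'g, 'x::metric_space) tds \<times> ('x \<Rightarrow> 'x)) set \<Rightarrow> bool" where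
  "nil_rigid G C \<longleftrightarrow>
     (\<forall>(S, f)\<in>C. G \<cong> grp S (base S) \<and> asymptotically_nilpotent S f \<longrightarrow>
        (\<forall>t\<in>tiers S. nilpotent_on S f (tier S t)))"

end

theory Submission imports Defs begin

text \<open>
  Call a point dying if \<open>f\<close> takes it to \<open>0\<close> in finitely many steps. The theorem has two halves:
  every homoclinic point dies (\<open>homoclinic_dies\<close>), and this forces nilpotency on each tier
  (\<open>nilpotent_of_homoclinic_dies\<close>).

  For the second half, the Baire category theorem gives an open set of points that stay near \<open>0\<close> from
  a common time on, and this set contains a homoclinic point \<open>w\<close>. If \<open>y\<close> is small on a large finite set,
  it can be glued to \<open>w\<close>; once \<open>w\<close> has died, the glued point has the same future as \<open>y\<close>. So
  points that are small on that set stay near \<open>0\<close>. Every orbit enters this situation, by compactness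
  after a bounded time, and expansiveness turns ``always near \<open>0\<close> under the whole group'' into
  ``equal to \<open>0\<close>''.

  For the first half, all initial points are sums \<open>ptsum S\<close> of translates of one homoclinic point \<open>x\<close>, so
  that sets \<open>S\<close> of group elements behave like the configurations of a cellular automaton. Since only such
  sums, and sums of their images, are ever glued, the whole argument takes place at one fixed tier, with
  one expansivity constant and one finite window for \<open>f\<close>. The statement that descends along the subnormal
  series is \<open>confined F B\<close>: sums over subsets of \<open>B\<close> remain supported on \<open>F <#> B\<close> forever. It
  holds for the whole group, and once it holds for a finite \<open>B\<close>, the orbit of \<open>x\<close> has only finitely many
  places to go to, so \<open>x\<close> dies. Confinement passes to any subgroup of \<open>B\<close> that contains certain finitely
  many elements (\<open>confined_local\<close>), to finite index subgroups (\<open>confined_finite_index\<close>) and to the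
  kernel of a homomorphism onto the integers (\<open>confined_kernel\<close>). A locally virtually abelian factor is
  handled by these three: pass to a finitely generated subgroup, then to a finite index subgroup
  that is abelian modulo the next term, and then drop the generators one at a time.

  The heart is the infinite cyclic quotient. Baire's argument yields walls: finite index sets near which
  nothing is seen after some time, whatever is added far away (\<open>wall_exists\<close>). A wall that dies by itself
  makes \<open>0\<close> stable, because it can be added to any distant sum without changing the future. For a
  wall repeated along a finite index subgroup \<open>M\<close> of the kernel, which exists by residual finiteness,
  this stability says exactly that nothing crosses a coset of the kernel. So one has to show that such
  periodic walls die. Modulo \<open>M\<close> the group is virtually infinite cyclic, and a second, \<open>M\<close>-invariant wall
  \<open>V\<close> really separates left from right. Periodic arrangements of copies of \<open>V\<close> die, since they have
  only finitely many places up to their periods; hence so does a full row of copies with a single gap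
  (\<open>hole_dies\<close>). If two neighbouring copies of \<open>V\<close> did not die, they would send something arbitrarily
  far to one side, and near its front it would look just like what comes out of one end of a very long
  gap. But rows with a gap die, so infinitely many of them can be glued such that each
  visits a fixed place, later than the previous one, and is dead before it meets the next
  (\<open>no_wandering\<close>). This contradicts asymptotic nilpotency.
\<close>

section \<open>Products of subsets of a group and finite index\<close>

context group begin

lemma finite_set_mult: "finite A \<Longrightarrow> finite B \<Longrightarrow> finite (A <#> B)"
  unfolding set_mult_def by auto

lemma set_multI: "a \<in> A \<Longrightarrow> b \<in> B \<Longrightarrow> a \<otimes> b \<in> A <#> B"
  unfolding set_mult_def by auto

lemma set_multE:
  assumes "g \<in> A <#> B" obtains a b where "a \<in> A" "b \<in> B" "g = a \<otimes> b"
  using assms unfolding set_mult_def by auto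

lemma subset_set_mult: "\<one> \<in> A \<Longrightarrow> B \<subseteq> carrier G \<Longrightarrow> B \<subseteq> A <#> B"
  using set_multI[of \<one> A] by (metis l_one subsetD subsetI)

lemma subset_set_mult_right: "\<one> \<in> B \<Longrightarrow> A \<subseteq> carrier G \<Longrightarrow> A \<subseteq> A <#> B"
  using set_multI[of _ A \<one> B] by (metis r_one subsetD subsetI)

text \<open>In a residually finite group, some normal subgroup of finite index avoids a given finite set.\<close>

lemma residually_finite_avoid:
  assumes rf: "residually_finite G" and A: "finite A" "A \<subseteq> carrier G"
  shows "\<exists>N T. N \<lhd> G \<and> finite T \<and> T \<subseteq> carrier G \<and> carrier G \<subseteq> T <#> N \<and> N \<inter> A \<subseteq> {\<one>}"
proof -
  have "\<exists>N. N \<lhd> G \<and> finite (rcosets N) \<and> N \<inter> A \<subseteq> {\<one>}"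
    using A
  proof (induction A rule: finite_induct)
    case empty
    have N: "carrier G \<lhd> G" by (rule normal_invI[OF subgroup_self]) auto
    have "rcosets (carrier G) \<subseteq> {carrier G}"
      unfolding RCOSETS_def using coset_join2[OF _ subgroup_self] by auto
    then show ?case using N finite_subset by blast
  next
    case (insert a A)
    then obtain N where N: "N \<lhd> G" "finite (rcosets N)" "N \<inter> A \<subseteq> {\<one>}" by auto
    show ?case
    proof (cases "a = \<one>")
      case True
      then show ?thesis using N by auto
    next
      case False
      then obtain N' where N': "N' \<lhd> G" "finite (rcosets N')" "a \<notin> N'"
        using rf insert.prems unfolding residually_finite_def by auto
      have sub: "N \<subseteq> carrier G" "N' \<subseteq> carrier G"
        using N(1) N'(1) normal_imp_subgroup subgroup.subset by blast+
      have "(N \<inter> N') #> g = (N #> g) \<inter> (N' #> g)" if "g \<in> carrier G" for g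
      proof
        show "(N \<inter> N') #> g \<subseteq> (N #> g) \<inter> (N' #> g)" unfolding r_coset_def by auto
        show "(N #> g) \<inter> (N' #> g) \<subseteq> (N \<inter> N') #> g"
        proof
          fix y assume "y \<in> (N #> g) \<inter> (N' #> g)"
          then obtain p q where pq: "p \<in> N" "q \<in> N'" "y = p \<otimes> g" "p \<otimes> g = q \<otimes> g"
            unfolding r_coset_def by auto
          then have "p = q" using that sub by (metis right_cancel subsetD)
          then show "y \<in> (N \<inter> N') #> g" using pq unfolding r_coset_def by auto
        qed
      qed
      then have "rcosets (N \<inter> N') \<subseteq> (\<lambda>(X, Y). X \<inter> Y) ` ((rcosets N) \<times> (rcosets N'))"
        unfolding RCOSETS_def by auto
      then have "finite (rcosets (N \<inter> N'))"
        using N(2) N'(2) finite_subset by blast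
      moreover have "N \<inter> N' \<lhd> G" using N(1) N'(1) by (rule normal_subgroup_intersect)
      ultimately show ?thesis using N(3) N'(3) by blast
    qed
  qed
  then obtain N where N: "N \<lhd> G" "finite (rcosets N)" "N \<inter> A \<subseteq> {\<one>}" by blast
  have Ns: "subgroup N G" using N(1) by (rule normal_imp_subgroup)
  define T where "T = (\<lambda>R. SOME g. g \<in> R) ` (rcosets N)"
  have rep: "(SOME t. t \<in> N #> g) \<in> N #> g" if "g \<in> carrier G" for g
    using rcos_self[OF that Ns] by (rule someI)
  have "T \<subseteq> carrier G"
  proof
    fix t assume "t \<in> T"
    then obtain g where "g \<in> carrier G" "t = (SOME t. t \<in> N #> g)" unfolding T_def RCOSETS_def by auto
    then have "t \<in> N #> g" "N #> g \<subseteq> carrier G"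
      using rep r_coset_subset_G subgroup.subset[OF Ns] by auto
    then show "t \<in> carrier G" by blast
  qed
  moreover have "g \<in> T <#> N" if g: "g \<in> carrier G" for g
  proof -
    define t where "t = (SOME t. t \<in> N #> g)"
    have "t \<in> T" unfolding T_def t_def RCOSETS_def using g by blast
    have "N #> g = N #> t" using repr_independence[OF rep[OF g] g Ns] unfolding t_def .
    then have "g \<in> N #> t" using rcos_self[OF g Ns] by simp
    also have "N #> t = t <# N" using normal.coset_eq[OF N(1)] \<open>t \<in> T\<close> \<open>T \<subseteq> carrier G\<close> by blast
    finally show ?thesis using \<open>t \<in> T\<close> unfolding l_coset_def set_mult_def by blast
  qed
  ultimately show ?thesis using N unfolding T_def by blast
qed

text \<open>A homomorphism to a group in which the image of \<open>U\<close> generates a virtually abelian group yields a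
  finite index subgroup of \<open>generate G U\<close> whose commutators lie in the kernel.\<close>

lemma virtually_abelian_pullback:
  fixes Q :: "('q, 'r) monoid_scheme"
  assumes B: "subgroup B G" and Q: "group Q"
    and c_in: "\<And>g. g \<in> B \<Longrightarrow> c g \<in> carrier Q"
    and c_mult: "\<And>g g'. g \<in> B \<Longrightarrow> g' \<in> B \<Longrightarrow> c (g \<otimes> g') = c g \<otimes>\<^bsub>Q\<^esub> c g'"
    and U: "U \<subseteq> B" and va: "virtually_abelian (Q\<lparr>carrier := generate Q (c ` U)\<rparr>)"
  shows "\<exists>L T. subgroup L G \<and> L \<subseteq> generate G U \<and> finite T \<and> T \<subseteq> carrier G \<and> generate G U \<subseteq> T <#> L \<and>
    (\<forall>a\<in>L. \<forall>b\<in>L. c (inv a \<otimes> (inv b \<otimes> (a \<otimes> b))) = \<one>\<^bsub>Q\<^esub>)"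
proof -
  interpret Q: group Q by (rule Q)
  have BG: "B \<subseteq> carrier G" using subgroup.subset[OF B] .
  have Bc: "a \<otimes> b \<in> B" "inv a \<in> B" "\<one> \<in> B" if "a \<in> B" "b \<in> B" for a b
    using that B by (auto simp: subgroup.m_closed subgroup.m_inv_closed subgroup.one_closed)
  have oneB: "\<one> \<in> B" using subgroup.one_closed[OF B] .
  have "c \<one> \<otimes>\<^bsub>Q\<^esub> c \<one> = c \<one>" using c_mult[OF oneB oneB] by simp
  then have c_one: "c \<one> = \<one>\<^bsub>Q\<^esub>" using c_in[OF oneB] Q.l_cancel_one by metis
  have c_inv: "c (inv g) = inv\<^bsub>Q\<^esub> (c g)" if g: "g \<in> B" for g
  proof -
    have "c (inv g) \<otimes>\<^bsub>Q\<^esub> c g = \<one>\<^bsub>Q\<^esub>" using c_mult[of "inv g" g] Bc[OF g g] g BG c_one by auto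
    then show ?thesis using Q.inv_equality[of "c (inv g)" "c g"] c_in Bc[OF g g] g by auto
  qed
  define S where "S = generate Q (c ` U)"
  have SQ: "subgroup S Q" unfolding S_def by (rule Q.generate_is_subgroup) (use c_in U in auto)
  interpret S: group "Q\<lparr>carrier := S\<rparr>" by (rule Q.subgroup_imp_group[OF SQ])
  obtain A where A: "subgroup A (Q\<lparr>carrier := S\<rparr>)" "comm_group (Q\<lparr>carrier := S\<rparr>\<lparr>carrier := A\<rparr>)"
    "finite (rcosets\<^bsub>Q\<lparr>carrier := S\<rparr>\<^esub> A)"
    using va unfolding virtually_abelian_def S_def by auto
  have AQ: "subgroup A Q" by (rule Q.incl_subgroup[OF SQ A(1)])
  have A_comm: "a \<otimes>\<^bsub>Q\<^esub> b = b \<otimes>\<^bsub>Q\<^esub> a" if "a \<in> A" "b \<in> A" for a b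
    using comm_monoid.m_comm[OF comm_group.axioms(1)[OF A(2)], of a b] that by simp
  define P where "P = generate G U"
  have P: "subgroup P G" unfolding P_def by (rule generate_is_subgroup) (use U BG in auto)
  have PB: "P \<subseteq> B" unfolding P_def by (rule generate_subgroup_incl[OF U B])
  have cS: "c g \<in> S" if "g \<in> P" for g
    using that unfolding P_def
  proof (induction g rule: generate.induct)
    case one then show ?case using c_one subgroup.one_closed[OF SQ] by simp
  next
    case (incl a) then show ?case unfolding S_def by (intro generate.incl) auto
  next
    case (inv a)
    then have "c a \<in> S" unfolding S_def by (intro generate.incl) auto
    then show ?case using c_inv[of a] inv U subgroup.m_inv_closed[OF SQ] by auto
  next
    case (eng a b)
    then have "a \<in> B" "b \<in> B" using PB unfolding P_def by auto
    then show ?case using c_mult eng subgroup.m_closed[OF SQ] by auto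
  qed
  define L where "L = {g \<in> P. c g \<in> A}"
  have LP: "L \<subseteq> P" unfolding L_def by auto
  have LG: "L \<subseteq> carrier G" using LP PB BG by blast
  have L: "subgroup L G"
  proof (rule subgroupI)
    show "L \<subseteq> carrier G" by (rule LG)
    have "\<one> \<in> L" unfolding L_def using c_one subgroup.one_closed[OF P] subgroup.one_closed[OF AQ] by simp
    then show "L \<noteq> {}" by blast
    show "inv a \<in> L" if "a \<in> L" for a
      using that PB c_inv[of a] subgroup.m_inv_closed[OF P] subgroup.m_inv_closed[OF AQ] unfolding L_def by auto
    show "a \<otimes> b \<in> L" if "a \<in> L" "b \<in> L" for a b
    proof -
      have "a \<in> B" "b \<in> B" using that PB unfolding L_def by auto
      then show ?thesis using that c_mult[of a b] subgroup.m_closed[OF P] subgroup.m_closed[OF AQ]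
        unfolding L_def by auto
    qed
  qed
  define rc where "rc g = A #>\<^bsub>Q\<lparr>carrier := S\<rparr>\<^esub> c g" for g
  define rp where "rp v = (SOME g. g \<in> P \<and> rc g = v)" for v
  have rp: "rp (rc g) \<in> P" "rc (rp (rc g)) = rc g" if "g \<in> P" for g
    using someI[of "\<lambda>g'. g' \<in> P \<and> rc g' = rc g" g] that unfolding rp_def by auto
  have "rc ` P \<subseteq> rcosets\<^bsub>Q\<lparr>carrier := S\<rparr>\<^esub> A" unfolding rc_def RCOSETS_def using cS by auto
  then have fin: "finite (rc ` P)" using A(3) finite_subset by blast
  define T where "T = (\<lambda>v. inv (rp v)) ` rc ` P"
  have T: "finite T" "T \<subseteq> carrier G" unfolding T_def using fin rp(1) PB BG by auto
  have cover: "b \<in> T <#> L" if b: "b \<in> P" for b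
  proof -
    define b' where "b' = inv b"
    have b': "b' \<in> P" unfolding b'_def using b subgroup.m_inv_closed[OF P] by simp
    define g where "g = rp (rc b')"
    have g: "g \<in> P" "rc g = rc b'" unfolding g_def using rp[OF b'] by auto
    have inB: "b \<in> B" "b' \<in> B" "g \<in> B" using b b' g PB by auto
    have G: "b \<in> carrier G" "b' \<in> carrier G" "g \<in> carrier G" using inB BG by auto
    have "c b' \<in> A #>\<^bsub>Q\<lparr>carrier := S\<rparr>\<^esub> c b'" using S.rcos_self[OF _ A(1), of "c b'"] cS[OF b'] by simp
    then have "c b' \<in> A #>\<^bsub>Q\<lparr>carrier := S\<rparr>\<^esub> c g" using g(2) unfolding rc_def by simp
    then obtain a where a: "a \<in> A" "c b' = a \<otimes>\<^bsub>Q\<^esub> c g" unfolding r_coset_def by auto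
    have aQ: "a \<in> carrier Q" using a(1) subgroup.subset[OF AQ] by auto
    have "c (b' \<otimes> inv g) = a \<otimes>\<^bsub>Q\<^esub> c g \<otimes>\<^bsub>Q\<^esub> inv\<^bsub>Q\<^esub> c g"
      using c_mult[of b' "inv g"] c_inv inB Bc a(2) by auto
    also have "\<dots> = a" using aQ c_in[OF inB(3)] by (simp add: Q.m_assoc)
    finally have "c (b' \<otimes> inv g) \<in> A" using a(1) by simp
    moreover have "b' \<otimes> inv g \<in> P" using b' g(1) P by (simp add: subgroup.m_closed subgroup.m_inv_closed)
    ultimately have "b' \<otimes> inv g \<in> L" unfolding L_def by blast
    then have "inv (b' \<otimes> inv g) \<in> L" using subgroup.m_inv_closed[OF L] by blast
    moreover have "inv g \<in> T" unfolding T_def g_def using b' by blast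
    ultimately have "inv g \<otimes> inv (b' \<otimes> inv g) \<in> T <#> L" by (intro set_multI)
    moreover have "inv g \<otimes> inv (b' \<otimes> inv g) = b"
      unfolding b'_def using G by (simp add: inv_mult_group m_assoc[symmetric])
    ultimately show ?thesis by simp
  qed
  have "c (inv a \<otimes> (inv b \<otimes> (a \<otimes> b))) = \<one>\<^bsub>Q\<^esub>" if ab: "a \<in> L" "b \<in> L" for a b
  proof -
    have inB: "a \<in> B" "b \<in> B" using ab LP PB by auto
    have Qc: "c a \<in> carrier Q" "c b \<in> carrier Q" using c_in inB by auto
    have "c (inv a \<otimes> (inv b \<otimes> (a \<otimes> b))) = inv\<^bsub>Q\<^esub> c a \<otimes>\<^bsub>Q\<^esub> (inv\<^bsub>Q\<^esub> c b \<otimes>\<^bsub>Q\<^esub> (c a \<otimes>\<^bsub>Q\<^esub> c b))"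
      using inB Bc c_mult c_inv by simp
    also have "c a \<otimes>\<^bsub>Q\<^esub> c b = c b \<otimes>\<^bsub>Q\<^esub> c a" using A_comm ab unfolding L_def by blast
    also have "inv\<^bsub>Q\<^esub> c b \<otimes>\<^bsub>Q\<^esub> (c b \<otimes>\<^bsub>Q\<^esub> c a) = c a" using Qc by (simp add: Q.m_assoc[symmetric])
    also have "inv\<^bsub>Q\<^esub> c a \<otimes>\<^bsub>Q\<^esub> c a = \<one>\<^bsub>Q\<^esub>" using Qc by simp
    finally show ?thesis .
  qed
  moreover have "P \<subseteq> T <#> L" using cover by blast
  ultimately show ?thesis unfolding P_def[symmetric]
    by (intro exI[of _ L] exI[of _ T] conjI ballI L LP T) simp_all
qed

end

lemma fixed_point_of_limit:
  fixes f :: "'a::t2_space \<Rightarrow> 'a"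
  assumes "continuous_on A f" "\<And>x. x \<in> A \<Longrightarrow> f x \<in> A" "z \<in> A" "(\<lambda>n. (f ^^ n) z) \<longlonglongrightarrow> z"
  shows "f z = z"
proof -
  have "(f ^^ n) z \<in> A" for n by (induction n) (simp_all add: assms)
  then have "(\<lambda>n. f ((f ^^ n) z)) \<longlonglongrightarrow> f z"
    by (intro continuous_on_tendsto_compose[OF assms(1,4,3)]) simp
  then show ?thesis using LIMSEQ_Suc[OF assms(4)] LIMSEQ_unique by simp
qed

section \<open>Expansive systems with an asymptotically nilpotent equivariant map\<close>

text \<open>One tier at a time: in the application \<open>Y\<close> consists of those points of a tier whose orbit under \<open>f\<close>
  never leaves it, so that \<open>f\<close> commutes with the full group of this tier.\<close>

locale nil_system = group G for G :: "('g, 'm) monoid_scheme" (structure) +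
  fixes Y :: "'x::metric_space set" and act :: "'g \<Rightarrow> 'x \<Rightarrow> 'x" and z :: 'x
    and f :: "'x \<Rightarrow> 'x" and \<Delta> :: real
  assumes compact_Y: "compact Y"
    and z_in: "z \<in> Y"
    and act_in: "g \<in> carrier G \<Longrightarrow> y \<in> Y \<Longrightarrow> act g y \<in> Y"
    and act_mult: "g \<in> carrier G \<Longrightarrow> h \<in> carrier G \<Longrightarrow> y \<in> Y \<Longrightarrow> act (g \<otimes> h) y = act g (act h y)"
    and act_one: "y \<in> Y \<Longrightarrow> act \<one> y = y"
    and act_cont: "g \<in> carrier G \<Longrightarrow> continuous_on Y (act g)"
    and act_z: "g \<in> carrier G \<Longrightarrow> act g z = z"
    and f_in: "y \<in> Y \<Longrightarrow> f y \<in> Y"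
    and f_cont: "continuous_on Y f"
    and f_act: "g \<in> carrier G \<Longrightarrow> y \<in> Y \<Longrightarrow> f (act g y) = act g (f y)"
    and f_tendsto: "y \<in> Y \<Longrightarrow> (\<lambda>n. (f ^^ n) y) \<longlonglongrightarrow> z"
    and \<Delta>_pos: "0 < \<Delta>"
    and expansiveness: "x \<in> Y \<Longrightarrow> y \<in> Y \<Longrightarrow>
      (\<And>g. g \<in> carrier G \<Longrightarrow> dist (act g x) (act g y) \<le> \<Delta>) \<Longrightarrow> x = y"
begin

lemma fn_in: "y \<in> Y \<Longrightarrow> (f ^^ n) y \<in> Y"
  by (induction n) (simp_all add: f_in)

lemma fn_act: "g \<in> carrier G \<Longrightarrow> y \<in> Y \<Longrightarrow> (f ^^ n) (act g y) = act g ((f ^^ n) y)"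
  by (induction n) (simp_all add: f_act fn_in)

lemma f_z: "f z = z"
  by (rule fixed_point_of_limit[OF f_cont f_in z_in f_tendsto[OF z_in]])

lemma fn_split: "m \<le> n \<Longrightarrow> (f ^^ n) y = (f ^^ (n - m)) ((f ^^ m) y)"
  by (metis funpow_add comp_apply le_add_diff_inverse2)

lemma fn_z: "(f ^^ n) z = z"
  by (induction n) (auto simp: f_z)

lemma fn_zero_mono: "(f ^^ m) y = z \<Longrightarrow> m \<le> n \<Longrightarrow> (f ^^ n) y = z"
  using fn_split[of m n y] fn_z by simp

text \<open>Expansiveness and compactness bound the distance of two points by their distances, up to
  \<open>\<Delta>\<close>, along the translates by a finite set.\<close>

lemma finite_window:
  assumes "0 < \<eta>"
  shows "\<exists>W. finite W \<and> W \<subseteq> carrier G \<and>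
    (\<forall>x\<in>Y. \<forall>y\<in>Y. (\<forall>g\<in>W. dist (act g x) (act g y) \<le> \<Delta>) \<longrightarrow> dist x y < \<eta>)"
proof -
  define K where "K = {p \<in> Y \<times> Y. \<eta> \<le> dist (fst p) (snd p)}"
  define U where "U g = {p \<in> K. \<Delta> < dist (act g (fst p)) (act g (snd p))}" for g
  have contd: "continuous_on (Y \<times> Y) (\<lambda>p. dist (fst p) (snd p))"
    by (intro continuous_intros)
  have "K = (Y \<times> Y) \<inter> (\<lambda>p. dist (fst p) (snd p)) -` {\<eta>..}"
    unfolding K_def by auto
  moreover have "closedin (top_of_set (Y \<times> Y)) ((Y \<times> Y) \<inter> (\<lambda>p. dist (fst p) (snd p)) -` {\<eta>..})"
    by (rule continuous_closedin_preimage[OF contd]) auto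
  ultimately have "compact K"
    using compact_Times[OF compact_Y compact_Y] closedin_compact by metis
  have KY: "K \<subseteq> Y \<times> Y" unfolding K_def by auto
  have Uop: "openin (top_of_set K) (U g)" if g: "g \<in> carrier G" for g
  proof -
    have "continuous_on K (\<lambda>p. act g (fst p))" "continuous_on K (\<lambda>p. act g (snd p))"
      using KY by (auto intro!: continuous_on_compose2[OF act_cont[OF g]] continuous_intros)
    then have "continuous_on K (\<lambda>p. dist (act g (fst p)) (act g (snd p)))"
      by (intro continuous_intros)
    then have "openin (top_of_set K) (K \<inter> (\<lambda>p. dist (act g (fst p)) (act g (snd p))) -` {\<Delta><..})"
      by (rule continuous_openin_preimage_gen) auto
    moreover have "U g = K \<inter> (\<lambda>p. dist (act g (fst p)) (act g (snd p))) -` {\<Delta><..}"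
      unfolding U_def by auto
    ultimately show ?thesis by simp
  qed
  have cover: "K \<subseteq> \<Union> (U ` carrier G)"
  proof
    fix p assume p: "p \<in> K"
    then have "fst p \<noteq> snd p" "fst p \<in> Y" "snd p \<in> Y"
      using assms unfolding K_def by auto
    then obtain g where "g \<in> carrier G" "\<Delta> < dist (act g (fst p)) (act g (snd p))"
      using expansiveness by (meson not_le)
    then show "p \<in> \<Union> (U ` carrier G)" using p unfolding U_def by auto
  qed
  have "\<exists>D\<subseteq>U ` carrier G. finite D \<and> K \<subseteq> \<Union> D"
    using \<open>compact K\<close>[unfolded compact_eq_openin_cover] Uop cover by auto
  then obtain D where D: "D \<subseteq> U ` carrier G" "finite D" "K \<subseteq> \<Union> D" by blast
  then obtain W where W: "W \<subseteq> carrier G" "finite W" "D = U ` W"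
    by (meson finite_subset_image)
  have "dist x y < \<eta>" if "x \<in> Y" "y \<in> Y" "\<forall>g\<in>W. dist (act g x) (act g y) \<le> \<Delta>" for x y
  proof (rule ccontr)
    assume "\<not> dist x y < \<eta>"
    then have "(x, y) \<in> K" using that unfolding K_def by auto
    then obtain g where "g \<in> W" "(x, y) \<in> U g" using D W by auto
    then show False using that unfolding U_def by auto
  qed
  then show ?thesis using W by blast
qed

text \<open>Two points that agree up to \<open>\<Delta>\<close> on the window of \<open>f\<close> agree there much better, and so do
  their images: this is the analogue of the neighbourhood of a cellular automaton. The improvement
  from \<open>\<Delta>\<close> to \<open>\<Delta>/8\<close> makes up for the failure of transitivity of approximate agreement.\<close>

lemma window_exists:
  "\<exists>W. finite W \<and> W \<subseteq> carrier G \<and> \<one> \<in> W \<and>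
    (\<forall>x\<in>Y. \<forall>y\<in>Y. (\<forall>g\<in>W. dist (act g x) (act g y) \<le> \<Delta>) \<longrightarrow>
       dist x y \<le> \<Delta>/8 \<and> dist (f x) (f y) \<le> \<Delta>/8)"
proof -
  have "uniformly_continuous_on Y f"
    using compact_uniformly_continuous[OF f_cont compact_Y] .
  moreover have "0 < \<Delta>/8" using \<Delta>_pos by simp
  ultimately obtain d where d0: "0 < d"
    and d1: "\<forall>x\<in>Y. \<forall>x'\<in>Y. dist x' x < d \<longrightarrow> dist (f x') (f x) < \<Delta>/8"
    unfolding uniformly_continuous_on_def by blast
  have d: "dist (f x) (f y) < \<Delta>/8" if "x \<in> Y" "y \<in> Y" "dist x y < d" for x y
    using d1 that by blast
  have "0 < min d (\<Delta>/8)" using d0 \<Delta>_pos by simp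
  from finite_window[OF this] obtain W where W: "finite W" "W \<subseteq> carrier G"
    "\<forall>x\<in>Y. \<forall>y\<in>Y. (\<forall>g\<in>W. dist (act g x) (act g y) \<le> \<Delta>) \<longrightarrow> dist x y < min d (\<Delta>/8)"
    by (elim exE conjE)
  show ?thesis
  proof (intro exI conjI ballI impI)
    show "finite (insert \<one> W)" "insert \<one> W \<subseteq> carrier G" "\<one> \<in> insert \<one> W" using W by auto
    fix x y assume xy: "x \<in> Y" "y \<in> Y" "\<forall>g\<in>insert \<one> W. dist (act g x) (act g y) \<le> \<Delta>"
    then have "dist x y < min d (\<Delta>/8)" using W(3) by simp
    then show "dist x y \<le> \<Delta>/8" "dist (f x) (f y) \<le> \<Delta>/8" using d[OF xy(1,2)] by auto
  qed
qed

definition window :: "'g set" where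
  "window = (SOME W. finite W \<and> W \<subseteq> carrier G \<and> \<one> \<in> W \<and>
    (\<forall>x\<in>Y. \<forall>y\<in>Y. (\<forall>g\<in>W. dist (act g x) (act g y) \<le> \<Delta>) \<longrightarrow>
       dist x y \<le> \<Delta>/8 \<and> dist (f x) (f y) \<le> \<Delta>/8))"

lemma window:
  "finite window" "window \<subseteq> carrier G" "\<one> \<in> window"
  "x \<in> Y \<Longrightarrow> y \<in> Y \<Longrightarrow> (\<And>g. g \<in> window \<Longrightarrow> dist (act g x) (act g y) \<le> \<Delta>) \<Longrightarrow>
     dist x y \<le> \<Delta>/8 \<and> dist (f x) (f y) \<le> \<Delta>/8"
  using someI_ex[OF window_exists] unfolding window_def[symmetric] by auto

fun windows :: "nat \<Rightarrow> 'g set" where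
  "windows 0 = {\<one>}"
| "windows (Suc m) = windows m <#> window"

lemma windows: "finite (windows m)" "windows m \<subseteq> carrier G" "\<one> \<in> windows m"
proof (induction m)
  case (Suc m)
  { case 1 then show ?case using Suc window by (auto intro: finite_set_mult) }
  { case 2 then show ?case using Suc window by (simp add: set_mult_closed) }
  { case 3
    have "\<one> \<otimes> \<one> \<in> windows m <#> window" using Suc window unfolding set_mult_def by blast
    then show ?case by simp }
qed auto

definition agree :: "real \<Rightarrow> 'g set \<Rightarrow> 'x \<Rightarrow> 'x \<Rightarrow> bool" where
  "agree \<eta> A x y \<longleftrightarrow> (\<forall>g\<in>A. dist (act g x) (act g y) \<le> \<eta>)"

lemma agree_sym: "agree \<eta> A x y \<Longrightarrow> agree \<eta> A y x"
  unfolding agree_def by (simp add: dist_commute)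

lemma agree_trans: "agree \<eta> A x y \<Longrightarrow> agree \<theta> A y w \<Longrightarrow> \<eta> + \<theta> \<le> \<zeta> \<Longrightarrow> agree \<zeta> A x w"
  unfolding agree_def by (smt (verit) dist_triangle)

lemma agree_mono: "agree \<eta> A x y \<Longrightarrow> B \<subseteq> A \<Longrightarrow> \<eta> \<le> \<theta> \<Longrightarrow> agree \<theta> B x y"
  unfolding agree_def by force

lemma agree_act:
  assumes "h \<in> carrier G" "x \<in> Y" "y \<in> Y" "A \<subseteq> carrier G"
  shows "agree \<eta> A (act h x) (act h y) \<longleftrightarrow> agree \<eta> (A #> h) x y"
proof -
  have "act (g \<otimes> h) x = act g (act h x)" "act (g \<otimes> h) y = act g (act h y)" if "g \<in> A" for g
    using that assms act_mult by auto
  then show ?thesis unfolding agree_def r_coset_def by auto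
qed

lemma agree_window:
  assumes "x \<in> Y" "y \<in> Y" "A \<subseteq> carrier G" "agree \<Delta> (window <#> A) x y"
  shows "agree (\<Delta>/8) A x y" "agree (\<Delta>/8) A (f x) (f y)"
proof -
  have "dist (act g x) (act g y) \<le> \<Delta>/8 \<and> dist (f (act g x)) (f (act g y)) \<le> \<Delta>/8" if g: "g \<in> A" for g
  proof (rule window(4))
    have gG: "g \<in> carrier G" using g assms(3) by auto
    show "act g x \<in> Y" "act g y \<in> Y" using gG assms act_in by auto
    fix e assume e: "e \<in> window"
    then have eG: "e \<in> carrier G" using window by auto
    have "e \<otimes> g \<in> window <#> A" using e g unfolding set_mult_def by auto
    then have "dist (act (e \<otimes> g) x) (act (e \<otimes> g) y) \<le> \<Delta>" using assms(4) unfolding agree_def by auto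
    then show "dist (act e (act g x)) (act e (act g y)) \<le> \<Delta>"
      using act_mult[OF eG gG] assms by simp
  qed
  moreover have "f (act g x) = act g (f x)" "f (act g y) = act g (f y)" if "g \<in> A" for g
    using that f_act assms by auto
  ultimately show "agree (\<Delta>/8) A x y" "agree (\<Delta>/8) A (f x) (f y)"
    unfolding agree_def by auto
qed

lemma agree_fn:
  assumes "x \<in> Y" "y \<in> Y" "A \<subseteq> carrier G" "agree \<Delta> (windows (Suc m) <#> A) x y"
  shows "agree (\<Delta>/8) A ((f ^^ m) x) ((f ^^ m) y)"
  using assms(3,4)
proof (induction m arbitrary: A)
  case 0
  have "windows (Suc 0) = window" using window(2) unfolding windows.simps set_mult_def by force
  then show ?case using agree_window(1)[of x y A] assms(1,2) 0 by simp
next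
  case (Suc m)
  have WA: "window <#> A \<subseteq> carrier G" using Suc.prems window by (simp add: set_mult_closed)
  have "windows (Suc m) <#> (window <#> A) = windows (Suc (Suc m)) <#> A"
    using set_mult_assoc[of "windows (Suc m)" window A] windows(2)[of "Suc m"] window(2) Suc.prems
    by simp
  then have "agree (\<Delta>/8) (window <#> A) ((f ^^ m) x) ((f ^^ m) y)"
    using Suc.IH[OF WA] Suc.prems by simp
  then have "agree \<Delta> (window <#> A) ((f ^^ m) x) ((f ^^ m) y)"
    using \<Delta>_pos by (auto intro: agree_mono)
  then show ?case using agree_window(2)[of "(f ^^ m) x" "(f ^^ m) y" A] Suc.prems fn_in assms by simp
qed

lemma agree_everywhere: "x \<in> Y \<Longrightarrow> y \<in> Y \<Longrightarrow> agree \<Delta> (carrier G) x y \<Longrightarrow> x = y"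
  using expansiveness unfolding agree_def by blast

text \<open>Pointwise convergence is uniform on finitely many translates.\<close>

lemma eventually_agree_z:
  assumes "finite A" "A \<subseteq> carrier G" "y \<in> Y" "0 < \<eta>"
  shows "\<exists>N. \<forall>m\<ge>N. agree \<eta> A ((f ^^ m) y) z"
proof -
  have "\<forall>g\<in>A. \<forall>\<^sub>F m in sequentially. dist (act g ((f ^^ m) y)) (act g z) \<le> \<eta>"
  proof
    fix g assume g: "g \<in> A"
    then have "(\<lambda>n. (f ^^ n) (act g y)) \<longlonglongrightarrow> z" using f_tendsto act_in assms by auto
    then have "\<forall>\<^sub>F m in sequentially. dist ((f ^^ m) (act g y)) z < \<eta>"
      using assms(4) tendstoD by blast
    then show "\<forall>\<^sub>F m in sequentially. dist (act g ((f ^^ m) y)) (act g z) \<le> \<eta>"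
      using g assms(2,3) fn_act act_z by (auto elim!: eventually_mono simp: subset_iff)
  qed
  then have "\<forall>\<^sub>F m in sequentially. \<forall>g\<in>A. dist (act g ((f ^^ m) y)) (act g z) \<le> \<eta>"
    using assms(1) by (simp add: eventually_ball_finite_distrib)
  then show ?thesis unfolding agree_def eventually_sequentially by auto
qed

lemma dies_of_agree:
  assumes "y \<in> Y" "agree \<Delta> (carrier G) ((f ^^ m) y) z"
  shows "(f ^^ m) y = z"
  using assms agree_everywhere fn_in z_in by blast

end

section \<open>Gluing\<close>

context nil_system begin

definition spt :: "real \<Rightarrow> 'x \<Rightarrow> 'g set" where
  "spt \<eta> y = {g \<in> carrier G. \<eta> \<le> dist (act g y) z}"

definition cell :: "real \<Rightarrow> 'g set \<Rightarrow> 'x \<Rightarrow> 'g set" where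
  "cell \<delta> K p = K <#> spt \<delta> p"

definition separated :: "real \<Rightarrow> 'g set \<Rightarrow> 'x set \<Rightarrow> bool" where
  "separated \<delta> K P \<longleftrightarrow> (\<forall>p\<in>P. \<forall>q\<in>P. p \<noteq> q \<longrightarrow> cell \<delta> K p \<inter> cell \<delta> K q = {})"

definition glued :: "real \<Rightarrow> real \<Rightarrow> 'g set \<Rightarrow> 'x set \<Rightarrow> 'x \<Rightarrow> bool" where
  "glued \<epsilon> \<delta> K P y \<longleftrightarrow> y \<in> Y \<and>
     (\<forall>p\<in>P. \<forall>g\<in>cell \<delta> K p. dist (act g y) (act g p) \<le> \<epsilon>) \<and>
     (\<forall>g\<in>carrier G. (\<forall>p\<in>P. g \<notin> cell \<delta> K p) \<longrightarrow> dist (act g y) z \<le> \<epsilon>)"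

text \<open>The family of points to be glued is a set of points and not an indexed family: distinct members
  with nonempty cells have disjoint cells, so nothing is lost and no index type has to be chosen.\<close>

definition glues :: "'x set \<Rightarrow> bool" where
  "glues C \<longleftrightarrow> (\<forall>\<epsilon>>0. \<exists>\<delta>>0. \<exists>K. \<delta> \<le> \<epsilon> \<and> finite K \<and> K \<subseteq> carrier G \<and> \<one> \<in> K \<and>
     (\<forall>P\<subseteq>C. separated \<delta> K P \<longrightarrow> (\<exists>y. glued \<epsilon> \<delta> K P y)))"

lemma spt_subset: "spt \<eta> y \<subseteq> carrier G"
  unfolding spt_def by auto

lemma cell_subset: "K \<subseteq> carrier G \<Longrightarrow> cell \<delta> K p \<subseteq> carrier G"
  unfolding cell_def by (intro set_mult_closed spt_subset)

lemma spt_act: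
  assumes "h \<in> carrier G" "y \<in> Y"
  shows "spt \<eta> (act h y) = spt \<eta> y #> inv h"
proof (intro equalityI subsetI)
  fix g assume "g \<in> spt \<eta> (act h y)"
  then have g: "g \<in> carrier G" "\<eta> \<le> dist (act g (act h y)) z" unfolding spt_def by auto
  then have "g \<otimes> h \<in> spt \<eta> y" using assms act_mult unfolding spt_def by auto
  moreover have "g = (g \<otimes> h) \<otimes> inv h" using g assms by (simp add: m_assoc)
  ultimately show "g \<in> spt \<eta> y #> inv h" unfolding r_coset_def by blast
next
  fix g assume "g \<in> spt \<eta> y #> inv h"
  then obtain k where k: "k \<in> carrier G" "\<eta> \<le> dist (act k y) z" "g = k \<otimes> inv h"
    unfolding r_coset_def spt_def by auto
  then have "g \<in> carrier G" "g \<otimes> h = k" using assms by (auto simp: m_assoc)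
  then show "g \<in> spt \<eta> (act h y)" using k act_mult[of g h y] assms unfolding spt_def by auto
qed

lemma cell_act:
  assumes "h \<in> carrier G" "y \<in> Y" "K \<subseteq> carrier G"
  shows "cell \<delta> K (act h y) = cell \<delta> K y #> inv h"
  unfolding cell_def spt_act[OF assms(1,2)] using assms(1,3) spt_subset setmult_rcos_assoc by simp

lemma spt_subset_cell:
  assumes "\<one> \<in> K"
  shows "spt \<delta> p \<subseteq> cell \<delta> K p"
proof
  fix g assume g: "g \<in> spt \<delta> p"
  then have "\<one> \<otimes> g \<in> cell \<delta> K p" using assms unfolding cell_def set_mult_def by blast
  then show "g \<in> cell \<delta> K p" using g spt_subset by (simp add: subset_iff)
qed

lemma glued_single:
  assumes "p \<in> Y" "\<delta> \<le> \<epsilon>" "0 \<le> \<epsilon>" "\<one> \<in> K"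
  shows "glued \<epsilon> \<delta> K {p} p"
proof -
  have "dist (act g p) z \<le> \<epsilon>" if "g \<in> carrier G" "g \<notin> cell \<delta> K p" for g
    using that spt_subset_cell[OF assms(4), of \<delta> p] assms(2) unfolding spt_def by force
  then show ?thesis using assms unfolding glued_def by auto
qed

lemma glued_empty: "0 \<le> \<epsilon> \<Longrightarrow> glued \<epsilon> \<delta> K {} z"
  unfolding glued_def by (simp add: z_in act_z)

text \<open>Glued points agree wherever they were glued from the same pieces.\<close>

lemma glued_agree:
  assumes g1: "glued \<epsilon> \<delta> K P y" and g2: "glued \<epsilon> \<delta> K P' y'" and A: "A \<subseteq> carrier G"
    and common: "\<And>p. p \<in> P \<union> P' \<Longrightarrow> cell \<delta> K p \<inter> A \<noteq> {} \<Longrightarrow> p \<in> P \<inter> P'"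
  shows "agree (2 * \<epsilon>) A y y'"
  unfolding agree_def
proof
  fix g assume g: "g \<in> A"
  show "dist (act g y) (act g y') \<le> 2 * \<epsilon>"
  proof (cases "\<exists>p\<in>P \<union> P'. g \<in> cell \<delta> K p")
    case True
    then obtain p where p: "p \<in> P \<union> P'" "g \<in> cell \<delta> K p" by blast
    then have "p \<in> P \<inter> P'" using common g by blast
    then have "dist (act g y) (act g p) \<le> \<epsilon>" "dist (act g y') (act g p) \<le> \<epsilon>"
      using p g1 g2 unfolding glued_def by auto
    then show ?thesis using dist_triangle2[of "act g y" "act g y'" "act g p"] by linarith
  next
    case False
    then have "dist (act g y) z \<le> \<epsilon>" "dist (act g y') z \<le> \<epsilon>"
      using g A g1 g2 unfolding glued_def by auto
    then show ?thesis using dist_triangle2[of "act g y" "act g y'" z] by linarith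
  qed
qed

lemma glued_unique:
  assumes "glued \<epsilon> \<delta> K P y" "glued \<epsilon> \<delta> K P y'" "2 * \<epsilon> \<le> \<Delta>"
  shows "y = y'"
proof (rule agree_everywhere)
  show "y \<in> Y" "y' \<in> Y" using assms unfolding glued_def by auto
  have "agree (2 * \<epsilon>) (carrier G) y y'" using glued_agree[OF assms(1,2)] by auto
  then show "agree \<Delta> (carrier G) y y'" using assms(3) agree_mono by blast
qed

lemma glued_act:
  assumes "glued \<epsilon> \<delta> K P y" "h \<in> carrier G" "P \<subseteq> Y" "K \<subseteq> carrier G"
  shows "glued \<epsilon> \<delta> K (act h ` P) (act h y)"
proof -
  have yY: "y \<in> Y" using assms(1) unfolding glued_def by auto
  have mem: "g \<otimes> h \<in> cell \<delta> K p \<longleftrightarrow> g \<in> cell \<delta> K (act h p)" if "p \<in> P" "g \<in> carrier G" for p g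
  proof -
    have c: "cell \<delta> K (act h p) = cell \<delta> K p #> inv h" using cell_act assms that by auto
    have "g \<otimes> h \<in> cell \<delta> K p" if "g = k \<otimes> inv h" "k \<in> cell \<delta> K p" for k
      using that cell_subset[OF assms(4), of \<delta> p] assms(2) by (simp add: m_assoc subset_iff)
    moreover have "g = (g \<otimes> h) \<otimes> inv h" using that assms(2) by (simp add: m_assoc)
    ultimately show ?thesis unfolding c r_coset_def by blast
  qed
  show ?thesis unfolding glued_def
  proof (intro conjI ballI impI)
    show "act h y \<in> Y" using act_in assms(2) yY by auto
  next
    fix q g assume "q \<in> act h ` P" and g: "g \<in> cell \<delta> K q"
    then obtain p where p: "p \<in> P" "q = act h p" by auto
    have gG: "g \<in> carrier G" using g cell_subset[OF assms(4)] by blast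
    then have "g \<otimes> h \<in> cell \<delta> K p" using mem g p by auto
    then have "dist (act (g \<otimes> h) y) (act (g \<otimes> h) p) \<le> \<epsilon>"
      using assms(1) p unfolding glued_def by auto
    then show "dist (act g (act h y)) (act g q) \<le> \<epsilon>"
      using act_mult[OF gG assms(2)] p assms(3) yY by auto
  next
    fix g assume gG: "g \<in> carrier G" and "\<forall>q\<in>act h ` P. g \<notin> cell \<delta> K q"
    then have "\<forall>p\<in>P. g \<otimes> h \<notin> cell \<delta> K p" using mem by blast
    then have "dist (act (g \<otimes> h) y) z \<le> \<epsilon>"
      using assms(1,2) gG unfolding glued_def by auto
    then show "dist (act g (act h y)) z \<le> \<epsilon>" using act_mult[OF gG assms(2) yY] by simp
  qed
qed

text \<open>A translate of \<open>windows (Suc T)\<close> cannot meet both a set \<open>A\<close> and the complement of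
  \<open>halo T <#> A\<close>, so what happens in \<open>A\<close> cannot meet within \<open>T\<close> steps with what happens out there.\<close>

definition halo :: "nat \<Rightarrow> 'g set" where
  "halo T = windows (Suc T) <#> (\<lambda>g. inv g) ` windows (Suc T)"

lemma halo: "finite (halo T)" "halo T \<subseteq> carrier G" "\<one> \<in> halo T"
proof -
  have w: "finite (windows (Suc T))" "windows (Suc T) \<subseteq> carrier G" "\<one> \<in> windows (Suc T)"
    using windows by blast+
  show "finite (halo T)" unfolding halo_def using w(1) by (intro finite_set_mult) auto
  show "halo T \<subseteq> carrier G" unfolding halo_def using w(2) by (intro set_mult_closed) auto
  have "\<one> \<otimes> inv \<one> \<in> halo T" unfolding halo_def set_mult_def using w(3) by blast
  then show "\<one> \<in> halo T" by simp
qed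

lemma halo_mem:
  assumes "g \<in> carrier G" "a \<in> carrier G" "a \<in> windows (Suc T) <#> {g}" "b \<in> windows (Suc T) <#> {g}"
  shows "b \<in> halo T <#> {a}"
proof -
  obtain v w where vw: "v \<in> windows (Suc T)" "a = v \<otimes> g" "w \<in> windows (Suc T)" "b = w \<otimes> g"
    using assms unfolding set_mult_def by auto
  have G: "v \<in> carrier G" "w \<in> carrier G" using vw(1,3) windows(2)[of "Suc T"] by blast+
  have "w \<otimes> inv v \<in> halo T" unfolding halo_def set_mult_def using vw by blast
  moreover have "b = (w \<otimes> inv v) \<otimes> a" using vw(2,4) G assms(1) by (simp add: m_assoc inv_solve_left)
  ultimately show ?thesis unfolding set_mult_def by blast
qed

text \<open>A part \<open>P''\<close> that dies within \<open>T\<close> steps before it can interact with the other part can be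
  removed without changing the future.\<close>

lemma merge:
  assumes y: "glued \<epsilon> \<delta> K (P' \<union> P'') y" and y': "glued \<epsilon> \<delta> K P' y'"
    and y'': "glued \<epsilon> \<delta> K P'' y''" and \<epsilon>: "0 \<le> \<epsilon>" "2 * \<epsilon> \<le> \<Delta>" and K: "K \<subseteq> carrier G"
    and dies: "(f ^^ T) y'' = z"
    and sep: "\<And>p q. p \<in> P'' \<Longrightarrow> q \<in> P' \<Longrightarrow> cell \<delta> K q \<inter> (halo T <#> cell \<delta> K p) = {}"
  shows "(f ^^ T) y = (f ^^ T) y'"
proof (rule agree_everywhere)
  have Y: "y \<in> Y" "y' \<in> Y" "y'' \<in> Y" using y y' y'' unfolding glued_def by auto
  then show "(f ^^ T) y \<in> Y" "(f ^^ T) y' \<in> Y" using fn_in by auto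
  show "agree \<Delta> (carrier G) ((f ^^ T) y) ((f ^^ T) y')"
    unfolding agree_def
  proof
    fix g assume g: "g \<in> carrier G"
    define W where "W = windows (Suc T) <#> {g}"
    have gG: "{g} \<subseteq> carrier G" using g by auto
    have WG: "W \<subseteq> carrier G" unfolding W_def by (rule set_mult_closed[OF windows(2) gG])
    have step: "dist (act g ((f ^^ T) u)) (act g ((f ^^ T) v)) \<le> \<Delta>/8"
      if "agree (2 * \<epsilon>) W u v" "u \<in> Y" "v \<in> Y" for u v
    proof -
      have "agree \<Delta> (windows (Suc T) <#> {g}) u v"
        using that \<epsilon> agree_mono W_def by blast
      then show ?thesis using agree_fn[OF that(2,3) gG] unfolding agree_def by auto
    qed
    have notboth: "\<not> (cell \<delta> K p \<inter> W \<noteq> {} \<and> cell \<delta> K q \<inter> W \<noteq> {})" if pq: "p \<in> P''" "q \<in> P'" for p q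
    proof
      assume "cell \<delta> K p \<inter> W \<noteq> {} \<and> cell \<delta> K q \<inter> W \<noteq> {}"
      then obtain a b where ab: "a \<in> cell \<delta> K p" "a \<in> W" "b \<in> cell \<delta> K q" "b \<in> W" by blast
      have "a \<in> carrier G" using ab WG by auto
      then have "b \<in> halo T <#> {a}" using halo_mem[OF g] ab unfolding W_def by blast
      then have "b \<in> halo T <#> cell \<delta> K p" using ab(1) unfolding set_mult_def by auto
      then show False using sep[OF pq] ab(3) by blast
    qed
    show "dist (act g ((f ^^ T) y)) (act g ((f ^^ T) y')) \<le> \<Delta>"
    proof (cases "\<exists>p\<in>P''. cell \<delta> K p \<inter> W \<noteq> {}")
      case True
      then obtain p where p: "p \<in> P''" "cell \<delta> K p \<inter> W \<noteq> {}" by blast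
      have none: "cell \<delta> K q \<inter> W = {}" if "q \<in> P'" for q using notboth[OF p(1) that] p(2) by blast
      have "agree (2 * \<epsilon>) W y y''"
        by (rule glued_agree[OF y y'' WG]) (use none in auto)
      then have 1: "dist (act g ((f ^^ T) y)) z \<le> \<Delta>/8" using step[of y y''] Y dies act_z g by simp
      have "agree (2 * \<epsilon>) W y' z"
        by (rule glued_agree[OF y' glued_empty[OF \<epsilon>(1)] WG]) (use none in auto)
      then have 2: "dist (act g ((f ^^ T) y')) z \<le> \<Delta>/8" using step[of y' z] Y z_in fn_z act_z g by simp
      show ?thesis using 1 2 dist_triangle2[of "act g ((f ^^ T) y)" "act g ((f ^^ T) y')" z] \<Delta>_pos
        by linarith
    next
      case False
      have "agree (2 * \<epsilon>) W y y'"
        by (rule glued_agree[OF y y' WG]) (use False in auto)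
      then have "dist (act g ((f ^^ T) y)) (act g ((f ^^ T) y')) \<le> \<Delta>/8" using step Y by blast
      then show ?thesis using \<Delta>_pos by linarith
    qed
  qed
qed

lemma cell_disjoint:
  assumes "A \<subseteq> carrier G" "K \<subseteq> carrier G" "spt \<delta> q \<inter> ((\<lambda>k. inv k) ` K <#> A) = {}"
  shows "cell \<delta> K q \<inter> A = {}"
proof (rule ccontr)
  assume "cell \<delta> K q \<inter> A \<noteq> {}"
  then obtain k g where kg: "k \<in> K" "g \<in> spt \<delta> q" "k \<otimes> g \<in> A"
    unfolding cell_def set_mult_def by auto
  have "g = inv k \<otimes> (k \<otimes> g)" using kg assms(2) spt_subset[of \<delta> q]
    by (simp add: subset_iff m_assoc[symmetric])
  then have "g \<in> (\<lambda>k. inv k) ` K <#> A" unfolding set_mult_def using kg by blast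
  then show False using kg(2) assms(3) by auto
qed

end

section \<open>Dying points that wander\<close>

context nil_system begin

text \<open>Suppose that arbitrarily far away there are points that visit a fixed place arbitrarily late and
  then die. Glued together, far enough from each other that each is dead before it meets the next,
  they give a point that visits this place infinitely often, against asymptotic nilpotency.
  Distance is measured modulo a set \<open>M\<close> of periods, so that the single points may be \<open>M\<close>-periodic.\<close>

lemma no_wandering:
  assumes gl: "glues C" and C: "C \<subseteq> Y" and M: "M \<subseteq> carrier G" "\<one> \<in> M"
    and C0: "finite C0" "C0 \<subseteq> carrier G"
    and wander: "\<And>D \<tau> \<delta>. finite D \<Longrightarrow> D \<subseteq> carrier G \<Longrightarrow> 0 < \<delta> \<Longrightarrow>
      \<exists>r\<in>C. \<exists>m\<ge>\<tau>. \<exists>T D'. (f ^^ T) r = z \<and> finite D' \<and> D' \<subseteq> carrier G \<and> spt \<delta> r \<subseteq> D' <#> M \<and>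
        spt \<delta> r \<inter> (D <#> M) = {} \<and> \<not> agree (\<Delta>/2) C0 ((f ^^ m) r) z"
  shows False
proof -
  have "0 < \<Delta>/16" using \<Delta>_pos by simp
  with gl obtain \<delta> K where \<delta>: "0 < \<delta>" "\<delta> \<le> \<Delta>/16" and K: "finite K" "K \<subseteq> carrier G" "\<one> \<in> K"
    and glue: "\<And>P. P \<subseteq> C \<Longrightarrow> separated \<delta> K P \<Longrightarrow> \<exists>y. glued (\<Delta>/16) \<delta> K P y"
    unfolding glues_def by metis
  \<comment> \<open>\<open>D\<close> collects the places that the next point has to avoid initially, and \<open>\<tau>\<close> is a time at which all
    previous points are dead.\<close>
  define good where "good D \<tau> r m D' \<tau>' \<longleftrightarrow> r \<in> C \<and> \<tau> < m \<and> m \<le> \<tau>' \<and> (f ^^ \<tau>') r = z \<and>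
      D \<subseteq> D' \<and> cell \<delta> K r \<inter> (D <#> M) = {} \<and> halo \<tau>' <#> cell \<delta> K r \<subseteq> D' <#> M \<and>
      windows (Suc m) <#> C0 \<subseteq> D' <#> M \<and> \<not> agree (\<Delta>/2) C0 ((f ^^ m) r) z"
    for D \<tau> r m D' and \<tau>' :: nat
  have step: "\<exists>r m D' \<tau>'. finite D' \<and> D' \<subseteq> carrier G \<and> good D \<tau> r m D' \<tau>'"
    if D: "finite D" "D \<subseteq> carrier G" for D \<tau>
  proof -
    define D1 where "D1 = (\<lambda>k. inv k) ` K <#> D"
    have iK: "(\<lambda>k. inv k) ` K \<subseteq> carrier G" using K by auto
    have D1: "finite D1" "D1 \<subseteq> carrier G" unfolding D1_def
      by (rule finite_set_mult set_mult_closed finite_imageI iK D K)+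
    from wander[OF D1 \<delta>(1), of "Suc \<tau>"]
    obtain r m T D2 where r: "r \<in> C" "Suc \<tau> \<le> m" "(f ^^ T) r = z" "finite D2" "D2 \<subseteq> carrier G"
      "spt \<delta> r \<subseteq> D2 <#> M" "spt \<delta> r \<inter> (D1 <#> M) = {}" "\<not> agree (\<Delta>/2) C0 ((f ^^ m) r) z"
      by (elim bexE exE conjE)
    define \<tau>' where "\<tau>' = max m T"
    define D' where "D' = D \<union> (halo \<tau>' <#> (K <#> D2)) \<union> (windows (Suc m) <#> C0)"
    have DM: "D <#> M \<subseteq> carrier G" using D M by (intro set_mult_closed)
    have D1M: "D1 <#> M = (\<lambda>k. inv k) ` K <#> (D <#> M)"
      unfolding D1_def using set_mult_assoc[OF iK D(2) M(1)] by simp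
    have 1: "cell \<delta> K r \<inter> (D <#> M) = {}"
      by (rule cell_disjoint[OF DM K(2)]) (use r(7) D1M in simp)
    have "cell \<delta> K r \<subseteq> K <#> (D2 <#> M)" unfolding cell_def by (rule mono_set_mult[OF subset_refl r(6)])
    then have "halo \<tau>' <#> cell \<delta> K r \<subseteq> halo \<tau>' <#> (K <#> (D2 <#> M))" by (rule mono_set_mult[OF subset_refl])
    also have "\<dots> = (halo \<tau>' <#> (K <#> D2)) <#> M"
      using halo(2) K r(5) M by (simp add: set_mult_assoc set_mult_closed)
    also have "\<dots> \<subseteq> D' <#> M" by (rule mono_set_mult) (auto simp: D'_def)
    finally have 2: "halo \<tau>' <#> cell \<delta> K r \<subseteq> D' <#> M" .
    have fin: "finite (windows (Suc m) <#> C0)" "windows (Suc m) <#> C0 \<subseteq> carrier G"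
      using windows(1) C0 finite_set_mult set_mult_closed[OF windows(2) C0(2)] by blast+
    have KD: "finite (K <#> D2)" "K <#> D2 \<subseteq> carrier G"
      by (rule finite_set_mult set_mult_closed r K)+
    have HD: "finite (halo \<tau>' <#> (K <#> D2))" "halo \<tau>' <#> (K <#> D2) \<subseteq> carrier G"
      by (rule finite_set_mult set_mult_closed halo KD)+
    have D'fin: "finite D'" "D' \<subseteq> carrier G" unfolding D'_def using D fin HD by blast+
    have "windows (Suc m) <#> C0 \<subseteq> D'" unfolding D'_def by blast
    then have 3: "windows (Suc m) <#> C0 \<subseteq> D' <#> M"
      using subset_set_mult_right[OF M(2) D'fin(2)] by blast
    have "good D \<tau> r m D' \<tau>'" unfolding good_def
      using r 1 2 3 fn_zero_mono[of T r \<tau>'] by (auto simp: \<tau>'_def D'_def)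
    then show ?thesis using D'fin by blast
  qed
  define P where "P s \<longleftrightarrow> finite (fst s) \<and> fst s \<subseteq> carrier G" for s :: "'g set \<times> nat \<times> 'x \<times> nat"
  define Q where "Q s s' \<longleftrightarrow> (case (s, s') of ((D, \<tau>, _, _), (D', \<tau>', r, m)) \<Rightarrow> good D \<tau> r m D' \<tau>')"
    for s s' :: "'g set \<times> nat \<times> 'x \<times> nat"
  have "\<exists>F. \<forall>n. P (F n) \<and> Q (F n) (F (Suc n))"
  proof (rule dependent_nat_choice)
    show "\<exists>x. P x" unfolding P_def by (rule exI[of _ "({}, undefined)"]) auto
    fix x n assume "P x"
    then show "\<exists>y. P y \<and> Q x y" using step[of "fst x" "fst (snd x)"] unfolding P_def Q_def
      by (cases x) fastforce
  qed
  then obtain F where F: "\<And>n. P (F n)" "\<And>n. Q (F n) (F (Suc n))" by blast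
  define D where "D n = fst (F n)" for n
  define \<tau> where "\<tau> n = fst (snd (F n))" for n
  define r where "r n = fst (snd (snd (F (Suc n))))" for n
  define m where "m n = snd (snd (snd (F (Suc n))))" for n
  have good: "good (D n) (\<tau> n) (r n) (m n) (D (Suc n)) (\<tau> (Suc n))" for n
    using F(2)[of n] unfolding Q_def D_def \<tau>_def r_def m_def by (auto split: prod.splits)
  have rC: "r n \<in> C" and m: "\<tau> n < m n" "m n \<le> \<tau> (Suc n)" and dead: "(f ^^ \<tau> (Suc n)) (r n) = z"
    and Dmono: "D n \<subseteq> D (Suc n)" and avoid: "cell \<delta> K (r n) \<inter> (D n <#> M) = {}"
    and absorb: "halo (\<tau> (Suc n)) <#> cell \<delta> K (r n) \<subseteq> D (Suc n) <#> M"
      "windows (Suc (m n)) <#> C0 \<subseteq> D (Suc n) <#> M"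
    and visit: "\<not> agree (\<Delta>/2) C0 ((f ^^ m n) (r n)) z" for n
    using good[of n] unfolding good_def by auto
  have rY: "r n \<in> Y" for n using rC C by auto
  have far: "cell \<delta> K (r k) \<inter> (D (Suc i) <#> M) = {}" if "i < k" for i k
  proof -
    have "D (Suc i) \<subseteq> D k" using that lift_Suc_mono_le[of D "Suc i" k] Dmono by auto
    then have "D (Suc i) <#> M \<subseteq> D k <#> M" by (rule mono_set_mult) simp
    then show ?thesis using avoid[of k] by auto
  qed
  have disj: "cell \<delta> K (r k) \<inter> cell \<delta> K (r i) = {}" if "i < k" for i k
  proof -
    have "cell \<delta> K (r i) \<subseteq> halo (\<tau> (Suc i)) <#> cell \<delta> K (r i)"
      by (rule subset_set_mult[OF halo(3) cell_subset[OF K(2)]])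
    then show ?thesis using far[OF that] absorb(1)[of i] by blast
  qed
  have sep: "separated \<delta> K (r ` {i..})" for i unfolding separated_def
  proof (intro ballI impI)
    fix p q assume "p \<in> r ` {i..}" "q \<in> r ` {i..}" "p \<noteq> q"
    then obtain a b where ab: "p = r a" "q = r b" "a \<noteq> b" by auto
    show "cell \<delta> K p \<inter> cell \<delta> K q = {}" unfolding ab(1,2)
      using ab(3) disj[of a b] disj[of b a] by (auto simp: neq_iff)
  qed
  have "\<exists>y. glued (\<Delta>/16) \<delta> K (r ` {i..}) y" for i using glue sep rC by blast
  then obtain y where y: "\<And>i. glued (\<Delta>/16) \<delta> K (r ` {i..}) (y i)" by metis
  have yY: "y i \<in> Y" for i using y unfolding glued_def by auto
  have single: "glued (\<Delta>/16) \<delta> K {r i} (r i)" for i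
    using glued_single rY \<delta> \<Delta>_pos K by auto
  have peel: "(f ^^ \<tau> (Suc i)) (y i) = (f ^^ \<tau> (Suc i)) (y (Suc i))" for i
  proof (rule merge)
    have "{i..} = {Suc i..} \<union> {i}" by auto
    then have "r ` {i..} = r ` {Suc i..} \<union> {r i}" by (metis image_Un image_empty image_insert)
    then show "glued (\<Delta>/16) \<delta> K (r ` {Suc i..} \<union> {r i}) (y i)" using y[of i] by simp
    show "glued (\<Delta>/16) \<delta> K (r ` {Suc i..}) (y (Suc i))" "glued (\<Delta>/16) \<delta> K {r i} (r i)"
      using y single by auto
    show "(f ^^ \<tau> (Suc i)) (r i) = z" by (rule dead)
    fix p q assume "p \<in> {r i}" "q \<in> r ` {Suc i..}"
    then obtain k where "p = r i" "q = r k" "i < k" by auto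
    then show "cell \<delta> K q \<inter> (halo (\<tau> (Suc i)) <#> cell \<delta> K p) = {}"
      using far[of i k] absorb(1)[of i] by auto
  qed (use \<Delta>_pos K in auto)
  have same: "(f ^^ t) (y 0) = (f ^^ t) (y j)" if "\<tau> j \<le> t" for t j
    using that
  proof (induction j)
    case (Suc j)
    have "\<tau> j \<le> t" using Suc.prems m[of j] by linarith
    then have "(f ^^ t) (y 0) = (f ^^ t) (y j)" by (rule Suc.IH)
    also have "\<dots> = (f ^^ t) (y (Suc j))" using fn_split[OF Suc.prems] peel[of j] by simp
    finally show ?case .
  qed simp
  obtain N where N: "\<And>t. N \<le> t \<Longrightarrow> agree (\<Delta>/8) C0 ((f ^^ t) (y 0)) z"
    using eventually_agree_z[OF C0 yY, of "\<Delta>/8"] \<Delta>_pos by auto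
  have "n \<le> \<tau> n" for n
  proof (induction n)
    case (Suc n) then show ?case using m[of n] by linarith
  qed simp
  then have "N \<le> m N" using m[of N] by (meson less_imp_le order_trans)
  have WC: "windows (Suc (m N)) <#> C0 \<subseteq> carrier G"
    using C0 windows(2) by (intro set_mult_closed)
  have "agree (2 * (\<Delta>/16)) (windows (Suc (m N)) <#> C0) (y N) (r N)"
  proof (rule glued_agree[OF y single WC])
    fix p assume p: "p \<in> r ` {N..} \<union> {r N}" "cell \<delta> K p \<inter> (windows (Suc (m N)) <#> C0) \<noteq> {}"
    then obtain k where k: "p = r k" "N \<le> k" by auto
    show "p \<in> r ` {N..} \<inter> {r N}"
    proof (cases "k = N")
      case False
      then have "cell \<delta> K p \<inter> (D (Suc N) <#> M) = {}" using far[of N k] k by auto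
      then show ?thesis using p(2) absorb(2)[of N] by blast
    qed (use k in auto)
  qed
  then have "agree \<Delta> (windows (Suc (m N)) <#> C0) (y N) (r N)" using \<Delta>_pos by (auto intro: agree_mono)
  then have 1: "agree (\<Delta>/8) C0 ((f ^^ m N) (y N)) ((f ^^ m N) (r N))"
    using agree_fn[OF yY rY C0(2)] by blast
  have "agree (\<Delta>/8) C0 ((f ^^ m N) (y N)) z" using N[OF \<open>N \<le> m N\<close>] same[of N "m N"] m[of N] by simp
  then have "agree (\<Delta>/2) C0 ((f ^^ m N) (r N)) z"
    using agree_trans[OF agree_sym[OF 1]] \<Delta>_pos by auto
  then show False using visit by blast
qed

end

section \<open>Sums of translates of a homoclinic point\<close>

text \<open>From here on a single point \<open>x\<close> with finite support is fixed, and the only initial points are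
  sums of its translates. These are indexed by subsets \<open>S\<close> of the group, so that subsets of the group
  play the part of the configurations of a full shift. The images of all sums lie in a set \<open>C\<close> whose
  members can be glued again, but the glued points are not required to lie in \<open>C\<close>: only a bounded
  number of gluings can be nested.\<close>

locale nil_sums = nil_system G Y act z f \<Delta>
  for G :: "('g, 'm) monoid_scheme" (structure) and Y :: "'x::metric_space set" and act z f \<Delta> +
  fixes x :: 'x and \<delta> :: real and K :: "'g set" and C :: "'x set"
  assumes x_in: "x \<in> Y"
    and \<delta>: "0 < \<delta>" "\<delta> \<le> \<Delta>/16"
    and K: "finite K" "K \<subseteq> carrier G" "\<one> \<in> K"
    and finite_spt: "finite (spt \<delta> x)"
    and C_Y: "C \<subseteq> Y"
    and glue_translates: "S \<subseteq> carrier G \<Longrightarrow> separated \<delta> K ((\<lambda>s. act (inv s) x) ` S) \<Longrightarrow>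
      \<exists>y. glued (\<Delta>/16) \<delta> K ((\<lambda>s. act (inv s) x) ` S) y \<and> (\<forall>m. (f ^^ m) y \<in> C)"
    and glues_C: "glues C"
begin

definition core :: "'g set" where "core = cell \<delta> K x"

definition translates :: "'g set \<Rightarrow> 'x set" where
  "translates S = (\<lambda>s. act (inv s) x) ` S"

definition spaced :: "'g set \<Rightarrow> bool" where
  "spaced S \<longleftrightarrow> S \<subseteq> carrier G \<and> (\<forall>s\<in>S. \<forall>t\<in>S. s \<noteq> t \<longrightarrow> (core #> s) \<inter> (core #> t) = {})"

definition ptsum :: "'g set \<Rightarrow> 'x" where
  "ptsum S = (SOME y. glued (\<Delta>/16) \<delta> K (translates S) y \<and> (\<forall>m. (f ^^ m) y \<in> C))"

lemma core: "finite core" "core \<subseteq> carrier G"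
  unfolding core_def using cell_subset[OF K(2)] K finite_spt finite_set_mult by (auto simp: cell_def)

lemma inv_core: "finite ((\<lambda>g. inv g) ` core)" "(\<lambda>g. inv g) ` core \<subseteq> carrier G"
  using core by auto

lemma cell_translate: "s \<in> carrier G \<Longrightarrow> cell \<delta> K (act (inv s) x) = core #> s"
  unfolding core_def using cell_act[of "inv s" x K \<delta>] x_in K by simp

lemma translates_Y: "S \<subseteq> carrier G \<Longrightarrow> translates S \<subseteq> Y"
  unfolding translates_def using act_in x_in by auto

lemma spaced_subset: "spaced S \<Longrightarrow> T \<subseteq> S \<Longrightarrow> spaced T"
  unfolding spaced_def by (meson subsetD subset_trans)

lemma spaced_carrier: "spaced S \<Longrightarrow> S \<subseteq> carrier G"
  unfolding spaced_def by blast

lemma core_cosets_meet: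
  assumes "s \<in> carrier G" "t \<in> carrier G" "(core #> s) \<inter> (core #> t) \<noteq> {}"
  shows "\<exists>p\<in>core. \<exists>q\<in>core. s = inv p \<otimes> q \<otimes> t"
proof -
  obtain p q where pq: "p \<in> core" "q \<in> core" "p \<otimes> s = q \<otimes> t"
    using assms(3) unfolding r_coset_def by blast
  have G: "p \<in> carrier G" "q \<in> carrier G" using pq core by auto
  have "s = inv p \<otimes> (p \<otimes> s)" using G assms by (simp add: m_assoc[symmetric])
  also have "\<dots> = inv p \<otimes> q \<otimes> t" using pq(3) G assms by (simp add: m_assoc)
  finally show ?thesis using pq by blast
qed

lemma core_coset_right: "s \<in> carrier G \<Longrightarrow> h \<in> carrier G \<Longrightarrow> core #> (s \<otimes> h) = (core #> s) #> h"
  using coset_mult_assoc core(2) by metis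

lemma r_coset_disjoint:
  assumes "A \<inter> B = {}" "A \<subseteq> carrier G" "B \<subseteq> carrier G" "h \<in> carrier G"
  shows "(A #> h) \<inter> (B #> h) = {}"
  using assms unfolding r_coset_def by (auto simp: subset_iff dest: right_cancel[THEN iffD1, rotated -1])

lemma spaced_shift:
  assumes "spaced S" "h \<in> carrier G"
  shows "spaced (S #> h)"
  unfolding spaced_def
proof (intro conjI ballI impI)
  have SG: "S \<subseteq> carrier G" using assms spaced_carrier by auto
  then show "S #> h \<subseteq> carrier G" using assms(2) r_coset_subset_G by blast
  fix s t assume "s \<in> S #> h" "t \<in> S #> h" "s \<noteq> t"
  then obtain a b where ab: "a \<in> S" "b \<in> S" "s = a \<otimes> h" "t = b \<otimes> h" "a \<noteq> b"
    unfolding r_coset_def by blast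
  have G: "a \<in> carrier G" "b \<in> carrier G" using ab SG by auto
  have "(core #> a) \<inter> (core #> b) = {}" using assms(1) ab unfolding spaced_def by blast
  then show "(core #> s) \<inter> (core #> t) = {}"
    unfolding ab(3,4) core_coset_right[OF G(1) assms(2)] core_coset_right[OF G(2) assms(2)]
    using r_coset_disjoint assms(2) r_coset_subset_G[OF core(2)] G by blast
qed

lemma glued_ptsum:
  assumes "spaced S"
  shows "glued (\<Delta>/16) \<delta> K (translates S) (ptsum S)" "(f ^^ m) (ptsum S) \<in> C"
proof -
  have SG: "S \<subseteq> carrier G" using assms spaced_carrier by auto
  have "separated \<delta> K (translates S)" unfolding separated_def translates_def
  proof (intro ballI impI)
    fix p q assume "p \<in> (\<lambda>s. act (inv s) x) ` S" "q \<in> (\<lambda>s. act (inv s) x) ` S" "p \<noteq> q"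
    then obtain s t where st: "s \<in> S" "t \<in> S" "p = act (inv s) x" "q = act (inv t) x" "s \<noteq> t" by auto
    then have "(core #> s) \<inter> (core #> t) = {}" using assms unfolding spaced_def by blast
    then show "cell \<delta> K p \<inter> cell \<delta> K q = {}" using st SG cell_translate by (metis subsetD)
  qed
  then have "\<exists>y. glued (\<Delta>/16) \<delta> K (translates S) y \<and> (\<forall>m. (f ^^ m) y \<in> C)"
    using glue_translates[OF SG] unfolding translates_def by blast
  from someI_ex[OF this] show "glued (\<Delta>/16) \<delta> K (translates S) (ptsum S)" "(f ^^ m) (ptsum S) \<in> C"
    unfolding ptsum_def by blast+
qed

lemma ptsum_in: "spaced S \<Longrightarrow> ptsum S \<in> Y"
  using glued_ptsum(1) unfolding glued_def by blast

lemma fn_ptsum_in: "spaced S \<Longrightarrow> (f ^^ m) (ptsum S) \<in> Y"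
  using ptsum_in fn_in by blast

lemma ptsum_act:
  assumes "spaced S" "h \<in> carrier G"
  shows "act h (ptsum S) = ptsum (S #> inv h)"
proof -
  have SG: "S \<subseteq> carrier G" using assms spaced_carrier by auto
  have "act h (act (inv s) x) = act (inv (s \<otimes> inv h)) x" if "s \<in> S" for s
    using that SG assms(2) act_mult[of h "inv s" x] x_in by (auto simp: inv_mult_group subset_iff)
  then have "act h ` translates S = translates (S #> inv h)"
    unfolding translates_def r_coset_def by (auto simp: image_iff)
  then have "glued (\<Delta>/16) \<delta> K (translates (S #> inv h)) (act h (ptsum S))"
    using glued_act[OF glued_ptsum(1)[OF assms(1)] assms(2) translates_Y[OF SG] K(2)] by simp
  moreover have "spaced (S #> inv h)" using spaced_shift assms by auto
  ultimately show ?thesis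
    using glued_unique[OF _ glued_ptsum(1)] \<Delta>_pos by auto
qed

lemma ptsum_empty: "ptsum {} = z"
proof -
  have "spaced {}" unfolding spaced_def by auto
  from glued_ptsum(1)[OF this] have "glued (\<Delta>/16) \<delta> K {} (ptsum {})" unfolding translates_def by simp
  then show ?thesis using glued_unique[OF _ glued_empty] \<Delta>_pos by auto
qed

lemma spaced_one: "spaced {\<one>}"
  unfolding spaced_def by auto

lemma ptsum_one: "ptsum {\<one>} = x"
proof -
  have "glued (\<Delta>/16) \<delta> K {x} (ptsum {\<one>})"
    using glued_ptsum(1)[OF spaced_one] act_one[OF x_in] unfolding translates_def by simp
  then show ?thesis using glued_unique[OF _ glued_single[OF x_in]] \<Delta>_pos \<delta> K by auto
qed

text \<open>The index elements whose translate can influence \<open>A\<close> within \<open>m\<close> steps.\<close>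

definition near :: "nat \<Rightarrow> 'g set \<Rightarrow> 'g set" where
  "near m A = (\<lambda>g. inv g) ` core <#> (windows (Suc m) <#> A)"

lemma near:
  assumes "A \<subseteq> carrier G"
  shows "near m A \<subseteq> carrier G" "finite A \<Longrightarrow> finite (near m A)"
  unfolding near_def using assms
  by (auto intro!: finite_set_mult windows(1) inv_core(1)
        simp del: windows.simps intro: subsetD[OF set_mult_closed[OF inv_core(2) set_mult_closed[OF windows(2) assms]]])

lemma core_coset_meets_iff:
  assumes "s \<in> carrier G" "A \<subseteq> carrier G" "(core #> s) \<inter> A \<noteq> {}"
  shows "s \<in> (\<lambda>g. inv g) ` core <#> A"
proof -
  obtain q where q: "q \<in> core" "q \<otimes> s \<in> A" using assms(3) unfolding r_coset_def by blast
  have "q \<in> carrier G" using q core by auto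
  then have "inv q \<otimes> (q \<otimes> s) = s" using assms(1) by (simp add: m_assoc[symmetric])
  moreover have "inv q \<otimes> (q \<otimes> s) \<in> (\<lambda>g. inv g) ` core <#> A" using q by (intro set_multI) auto
  ultimately show ?thesis by simp
qed

text \<open>The sums depend locally on the index set, at all times.\<close>

lemma ptsum_agree:
  assumes S: "spaced S" and S': "spaced S'" and A: "A \<subseteq> carrier G"
    and eq: "S \<inter> near m A = S' \<inter> near m A"
  shows "agree (\<Delta>/8) A ((f ^^ m) (ptsum S)) ((f ^^ m) (ptsum S'))"
proof -
  define W where "W = windows (Suc m) <#> A"
  have W: "W \<subseteq> carrier G" unfolding W_def using windows(2) A by (rule set_mult_closed)
  have G: "S \<subseteq> carrier G" "S' \<subseteq> carrier G" using S S' spaced_carrier by auto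
  have "agree (2 * (\<Delta>/16)) W (ptsum S) (ptsum S')"
  proof (rule glued_agree[OF glued_ptsum(1)[OF S] glued_ptsum(1)[OF S'] W])
    fix p assume p: "p \<in> translates S \<union> translates S'" "cell \<delta> K p \<inter> W \<noteq> {}"
    then obtain s where s: "s \<in> S \<union> S'" "p = act (inv s) x" unfolding translates_def by blast
    then have sG: "s \<in> carrier G" using G by auto
    then have "(core #> s) \<inter> W \<noteq> {}" using p(2) cell_translate s(2) by simp
    then have "s \<in> near m A" using core_coset_meets_iff[OF sG W] unfolding near_def W_def by simp
    then have "s \<in> S \<inter> S'" using s(1) eq by blast
    then show "p \<in> translates S \<inter> translates S'" using s(2) unfolding translates_def by blast
  qed
  then have "agree \<Delta> (windows (Suc m) <#> A) (ptsum S) (ptsum S')"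
    unfolding W_def[symmetric] using \<Delta>_pos by (auto intro: agree_mono)
  then show ?thesis using agree_fn[OF ptsum_in[OF S] ptsum_in[OF S'] A] by blast
qed

lemma ptsum_agree_z:
  assumes S: "spaced S" and A: "A \<subseteq> carrier G" and disj: "S \<inter> near m A = {}"
  shows "agree (\<Delta>/8) A ((f ^^ m) (ptsum S)) z"
proof -
  have "agree (\<Delta>/8) A ((f ^^ m) (ptsum S)) ((f ^^ m) (ptsum {}))"
    using ptsum_agree[OF S spaced_subset[OF S] A, of "{}"] disj by simp
  then show ?thesis using ptsum_empty fn_z by simp
qed

text \<open>Index sets that are separated by \<open>barrier T\<close> give sums that do not interact within \<open>T\<close> steps.\<close>

definition barrier :: "nat \<Rightarrow> 'g set" where
  "barrier T = (\<lambda>g. inv g) ` core <#> (halo T <#> core)"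

lemma barrier: "finite (barrier T)" "barrier T \<subseteq> carrier G"
proof -
  have hc: "finite (halo T <#> core)" "halo T <#> core \<subseteq> carrier G"
    using finite_set_mult[OF halo(1) core(1)] set_mult_closed[OF halo(2) core(2)] by auto
  show "finite (barrier T)" "barrier T \<subseteq> carrier G"
    unfolding barrier_def using finite_set_mult[OF inv_core(1) hc(1)] set_mult_closed[OF inv_core(2) hc(2)]
    by auto
qed

lemma barrier_sep:
  assumes "U \<subseteq> carrier G" "S \<subseteq> carrier G" "S \<inter> (barrier T <#> U) = {}" "s \<in> S" "u \<in> U"
  shows "(core #> s) \<inter> (halo T <#> (core #> u)) = {}"
proof (rule ccontr)
  assume n: "(core #> s) \<inter> (halo T <#> (core #> u)) \<noteq> {}"
  have sG: "s \<in> carrier G" and uG: "{u} \<subseteq> carrier G" using assms by auto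
  have eq: "halo T <#> (core #> u) = (halo T <#> core) <#> {u}"
    unfolding r_coset_eq_set_mult using set_mult_assoc[OF halo(2) core(2) uG] by simp
  have hc: "halo T <#> core \<subseteq> carrier G" using set_mult_closed[OF halo(2) core(2)] .
  have "s \<in> (\<lambda>g. inv g) ` core <#> ((halo T <#> core) <#> {u})"
    using core_coset_meets_iff[OF sG set_mult_closed[OF hc uG]] n eq by simp
  also have "\<dots> = barrier T <#> {u}" unfolding barrier_def using set_mult_assoc[OF inv_core(2) hc uG] by simp
  also have "\<dots> \<subseteq> barrier T <#> U" using assms(5) by (intro mono_set_mult) auto
  finally show False using assms(3,4) by blast
qed

lemma spaced_union:
  assumes S: "spaced S" and U: "spaced U" and disj: "S \<inter> (barrier T <#> U) = {}"
  shows "spaced (S \<union> U)"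
proof -
  have G: "S \<subseteq> carrier G" "U \<subseteq> carrier G" using S U spaced_carrier by auto
  have 1: "(core #> s) \<inter> (core #> u) = {}" if "s \<in> S" "u \<in> U" for s u
  proof -
    have "core #> u \<subseteq> carrier G" using G that r_coset_subset_G[OF core(2)] by blast
    then show ?thesis
      using barrier_sep[OF G(2,1) disj that] subset_set_mult[OF halo(3)] by blast
  qed
  have 2: "(core #> s) \<inter> (core #> t) = {}" if "s \<in> S \<union> U" "t \<in> S \<union> U" "s \<noteq> t" for s t
    using that 1[of s t] 1[of t s] S U unfolding spaced_def by (metis Int_commute UnE)
  show ?thesis using 2 G unfolding spaced_def by simp
qed

lemma merge_ptsum:
  assumes S: "spaced S" and U: "spaced U" and disj: "S \<inter> (barrier T <#> U) = {}"
    and dies: "(f ^^ T) (ptsum U) = z"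
  shows "(f ^^ T) (ptsum (S \<union> U)) = (f ^^ T) (ptsum S)"
proof (rule merge)
  have G: "S \<subseteq> carrier G" "U \<subseteq> carrier G" using S U spaced_carrier by auto
  have "translates (S \<union> U) = translates S \<union> translates U" unfolding translates_def by (rule image_Un)
  then show "glued (\<Delta>/16) \<delta> K (translates S \<union> translates U) (ptsum (S \<union> U))"
    using glued_ptsum(1)[OF spaced_union[OF S U disj]] by simp
  fix p q assume "p \<in> translates U" "q \<in> translates S"
  then obtain u s where us: "u \<in> U" "s \<in> S" "p = act (inv u) x" "q = act (inv s) x"
    unfolding translates_def by blast
  then show "cell \<delta> K q \<inter> (halo T <#> cell \<delta> K p) = {}"
    using barrier_sep[OF G(2,1) disj, of s u] cell_translate G by (metis subsetD)
qed (use glued_ptsum S U dies \<Delta>_pos K in auto)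

end

section \<open>Walls and confinement\<close>

context nil_sums begin

text \<open>The index sets in \<open>B\<close> with periods \<open>M\<close>. The periods act on the right, as \<open>act m\<close> turns the index
  set \<open>S\<close> into \<open>S #> inv m\<close>.\<close>

definition family :: "'g set \<Rightarrow> 'g set \<Rightarrow> 'g set set" where
  "family B M = {S. S \<subseteq> B \<and> spaced S \<and> (\<forall>s\<in>S. \<forall>m\<in>M. s \<otimes> m \<in> S)}"

lemma family_carrier: "S \<in> family B M \<Longrightarrow> S \<subseteq> carrier G"
  unfolding family_def using spaced_carrier by auto

lemma family_truncate:
  assumes "subgroup M G" "S \<in> family B M" "D \<subseteq> carrier G"
  shows "S \<inter> (D <#> M) \<in> family B M"
proof -
  have "s \<otimes> m \<in> D <#> M" if sm: "s \<in> D <#> M" "m \<in> M" for s m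
  proof -
    from sm(1) obtain d k where dk: "d \<in> D" "k \<in> M" "s = d \<otimes> k" by (rule set_multE)
    then have "s \<otimes> m = d \<otimes> (k \<otimes> m)"
      using sm(2) assms subgroup.subset[OF assms(1)] by (simp add: m_assoc subset_iff)
    then show ?thesis using dk sm(2) subgroup.m_closed[OF assms(1)] by (auto intro: set_multI)
  qed
  then show ?thesis using assms(2) spaced_subset[of S] unfolding family_def by auto
qed

text \<open>The Baire category argument: otherwise a point could be built step by step that returns to
  \<open>C0\<close> infinitely often. The index set \<open>U\<close> below is a wall in the sense that, whatever is added to it
  away from \<open>D\<close>, nothing is ever seen on \<open>C0\<close> after time \<open>n\<close>.\<close>

lemma wall_exists:
  assumes M: "subgroup M G" and C0: "finite C0" "C0 \<subseteq> carrier G"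
  shows "\<exists>U D n. U \<in> family B M \<and> finite D \<and> D \<subseteq> carrier G \<and> U \<subseteq> D <#> M \<and>
    (\<forall>S\<in>family B M. S \<inter> (D <#> M) = U \<longrightarrow> (\<forall>m\<ge>n. agree (\<Delta>/2) C0 ((f ^^ m) (ptsum S)) z))"
proof (rule ccontr)
  assume contra: "\<not> ?thesis"
  have M1: "\<one> \<in> M" using subgroup.one_closed[OF M] .
  define P where "P s \<longleftrightarrow> (case s of (U, D, n) \<Rightarrow>
      U \<in> family B M \<and> finite D \<and> D \<subseteq> carrier G \<and> U \<subseteq> D <#> M)" for s :: "'g set \<times> 'g set \<times> nat"
  define Q where "Q s s' \<longleftrightarrow> (case (s, s') of ((U, D, n), (U', D', m)) \<Rightarrow>
      n < m \<and> D \<subseteq> D' \<and> U' \<inter> (D <#> M) = U \<and>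
      (\<forall>S\<in>family B M. S \<inter> (D' <#> M) = U' \<longrightarrow> \<not> agree (\<Delta>/4) C0 ((f ^^ m) (ptsum S)) z))"
    for s s' :: "'g set \<times> 'g set \<times> nat"
  have step: "\<exists>s'. P s' \<and> Q (U, D, n) s'" if "P (U, D, n)" for U D n
  proof -
    have U: "U \<in> family B M" and D: "finite D" "D \<subseteq> carrier G" "U \<subseteq> D <#> M"
      using that unfolding P_def by auto
    then obtain S m where S: "S \<in> family B M" "S \<inter> (D <#> M) = U" "Suc n \<le> m"
      and bad: "\<not> agree (\<Delta>/2) C0 ((f ^^ m) (ptsum S)) z"
      using contra by blast
    have Sp: "spaced S" using S unfolding family_def by auto
    define D' where "D' = D \<union> near m C0"
    have D': "finite D'" "D' \<subseteq> carrier G" unfolding D'_def using D near C0 by auto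
    have "D <#> M \<subseteq> D' <#> M" by (rule mono_set_mult) (auto simp: D'_def)
    then have 1: "(S \<inter> (D' <#> M)) \<inter> (D <#> M) = U" using S(2) by blast
    have "near m C0 \<subseteq> D'" unfolding D'_def by blast
    then have nearD: "near m C0 \<subseteq> D' <#> M" using subset_set_mult_right[OF M1 D'(2)] by blast
    have 2: "\<not> agree (\<Delta>/4) C0 ((f ^^ m) (ptsum S')) z"
      if S': "S' \<in> family B M" "S' \<inter> (D' <#> M) = S \<inter> (D' <#> M)" for S'
    proof
      assume a: "agree (\<Delta>/4) C0 ((f ^^ m) (ptsum S')) z"
      have "S \<inter> near m C0 = S' \<inter> near m C0" using S'(2) nearD by blast
      moreover have "spaced S'" using S' unfolding family_def by auto
      ultimately have "agree (\<Delta>/8) C0 ((f ^^ m) (ptsum S)) ((f ^^ m) (ptsum S'))"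
        using ptsum_agree Sp C0 by blast
      from agree_trans[OF this a, of "\<Delta>/2"] show False using bad \<Delta>_pos by simp
    qed
    have "P (S \<inter> (D' <#> M), D', m)"
      unfolding P_def using family_truncate[OF M S(1) D'(2)] D' by simp
    moreover have "Q (U, D, n) (S \<inter> (D' <#> M), D', m)"
      unfolding Q_def using 1 2 S(3) by (auto simp: D'_def)
    ultimately show ?thesis by blast
  qed
  have "\<exists>F. \<forall>i. P (F i) \<and> Q (F i) (F (Suc i))"
  proof (rule dependent_nat_choice)
    have "P ({}, {}, 0)" unfolding P_def family_def spaced_def by auto
    then show "\<exists>s. P s" by blast
    show "\<exists>s'. P s' \<and> Q s s'" if "P s" for s i using that step by (cases s) blast
  qed
  then obtain F where F: "\<And>i. P (F i)" "\<And>i. Q (F i) (F (Suc i))" by blast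
  define U where "U i = fst (F i)" for i
  define D where "D i = fst (snd (F i))" for i
  define t where "t i = snd (snd (F i))" for i
  have Fi: "F i = (U i, D i, t i)" for i unfolding U_def D_def t_def by simp
  have U: "U i \<in> family B M" "U i \<subseteq> D i <#> M" for i
    using F(1)[of i] unfolding P_def Fi by auto
  have t: "t i < t (Suc i)" and Dm: "D i \<subseteq> D (Suc i)" and Ui: "U (Suc i) \<inter> (D i <#> M) = U i"
    and bad: "\<And>S. S \<in> family B M \<Longrightarrow> S \<inter> (D (Suc i) <#> M) = U (Suc i) \<Longrightarrow>
        \<not> agree (\<Delta>/4) C0 ((f ^^ t (Suc i)) (ptsum S)) z" for i
    using F(2)[of i] unfolding Q_def Fi by auto
  have DM: "D i <#> M \<subseteq> D j <#> M" if "i \<le> j" for i j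
    using lift_Suc_mono_le[of D i j] Dm that by (intro mono_set_mult) auto
  have Umono: "U i \<subseteq> U j" if "i \<le> j" for i j
    using lift_Suc_mono_le[of U i j] Ui that by auto
  have Ucut: "U j \<inter> (D i <#> M) = U i" if "i \<le> j" for i j
    using that
  proof (induction j rule: dec_induct)
    case base then show ?case using U(2) by auto
  next
    case (step j)
    have "U (Suc j) \<inter> (D i <#> M) = U (Suc j) \<inter> (D j <#> M) \<inter> (D i <#> M)"
      using DM[OF step(1)] by blast
    then show ?case using Ui step.IH by simp
  qed
  define S where "S = (\<Union>i. U i)"
  have Scut: "S \<inter> (D i <#> M) = U i" for i
  proof
    show "U i \<subseteq> S \<inter> (D i <#> M)" unfolding S_def using U(2) by blast
    show "S \<inter> (D i <#> M) \<subseteq> U i"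
    proof
      fix s assume s: "s \<in> S \<inter> (D i <#> M)"
      then obtain j where "s \<in> U j" unfolding S_def by blast
      then have "s \<in> U (max i j)" using Umono[of j "max i j"] by auto
      then show "s \<in> U i" using Ucut[of i "max i j"] s by auto
    qed
  qed
  have "spaced S" unfolding spaced_def
  proof (intro conjI ballI impI)
    show "S \<subseteq> carrier G" unfolding S_def using U(1) family_carrier by blast
    fix a b assume "a \<in> S" "b \<in> S" "a \<noteq> b"
    then obtain i j where "a \<in> U i" "b \<in> U j" unfolding S_def by blast
    then have "a \<in> U (max i j)" "b \<in> U (max i j)" using Umono[of i "max i j"] Umono[of j "max i j"] by auto
    then show "(core #> a) \<inter> (core #> b) = {}"
      using U(1)[of "max i j"] \<open>a \<noteq> b\<close> unfolding family_def spaced_def by blast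
  qed
  then have SF: "S \<in> family B M" unfolding S_def using U(1) unfolding family_def by blast
  obtain N where N: "\<And>m. N \<le> m \<Longrightarrow> agree (\<Delta>/4) C0 ((f ^^ m) (ptsum S)) z"
    using eventually_agree_z[OF C0 ptsum_in[OF \<open>spaced S\<close>], of "\<Delta>/4"] \<Delta>_pos by auto
  have "i \<le> t i" for i
  proof (induction i)
    case (Suc i) then show ?case using t[of i] by linarith
  qed simp
  then have "N \<le> t (Suc N)" by (meson Suc_leD)
  then show False using N bad[OF SF Scut] by blast
qed

text \<open>A wall that dies in isolation leaves a mark without being there: by merging, a sum
  that avoids its surroundings has the same future with the wall as without it.\<close>

lemma stable_of_dying_wall:
  assumes M: "M \<subseteq> carrier G" "\<one> \<in> M" and B: "B \<subseteq> carrier G"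
    and U: "U \<in> family B M0" "U \<subseteq> U0 <#> M" "finite U0" "U0 \<subseteq> carrier G"
    and dies: "(f ^^ T) (ptsum U) = z"
    and D: "finite D0" "D0 \<subseteq> carrier G" "D \<subseteq> D0 <#> M"
    and F: "finite F" "F \<subseteq> carrier G"
    and wall: "\<And>S m. S \<in> family B M0 \<Longrightarrow> S \<inter> D = U \<inter> D \<Longrightarrow> n \<le> m \<Longrightarrow>
      agree (\<Delta>/2) F ((f ^^ m) (ptsum S)) z"
  shows "\<exists>D'. finite D' \<and> D' \<subseteq> carrier G \<and> (\<forall>S\<in>family B M0. S \<inter> (D' <#> M) = {} \<longrightarrow>
    (\<forall>m. agree (\<Delta>/2) F ((f ^^ m) (ptsum S)) z))"
proof -
  define T' where "T' = max n T"
  define D' where "D' = D0 \<union> (barrier T' <#> U0) \<union> (\<Union>m<T'. near m F)"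
  have bU: "finite (barrier T' <#> U0)" "barrier T' <#> U0 \<subseteq> carrier G"
    using finite_set_mult[OF barrier(1) U(3)] set_mult_closed[OF barrier(2) U(4)] by auto
  have nearF: "finite (\<Union>m<T'. near m F)" "(\<Union>m<T'. near m F) \<subseteq> carrier G"
    using near[OF F(2)] F(1) by auto
  have D': "finite D'" "D' \<subseteq> carrier G" unfolding D'_def using D bU nearF by auto
  have D'M: "D' \<subseteq> D' <#> M" by (rule subset_set_mult_right[OF M(2) D'(2)])
  have "agree (\<Delta>/2) F ((f ^^ m) (ptsum S)) z"
    if S: "S \<in> family B M0" "S \<inter> (D' <#> M) = {}" for S m
  proof (cases "T' \<le> m")
    case False
    then have "near m F \<subseteq> D'" unfolding D'_def by auto
    then have "near m F \<subseteq> D' <#> M" using D'M by blast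
    then have "S \<inter> near m F = {}" using S(2) by blast
    moreover have "spaced S" using S(1) unfolding family_def by simp
    ultimately have "agree (\<Delta>/8) F ((f ^^ m) (ptsum S)) z"
      by (rule ptsum_agree_z[OF _ F(2), rotated])
    then show ?thesis using \<Delta>_pos by (auto intro: agree_mono)
  next
    case True
    have sp: "spaced S" "spaced U" using S U unfolding family_def by auto
    have "barrier T' <#> U \<subseteq> barrier T' <#> (U0 <#> M)" using U(2) by (intro mono_set_mult) auto
    also have "\<dots> = (barrier T' <#> U0) <#> M" using set_mult_assoc[OF barrier(2) U(4) M(1)] by simp
    also have "\<dots> \<subseteq> D' <#> M" unfolding D'_def by (intro mono_set_mult) auto
    finally have disj: "S \<inter> (barrier T' <#> U) = {}" using S(2) by blast
    have "(f ^^ T') (ptsum U) = z" using fn_zero_mono[OF dies] unfolding T'_def by simp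
    then have eq: "(f ^^ T') (ptsum (S \<union> U)) = (f ^^ T') (ptsum S)"
      by (rule merge_ptsum[OF sp disj])
    have eqm: "(f ^^ m) (ptsum (S \<union> U)) = (f ^^ m) (ptsum S)" using fn_split[OF True] eq by simp
    have "S \<union> U \<in> family B M0"
      using S(1) U(1) spaced_union[OF sp disj] unfolding family_def by blast
    moreover have "D \<subseteq> D' <#> M" using D(3) mono_set_mult[of D0 D' M M] unfolding D'_def by blast
    then have "(S \<union> U) \<inter> D = U \<inter> D" using S(2) by blast
    moreover have "n \<le> m" using True unfolding T'_def by simp
    ultimately show ?thesis using wall[of "S \<union> U" m] eqm by simp
  qed
  then show ?thesis using D' by blast
qed

definition confined :: "'g set \<Rightarrow> 'g set \<Rightarrow> bool" where
  "confined F B \<longleftrightarrow> finite F \<and> F \<subseteq> carrier G \<and> (\<forall>S. S \<subseteq> B \<longrightarrow> spaced S \<longrightarrow>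
     (\<forall>m. agree (\<Delta>/2) (carrier G - (F <#> B)) ((f ^^ m) (ptsum S)) z))"

lemma confinedD:
  assumes "confined F B" "S \<subseteq> B" "spaced S" "g \<in> carrier G" "g \<notin> F <#> B"
  shows "dist (act g ((f ^^ m) (ptsum S))) z \<le> \<Delta>/2"
proof -
  have "agree (\<Delta>/2) (carrier G - (F <#> B)) ((f ^^ m) (ptsum S)) z"
    using assms(1-3) unfolding confined_def by simp
  then have "dist (act g ((f ^^ m) (ptsum S))) (act g z) \<le> \<Delta>/2"
    using assms(4,5) unfolding agree_def by blast
  then show ?thesis using act_z[OF assms(4)] by simp
qed

lemma family_shift:
  assumes B: "subgroup B G" and M0: "M0 \<subseteq> carrier G"
    and norm: "\<And>b m. b \<in> B \<Longrightarrow> m \<in> M0 \<Longrightarrow> inv b \<otimes> m \<otimes> b \<in> M0"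
    and S: "S \<in> family B M0" and u: "u \<in> B"
  shows "S #> u \<in> family B M0"
proof -
  have uG: "u \<in> carrier G" using u subgroup.subset[OF B] by auto
  have SB: "S \<subseteq> B" "spaced S" "S \<subseteq> carrier G" using S family_carrier unfolding family_def by auto
  have "S #> u \<subseteq> B" using SB(1) u subgroup.m_closed[OF B] unfolding r_coset_def by auto
  moreover have "spaced (S #> u)" using spaced_shift[OF SB(2)] uG by simp
  moreover have "s \<otimes> k \<in> S #> u" if sk: "s \<in> S #> u" "k \<in> M0" for s k
  proof -
    obtain t where t: "t \<in> S" "s = t \<otimes> u" using sk(1) unfolding r_coset_def by auto
    have G: "t \<in> carrier G" "k \<in> carrier G" using t sk SB(3) M0 by auto
    have "inv (inv u) \<otimes> k \<otimes> inv u \<in> M0" using norm subgroup.m_inv_closed[OF B u] sk(2) by blast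
    then have "t \<otimes> (u \<otimes> k \<otimes> inv u) \<in> S" using t(1) S uG unfolding family_def by auto
    moreover have "s \<otimes> k = (t \<otimes> (u \<otimes> k \<otimes> inv u)) \<otimes> u"
      using t(2) G uG by (simp add: m_assoc)
    ultimately show ?thesis unfolding r_coset_def by blast
  qed
  ultimately show ?thesis unfolding family_def by blast
qed

text \<open>If \<open>F\<close> stays at zero as long as the index set avoids \<open>D <#> M\<close>, then by equivariance each translate
  \<open>F #> u\<close> stays at zero unless the index set meets \<open>D <#> M <#> {u}\<close>. As the translates of \<open>F\<close> over \<open>B\<close>
  are the only places to be considered, this bounds the support at all times in terms of \<open>S\<close>.\<close>

lemma support_of_stable:
  assumes B: "subgroup B G" and M: "M \<subseteq> B" and conf: "confined F B"
    and norm: "\<And>b m. b \<in> B \<Longrightarrow> m \<in> M0 \<Longrightarrow> inv b \<otimes> m \<otimes> b \<in> M0" and M0: "M0 \<subseteq> carrier G"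
    and D: "D \<subseteq> carrier G"
    and stable: "\<And>S m. S \<in> family B M0 \<Longrightarrow> S \<inter> (D <#> M) = {} \<Longrightarrow>
      agree (\<Delta>/2) F ((f ^^ m) (ptsum S)) z"
    and S: "S \<in> family B M0" and g: "g \<in> carrier G" "\<Delta>/2 < dist (act g ((f ^^ m) (ptsum S))) z"
  shows "\<exists>c\<in>F. \<exists>k\<in>M. \<exists>d\<in>D \<inter> B. \<exists>s\<in>S. g = c \<otimes> (inv k \<otimes> (inv d \<otimes> s))"
proof -
  have BG: "B \<subseteq> carrier G" using subgroup.subset[OF B] .
  have SB: "S \<subseteq> B" "spaced S" using S unfolding family_def by auto
  have "g \<in> F <#> B" using confinedD[OF conf SB g(1), of m] g(2) by force
  then obtain c u where cu: "c \<in> F" "u \<in> B" "g = c \<otimes> u" by (rule set_multE)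
  have uG: "u \<in> carrier G" and cG: "c \<in> carrier G" using cu BG conf unfolding confined_def by auto
  have iu: "inv u \<in> B" using cu(2) B by (simp add: subgroup.m_inv_closed)
  have "act g ((f ^^ m) (ptsum S)) = act c ((f ^^ m) (act u (ptsum S)))"
    using cu(3) act_mult[OF cG uG] fn_act[OF uG] fn_in ptsum_in[OF SB(2)] by simp
  then have "\<Delta>/2 < dist (act c ((f ^^ m) (ptsum (S #> inv u)))) z"
    using g(2) ptsum_act[OF SB(2) uG] by simp
  then have "\<not> agree (\<Delta>/2) F ((f ^^ m) (ptsum (S #> inv u))) z"
    using cu(1) act_z[OF cG] unfolding agree_def by force
  moreover have "S #> inv u \<in> family B M0" by (rule family_shift[OF B M0 norm S iu])
  ultimately have "(S #> inv u) \<inter> (D <#> M) \<noteq> {}" using stable by blast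
  then obtain s d k where sdk: "s \<in> S" "d \<in> D" "k \<in> M" "s \<otimes> inv u = d \<otimes> k"
    unfolding r_coset_def set_mult_def by blast
  have G: "s \<in> carrier G" "d \<in> carrier G" "k \<in> carrier G" using sdk SB(1) BG D M by auto
  have "d = s \<otimes> inv u \<otimes> inv k" using sdk(4) G uG by (simp add: m_assoc)
  also have "\<dots> \<in> B" using sdk SB(1) M iu B
    by (meson subgroup.m_closed subgroup.m_inv_closed subsetD)
  finally have dB: "d \<in> B" .
  have "u = inv (s \<otimes> inv u) \<otimes> s" using G uG by (simp add: inv_mult_group m_assoc)
  also have "\<dots> = inv k \<otimes> (inv d \<otimes> s)" using sdk(4) G by (simp add: inv_mult_group m_assoc)
  finally show ?thesis using cu sdk dB by blast
qed

lemma ptsum_off: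
  assumes "spaced S" "g \<in> carrier G" "\<And>s. s \<in> S \<Longrightarrow> g \<notin> core #> s"
  shows "dist (act g (ptsum S)) z \<le> \<Delta>/16"
proof -
  have "g \<notin> cell \<delta> K p" if "p \<in> translates S" for p
    using that assms(3) cell_translate spaced_carrier[OF assms(1)] unfolding translates_def by auto
  then show ?thesis using glued_ptsum(1)[OF assms(1)] assms(2) unfolding glued_def by blast
qed

lemma confined_carrier: "confined {\<one>} (carrier G)"
proof -
  have "{\<one>} <#> carrier G = carrier G" unfolding set_mult_def by force
  then show ?thesis unfolding confined_def agree_def by simp
qed

text \<open>Since \<open>f\<close> looks only at a finite window, confinement to \<open>B\<close> passes to all subgroups of \<open>B\<close> that
  contain certain finitely many elements.\<close>

lemma confined_local:
  assumes B: "subgroup B G" and conf: "confined F B"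
  shows "\<exists>U F'. finite U \<and> U \<subseteq> B \<and> (\<forall>B1. U \<subseteq> B1 \<longrightarrow> B1 \<subseteq> B \<longrightarrow> subgroup B1 G \<longrightarrow> confined F' B1)"
proof -
  define F' where "F' = F \<union> core"
  have F': "finite F'" "F' \<subseteq> carrier G" using conf core unfolding F'_def confined_def by auto
  define V where "V = (\<lambda>g. inv g) ` F' <#> ((\<lambda>g. inv g) ` window <#> F')"
  have "finite V" unfolding V_def using F' window(1) by (intro finite_set_mult finite_imageI)
  moreover have "confined F' B1" if B1: "V \<inter> B \<subseteq> B1" "B1 \<subseteq> B" "subgroup B1 G" for B1
    unfolding confined_def
  proof (intro conjI allI impI)
    show "finite F'" "F' \<subseteq> carrier G" by (fact F')+
    have BG: "B \<subseteq> carrier G" "B1 \<subseteq> carrier G" using subgroup.subset B B1(3) by auto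
    fix S m assume S: "S \<subseteq> B1" "spaced S"
    show "agree (\<Delta>/2) (carrier G - (F' <#> B1)) ((f ^^ m) (ptsum S)) z"
    proof (induction m)
      case 0
      have "dist (act g (ptsum S)) z \<le> \<Delta>/2" if g: "g \<in> carrier G" "g \<notin> F' <#> B1" for g
      proof -
        have "core #> s \<subseteq> F' <#> B1" if "s \<in> S" for s
          unfolding r_coset_eq_set_mult using that S(1) by (intro mono_set_mult) (auto simp: F'_def)
        then have "dist (act g (ptsum S)) z \<le> \<Delta>/16" using ptsum_off[OF S(2) g(1)] g(2) by blast
        then show ?thesis using \<Delta>_pos by linarith
      qed
      then show ?case unfolding agree_def using act_z by auto
    next
      case (Suc m)
      have "dist (act g ((f ^^ Suc m) (ptsum S))) z \<le> \<Delta>/2" if g: "g \<in> carrier G" "g \<notin> F' <#> B1" for g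
      proof (cases "g \<in> F <#> B")
        case False
        then show ?thesis using confinedD[OF conf _ S(2) g(1)] S(1) B1(2) by blast
      next
        case True
        then obtain c u where cu: "c \<in> F" "u \<in> B" "g = c \<otimes> u" by (rule set_multE)
        have cF: "c \<in> F'" using cu unfolding F'_def by auto
        have cuG: "c \<in> carrier G" "u \<in> carrier G" using cF F' cu BG by auto
        have win: "window <#> {g} \<subseteq> carrier G - (F' <#> B1)"
        proof
          fix a assume "a \<in> window <#> {g}"
          then obtain e where e: "e \<in> window" "a = e \<otimes> g" unfolding set_mult_def by auto
          have eG: "e \<in> carrier G" using e window by auto
          have "a \<notin> F' <#> B1"
          proof
            assume "a \<in> F' <#> B1"
            then obtain c' u' where c': "c' \<in> F'" "u' \<in> B1" "a = c' \<otimes> u'" by (rule set_multE)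
            have c'G: "c' \<in> carrier G" "u' \<in> carrier G" using c' F' BG by auto
            have "u = inv c \<otimes> (inv e \<otimes> (e \<otimes> (c \<otimes> u)))"
              using cuG eG by (simp add: m_assoc[symmetric])
            also have "\<dots> = (inv c \<otimes> (inv e \<otimes> c')) \<otimes> u'"
              using e(2) c'(3) cu(3) cuG c'G eG by (simp add: m_assoc)
            finally have u: "u = (inv c \<otimes> (inv e \<otimes> c')) \<otimes> u'" .
            then have "inv c \<otimes> (inv e \<otimes> c') = u \<otimes> inv u'" using cuG c'G eG by (simp add: m_assoc)
            also have "\<dots> \<in> B" using cu(2) c'(2) B1(2) B
              by (meson subgroup.m_closed subgroup.m_inv_closed subsetD)
            finally have "inv c \<otimes> (inv e \<otimes> c') \<in> V \<inter> B"
              unfolding V_def using cF e(1) c'(1) by (auto intro!: set_multI)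
            then have "u \<in> B1" using u B1(1,3) c'(2) by (metis subgroup.m_closed subsetD)
            then show False using g(2) cu(3) cF by (auto intro: set_multI)
          qed
          then show "a \<in> carrier G - (F' <#> B1)" using e eG g(1) by simp
        qed
        have "agree \<Delta> (window <#> {g}) ((f ^^ m) (ptsum S)) z"
          using agree_mono[OF Suc.IH win] \<Delta>_pos by simp
        then have "agree (\<Delta>/8) {g} (f ((f ^^ m) (ptsum S))) (f z)"
          using agree_window(2)[OF fn_ptsum_in[OF S(2)] z_in, of "{g}"] g(1) by simp
        then show ?thesis using f_z act_z[OF g(1)] \<Delta>_pos unfolding agree_def by simp
      qed
      then show ?case unfolding agree_def using act_z by auto
    qed
  qed
  ultimately show ?thesis by (intro exI[of _ "V \<inter> B"] exI[of _ F']) auto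
qed

lemma confined_finite_index:
  assumes "confined F B" "B1 \<subseteq> B" "B1 \<subseteq> carrier G" "finite T" "T \<subseteq> carrier G" "B \<subseteq> T <#> B1"
  shows "confined (F <#> T) B1"
proof -
  have F: "finite F" "F \<subseteq> carrier G" using assms(1) unfolding confined_def by auto
  have "F <#> B \<subseteq> F <#> (T <#> B1)" using assms(6) by (intro mono_set_mult) auto
  also have "\<dots> = (F <#> T) <#> B1" using set_mult_assoc F assms by simp
  finally have sub: "carrier G - ((F <#> T) <#> B1) \<subseteq> carrier G - (F <#> B)" by blast
  show ?thesis unfolding confined_def
  proof (intro conjI allI impI)
    show "finite (F <#> T)" "F <#> T \<subseteq> carrier G"
      using finite_set_mult[OF F(1) assms(4)] set_mult_closed[OF F(2) assms(5)] by auto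
    fix S m assume "S \<subseteq> B1" "spaced S"
    then show "agree (\<Delta>/2) (carrier G - ((F <#> T) <#> B1)) ((f ^^ m) (ptsum S)) z"
      using assms(1,2) agree_mono[OF _ sub, of "\<Delta>/2"] unfolding confined_def by blast
  qed
qed

text \<open>A periodic point whose support stays bounded modulo its periods dies, as pointwise convergence
  is uniform on finitely many places.\<close>

lemma dies_of_bounded:
  assumes y: "y \<in> Y" and D: "finite D" "D \<subseteq> carrier G" and M: "M \<subseteq> carrier G"
    and per: "\<And>k. k \<in> M \<Longrightarrow> act k y = y"
    and off: "\<And>m g. n \<le> m \<Longrightarrow> g \<in> carrier G \<Longrightarrow> g \<notin> D <#> M \<Longrightarrow> dist (act g ((f ^^ m) y)) z \<le> \<Delta>"
  shows "\<exists>T. (f ^^ T) y = z"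
proof -
  obtain N where N: "\<And>m. N \<le> m \<Longrightarrow> agree \<Delta> D ((f ^^ m) y) z"
    using eventually_agree_z[OF D y \<Delta>_pos] by blast
  define T where "T = max n N"
  have "dist (act g ((f ^^ T) y)) z \<le> \<Delta>" if g: "g \<in> carrier G" for g
  proof (cases "g \<in> D <#> M")
    case True
    then obtain d k where dk: "d \<in> D" "k \<in> M" "g = d \<otimes> k" by (rule set_multE)
    have G: "d \<in> carrier G" "k \<in> carrier G" using dk D M by auto
    have "act g ((f ^^ T) y) = act d ((f ^^ T) (act k y))"
      using dk(3) act_mult[OF G fn_in[OF y]] fn_act[OF G(2) y] by simp
    then have "act g ((f ^^ T) y) = act d ((f ^^ T) y)" using per[OF dk(2)] by simp
    moreover have "dist (act d ((f ^^ T) y)) (act d z) \<le> \<Delta>"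
      using N[of T] dk(1) unfolding agree_def T_def by auto
    ultimately show ?thesis using act_z[OF G(1)] by simp
  next
    case False
    then show ?thesis using off g unfolding T_def by simp
  qed
  then have "agree \<Delta> (carrier G) ((f ^^ T) y) z" unfolding agree_def using act_z by simp
  then show ?thesis using dies_of_agree[OF y] by blast
qed

lemma x_dies_of_confined_finite:
  assumes "confined F B" "finite B" "B \<subseteq> carrier G" "\<one> \<in> B"
  shows "\<exists>T. (f ^^ T) x = z"
proof -
  have F: "finite F" "F \<subseteq> carrier G" using assms(1) unfolding confined_def by auto
  have FB: "finite (F <#> B)" "F <#> B \<subseteq> carrier G"
    using finite_set_mult[OF F(1) assms(2)] set_mult_closed[OF F(2) assms(3)] by auto
  show ?thesis
  proof (rule dies_of_bounded[OF x_in FB, of "{\<one>}" 0])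
    fix m g assume g: "g \<in> carrier G" "g \<notin> (F <#> B) <#> {\<one>}"
    have "g \<notin> F <#> B"
    proof
      assume "g \<in> F <#> B"
      then have "g \<otimes> \<one> \<in> (F <#> B) <#> {\<one>}" by (intro set_multI) auto
      then show False using g by simp
    qed
    then have "dist (act g ((f ^^ m) (ptsum {\<one>}))) z \<le> \<Delta>/2"
      using confinedD[OF assms(1) _ spaced_one g(1)] assms(4) by simp
    then show "dist (act g ((f ^^ m) x)) z \<le> \<Delta>" using ptsum_one \<Delta>_pos by simp
  qed (use act_one x_in in auto)
qed

end

section \<open>Infinite cyclic quotients\<close>

text \<open>The setting for an infinite cyclic quotient, after passing to periodic points: \<open>h\<close> maps \<open>B\<close> onto the
  integers, and all index sets are invariant under a group \<open>M\<close> of periods that has finite index in the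
  kernel. Everything then lives on finitely many copies of the integers.\<close>

locale cyclic_step = nil_sums G Y act z f \<Delta> x \<delta> K C
  for G :: "('g, 'm) monoid_scheme" (structure) and Y :: "'x::metric_space set"
    and act z f \<Delta> x \<delta> K C +
  fixes B M F T0 :: "'g set" and h :: "'g \<Rightarrow> int" and u :: 'g
  assumes B: "subgroup B G" and M: "subgroup M G" "M \<subseteq> B"
    and h_mult: "a \<in> B \<Longrightarrow> b \<in> B \<Longrightarrow> h (a \<otimes> b) = h a + h b"
    and u: "u \<in> B" "h u = 1"
    and h_M: "m \<in> M \<Longrightarrow> h m = 0"
    and M_norm: "b \<in> B \<Longrightarrow> m \<in> M \<Longrightarrow> inv b \<otimes> m \<otimes> b \<in> M"
    and T0: "finite T0" "T0 \<subseteq> B" "\<And>b. b \<in> B \<Longrightarrow> h b = 0 \<Longrightarrow> b \<in> T0 <#> M"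
    and conf: "confined F B" and F_one: "\<one> \<in> F"
begin

lemma BG: "B \<subseteq> carrier G"
  using subgroup.subset[OF B] .

lemma B_carrier: "b \<in> B \<Longrightarrow> b \<in> carrier G"
  using BG by auto

lemma MG: "M \<subseteq> carrier G" "\<one> \<in> M"
  using subgroup.subset[OF M(1)] subgroup.one_closed[OF M(1)] by auto

lemma F: "finite F" "F \<subseteq> carrier G"
  using conf unfolding confined_def by auto

lemma B_closed: "a \<in> B \<Longrightarrow> b \<in> B \<Longrightarrow> a \<otimes> b \<in> B" "a \<in> B \<Longrightarrow> inv a \<in> B" "\<one> \<in> B"
  using subgroup.m_closed[OF B] subgroup.m_inv_closed[OF B] subgroup.one_closed[OF B] by auto

lemma h_one: "h \<one> = 0"
  using h_mult[of \<one> \<one>] B_closed by simp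

lemma h_inv: "a \<in> B \<Longrightarrow> h (inv a) = - h a"
  using h_mult[of "inv a" a] B_closed h_one B_carrier by simp

definition up :: "int \<Rightarrow> 'g" where "up j = u [^] j"

lemma up: "up j \<in> B" "up j \<in> carrier G" "up (i + j) = up i \<otimes> up j" "up (- j) = inv (up j)" "up 0 = \<one>"
proof -
  have uG: "u \<in> carrier G" using u B_carrier by auto
  show G: "up j \<in> carrier G" for j unfolding up_def using uG by simp
  show add: "up (i + j) = up i \<otimes> up j" for i j unfolding up_def using uG int_pow_mult by simp
  show neg: "up (- j) = inv (up j)" for j unfolding up_def using uG int_pow_neg by simp
  show "up 0 = \<one>" unfolding up_def by simp
  have nat: "up (int n) \<in> B" for n
  proof (induction n)
    case 0 then show ?case using B_closed by (simp add: up_def)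
  next
    case (Suc n)
    have "up (int (Suc n)) = up (int n) \<otimes> up 1" using add[of "int n" 1] by (simp add: add.commute)
    then show ?case using Suc B_closed u uG by (simp add: up_def)
  qed
  show "up j \<in> B"
  proof (cases "0 \<le> j")
    case True then show ?thesis using nat[of "nat j"] by simp
  next
    case False
    then have "up (- j) \<in> B" using nat[of "nat (- j)"] by simp
    then show ?thesis using neg[of "- j"] B_closed by simp
  qed
qed

lemma h_up: "h (up j) = j"
proof -
  have nat: "h (up (int n)) = int n" for n
  proof (induction n)
    case 0 then show ?case using up h_one by simp
  next
    case (Suc n)
    have "up (int (Suc n)) = up (int n) \<otimes> up 1" using up(3)[of "int n" 1] by (simp add: add.commute)
    moreover have "h (up 1) = 1" using u B_carrier by (simp add: up_def)
    ultimately show ?case using Suc h_mult up by simp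
  qed
  show ?thesis
  proof (cases "0 \<le> j")
    case True then show ?thesis using nat[of "nat j"] by simp
  next
    case False
    then have "h (up (- j)) = - j" using nat[of "nat (- j)"] by simp
    then show ?thesis using h_inv[of "up j"] up by simp
  qed
qed

text \<open>A subset of \<open>B\<close> of bounded height is finite modulo \<open>M\<close>.\<close>

definition slab :: "int \<Rightarrow> 'g set" where
  "slab c = (\<Union>j\<in>{-c..c}. {up j} <#> T0)"

lemma slab: "finite (slab c)" "slab c \<subseteq> carrier G"
  "b \<in> B \<Longrightarrow> \<bar>h b\<bar> \<le> c \<Longrightarrow> b \<in> slab c <#> M"
proof -
  show "finite (slab c)" unfolding slab_def using finite_set_mult T0(1) by auto
  have T0G: "T0 \<subseteq> carrier G" using T0 BG by auto
  show "slab c \<subseteq> carrier G" unfolding slab_def using set_mult_closed[of "{up j}" T0 for j] T0G up by auto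
  assume b: "b \<in> B" "\<bar>h b\<bar> \<le> c"
  define j where "j = h b"
  have "h (up (- j) \<otimes> b) = 0" using h_mult[OF up(1)[of "- j"] b(1)] h_up[of "- j"] j_def by linarith
  then have "up (- j) \<otimes> b \<in> T0 <#> M" using T0(3) B_closed up b by blast
  then obtain t m where tm: "t \<in> T0" "m \<in> M" "up (- j) \<otimes> b = t \<otimes> m" by (rule set_multE)
  have G: "b \<in> carrier G" "t \<in> carrier G" "m \<in> carrier G" using b tm T0G MG B_carrier by auto
  have "b = up j \<otimes> (up (- j) \<otimes> b)" using up G by (simp add: m_assoc[symmetric])
  also have "\<dots> = (up j \<otimes> t) \<otimes> m" using tm(3) up G by (simp add: m_assoc)
  finally have eq: "b = (up j \<otimes> t) \<otimes> m" .
  have "up j \<otimes> t \<in> {up j} <#> T0" using tm by (intro set_multI) auto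
  moreover have "j \<in> {-c..c}" using b(2) unfolding j_def by (simp add: abs_le_iff)
  ultimately have "up j \<otimes> t \<in> slab c" unfolding slab_def by blast
  then show "b \<in> slab c <#> M" using eq tm(2) by (auto intro: set_multI)
qed

lemma F_slab: "finite (F <#> slab c)" "F <#> slab c \<subseteq> carrier G"
  using finite_set_mult[OF F(1) slab(1)] set_mult_closed[OF F(2) slab(2)] by auto

lemma height_bound:
  assumes "finite W"
  shows "\<exists>r\<ge>0. \<forall>b\<in>W \<inter> B. \<bar>h b\<bar> \<le> r"
proof -
  have "finite ((\<lambda>b. \<bar>h b\<bar>) ` (W \<inter> B))" using assms by auto
  then have "\<forall>b\<in>W \<inter> B. \<bar>h b\<bar> \<le> Max (insert 0 ((\<lambda>b. \<bar>h b\<bar>) ` (W \<inter> B)))" by auto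
  moreover have "0 \<le> Max (insert 0 ((\<lambda>b. \<bar>h b\<bar>) ` (W \<inter> B)))"
    using \<open>finite ((\<lambda>b. \<bar>h b\<bar>) ` (W \<inter> B))\<close> by auto
  ultimately show ?thesis by blast
qed

definition region :: "int set \<Rightarrow> 'g set" where
  "region J = {c \<otimes> b | c b. c \<in> F \<and> b \<in> B \<and> h b \<in> J}"

definition fat :: "int \<Rightarrow> int set \<Rightarrow> int set" where
  "fat r J = {i. \<exists>j\<in>J. \<bar>i - j\<bar> \<le> r}"

lemma regionI: "c \<in> F \<Longrightarrow> b \<in> B \<Longrightarrow> h b \<in> J \<Longrightarrow> c \<otimes> b \<in> region J"
  unfolding region_def by blast

lemma regionE:
  assumes "g \<in> region J" obtains c b where "c \<in> F" "b \<in> B" "h b \<in> J" "g = c \<otimes> b"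
  using assms unfolding region_def by blast

lemma region_carrier: "region J \<subseteq> carrier G"
  unfolding region_def using F BG by auto

lemma region_mono: "J \<subseteq> J' \<Longrightarrow> region J \<subseteq> region J'"
  unfolding region_def by blast

lemma region_UNIV: "region UNIV = F <#> B"
  unfolding region_def set_mult_def by blast

lemma region_slab: "J \<subseteq> {-c..c} \<Longrightarrow> region J \<subseteq> (F <#> slab c) <#> M"
proof
  fix g assume J: "J \<subseteq> {-c..c}" and "g \<in> region J"
  then obtain d b where db: "d \<in> F" "b \<in> B" "h b \<in> J" "g = d \<otimes> b" by (elim regionE)
  then have "h b \<in> {-c..c}" using J by blast
  then have "\<bar>h b\<bar> \<le> c" by auto
  then have "b \<in> slab c <#> M" using slab(3) db(2) by blast
  then have "g \<in> F <#> (slab c <#> M)" using db by (auto intro: set_multI)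
  then show "g \<in> (F <#> slab c) <#> M" using set_mult_assoc[OF F(2) slab(2) MG(1)] by simp
qed

lemma region_shift: "b \<in> B \<Longrightarrow> region J #> b = region ((\<lambda>j. j + h b) ` J)"
proof (intro equalityI subsetI)
  fix g assume b: "b \<in> B" and "g \<in> region J #> b"
  then obtain a where "a \<in> region J" "g = a \<otimes> b" unfolding r_coset_def by blast
  then obtain c d where cd: "c \<in> F" "d \<in> B" "h d \<in> J" "g = c \<otimes> d \<otimes> b" by (metis regionE)
  then have "g = c \<otimes> (d \<otimes> b)" using b B_carrier F by (simp add: m_assoc subset_iff)
  moreover have "d \<otimes> b \<in> B" "h (d \<otimes> b) \<in> (\<lambda>j. j + h b) ` J" using cd b B_closed h_mult by auto
  ultimately show "g \<in> region ((\<lambda>j. j + h b) ` J)" using cd(1) by (auto intro: regionI)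
next
  fix g assume b: "b \<in> B" and "g \<in> region ((\<lambda>j. j + h b) ` J)"
  then obtain c d where cd: "c \<in> F" "d \<in> B" "h d \<in> (\<lambda>j. j + h b) ` J" "g = c \<otimes> d" by (elim regionE)
  have "h (d \<otimes> inv b) \<in> J" using cd b B_closed h_mult h_inv by auto
  then have "c \<otimes> (d \<otimes> inv b) \<in> region J" using cd b B_closed by (intro regionI) auto
  moreover have "g = c \<otimes> (d \<otimes> inv b) \<otimes> b" using cd b B_carrier F by (simp add: m_assoc subset_iff)
  ultimately show "g \<in> region J #> b" unfolding r_coset_def by blast
qed

text \<open>Multiplication by a finite set changes heights by a bounded amount, as only finitely many
  elements of \<open>B\<close> have the form \<open>inv c' \<otimes> w \<otimes> c\<close> with \<open>c, c' \<in> F\<close> and \<open>w \<in> W\<close>. So locality in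
  the group becomes locality in the height.\<close>

lemma region_spread:
  assumes W: "finite W" "W \<subseteq> carrier G"
  shows "\<exists>r\<ge>0. \<forall>J. \<forall>g\<in>region J. \<forall>w\<in>W. w \<otimes> g \<in> F <#> B \<longrightarrow> w \<otimes> g \<in> region (fat r J)"
proof -
  have iF: "finite ((\<lambda>g. inv g) ` F)" using F by auto
  have "finite ((\<lambda>g. inv g) ` F <#> (W <#> F))"
    by (rule finite_set_mult[OF iF finite_set_mult[OF W(1) F(1)]])
  from height_bound[OF this] obtain r where r: "0 \<le> r"
    "\<And>b. b \<in> (\<lambda>g. inv g) ` F <#> (W <#> F) \<Longrightarrow> b \<in> B \<Longrightarrow> \<bar>h b\<bar> \<le> r" by blast
  have "w \<otimes> g \<in> region (fat r J)" if g: "g \<in> region J" and w: "w \<in> W" and in_FB: "w \<otimes> g \<in> F <#> B" for J g w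
  proof -
    obtain c b where cb: "c \<in> F" "b \<in> B" "h b \<in> J" "g = c \<otimes> b" using g by (rule regionE)
    obtain c' b' where cb': "c' \<in> F" "b' \<in> B" "w \<otimes> g = c' \<otimes> b'" using in_FB by (rule set_multE)
    have G: "c \<in> carrier G" "c' \<in> carrier G" "b \<in> carrier G" "b' \<in> carrier G" "w \<in> carrier G"
      using cb cb' F W w B_carrier by auto
    have "inv c' \<otimes> (w \<otimes> c) = inv c' \<otimes> (w \<otimes> (c \<otimes> b)) \<otimes> inv b" using G by (simp add: m_assoc)
    also have "\<dots> = inv c' \<otimes> (c' \<otimes> b') \<otimes> inv b" using cb'(3) cb(4) by simp
    also have "\<dots> = b' \<otimes> inv b" using G by (simp add: m_assoc[symmetric])
    finally have eq: "inv c' \<otimes> (w \<otimes> c) = b' \<otimes> inv b" .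
    have "inv c' \<otimes> (w \<otimes> c) \<in> (\<lambda>g. inv g) ` F <#> (W <#> F)"
      using cb(1) cb'(1) w by (intro set_multI) auto
    then have "\<bar>h (b' \<otimes> inv b)\<bar> \<le> r" using r(2) eq cb cb' B_closed by metis
    then have "\<bar>h b' - h b\<bar> \<le> r" using h_mult h_inv cb cb' B_closed by simp
    then have "h b' \<in> fat r J" unfolding fat_def using cb(3) by blast
    then show ?thesis using cb' by (auto intro: regionI)
  qed
  then show ?thesis using r(1) by blast
qed

lemma height_spread:
  assumes W: "finite W" "W \<subseteq> carrier G"
  shows "\<exists>r\<ge>0. \<forall>J. \<forall>s\<in>B. s \<in> W <#> region J \<longrightarrow> h s \<in> fat r J"
proof -
  have "finite (W <#> F)" by (rule finite_set_mult[OF W(1) F(1)])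
  from height_bound[OF this] obtain r where r: "0 \<le> r"
    "\<And>b. b \<in> W <#> F \<Longrightarrow> b \<in> B \<Longrightarrow> \<bar>h b\<bar> \<le> r" by blast
  have "h s \<in> fat r J" if s: "s \<in> B" "s \<in> W <#> region J" for s J
  proof -
    obtain w g where wg: "w \<in> W" "g \<in> region J" "s = w \<otimes> g" using s(2) by (rule set_multE)
    obtain c b where cb: "c \<in> F" "b \<in> B" "h b \<in> J" "g = c \<otimes> b" using wg(2) by (rule regionE)
    have G: "c \<in> carrier G" "b \<in> carrier G" "w \<in> carrier G" using cb F W wg B_carrier by auto
    have eq: "w \<otimes> c = s \<otimes> inv b" using wg(3) cb(4) G by (simp add: m_assoc)
    have "w \<otimes> c \<in> W <#> F" using wg cb by (intro set_multI)
    then have "\<bar>h (s \<otimes> inv b)\<bar> \<le> r" using r(2) eq s cb B_closed by metis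
    then have "\<bar>h s - h b\<bar> \<le> r" using h_mult h_inv cb s B_closed by simp
    then show ?thesis unfolding fat_def using cb(3) by blast
  qed
  then show ?thesis using r(1) by blast
qed

lemma family_spaced: "S \<in> family B M \<Longrightarrow> spaced S" "S \<in> family B M \<Longrightarrow> S \<subseteq> B"
  unfolding family_def by auto

lemma fat_mono: "r \<le> r' \<Longrightarrow> fat r J \<subseteq> fat r' J"
  unfolding fat_def by force

lemma agree_of_heights:
  "\<exists>r\<ge>0. \<forall>J. \<forall>S\<in>family B M. \<forall>S'\<in>family B M. (\<forall>s\<in>B. h s \<in> fat r J \<longrightarrow> (s \<in> S \<longleftrightarrow> s \<in> S')) \<longrightarrow>
     agree (\<Delta>/8) (region J) ((f ^^ m) (ptsum S)) ((f ^^ m) (ptsum S'))"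
proof -
  define W where "W = (\<lambda>g. inv g) ` core <#> windows (Suc m)"
  have W: "finite W" unfolding W_def by (rule finite_set_mult[OF inv_core(1) windows(1)])
  have WG: "W \<subseteq> carrier G" unfolding W_def by (rule set_mult_closed[OF inv_core(2) windows(2)])
  have nearW: "near m (region J) = W <#> region J" for J
    unfolding near_def W_def by (rule set_mult_assoc[OF inv_core(2) windows(2) region_carrier, symmetric])
  obtain r where r: "0 \<le> r" "\<And>J s. s \<in> B \<Longrightarrow> s \<in> W <#> region J \<Longrightarrow> h s \<in> fat r J"
    using height_spread[OF W WG] by blast
  have "agree (\<Delta>/8) (region J) ((f ^^ m) (ptsum S)) ((f ^^ m) (ptsum S'))"
    if S: "S \<in> family B M" "S' \<in> family B M" "\<forall>s\<in>B. h s \<in> fat r J \<longrightarrow> (s \<in> S \<longleftrightarrow> s \<in> S')" for J S S'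
  proof (rule ptsum_agree[OF family_spaced(1)[OF S(1)] family_spaced(1)[OF S(2)] region_carrier])
    show "S \<inter> near m (region J) = S' \<inter> near m (region J)"
      using S family_spaced(2)[OF S(1)] family_spaced(2)[OF S(2)] r(2)[of _ J] unfolding nearW by blast
  qed
  then show ?thesis using r(1) by blast
qed

lemma agree_of_heights_upto:
  "\<exists>r\<ge>0. \<forall>J. \<forall>S\<in>family B M. \<forall>S'\<in>family B M. (\<forall>s\<in>B. h s \<in> fat r J \<longrightarrow> (s \<in> S \<longleftrightarrow> s \<in> S')) \<longrightarrow>
     (\<forall>m\<le>n. agree (\<Delta>/8) (region J) ((f ^^ m) (ptsum S)) ((f ^^ m) (ptsum S')))"
proof (induction n)
  case 0
  show ?case using agree_of_heights[of 0] by simp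
next
  case (Suc n)
  obtain r where r: "0 \<le> r" "\<forall>J. \<forall>S\<in>family B M. \<forall>S'\<in>family B M. (\<forall>s\<in>B. h s \<in> fat r J \<longrightarrow> (s \<in> S \<longleftrightarrow> s \<in> S')) \<longrightarrow>
     (\<forall>m\<le>n. agree (\<Delta>/8) (region J) ((f ^^ m) (ptsum S)) ((f ^^ m) (ptsum S')))"
    using Suc by blast
  obtain r' where r': "0 \<le> r'" "\<forall>J. \<forall>S\<in>family B M. \<forall>S'\<in>family B M. (\<forall>s\<in>B. h s \<in> fat r' J \<longrightarrow> (s \<in> S \<longleftrightarrow> s \<in> S')) \<longrightarrow>
     agree (\<Delta>/8) (region J) ((f ^^ Suc n) (ptsum S)) ((f ^^ Suc n) (ptsum S'))"
    using agree_of_heights[of "Suc n"] by blast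
  have "agree (\<Delta>/8) (region J) ((f ^^ m) (ptsum S)) ((f ^^ m) (ptsum S'))"
    if S: "S \<in> family B M" "S' \<in> family B M"
      and eq: "\<forall>s\<in>B. h s \<in> fat (max r r') J \<longrightarrow> (s \<in> S \<longleftrightarrow> s \<in> S')" and m: "m \<le> Suc n" for J S S' m
  proof (cases "m \<le> n")
    case True
    have "\<forall>s\<in>B. h s \<in> fat r J \<longrightarrow> (s \<in> S \<longleftrightarrow> s \<in> S')" using eq fat_mono[of r "max r r'" J] by auto
    then show ?thesis using r(2) S True by blast
  next
    case False
    then have "m = Suc n" using m by simp
    moreover have "\<forall>s\<in>B. h s \<in> fat r' J \<longrightarrow> (s \<in> S \<longleftrightarrow> s \<in> S')" using eq fat_mono[of r' "max r r'" J] by auto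
    ultimately show ?thesis using r'(2) S by blast
  qed
  then show ?case using r(1) by (intro exI[of _ "max r r'"]) auto
qed

lemma family_M:
  assumes "S \<in> family B M" "m \<in> M"
  shows "S #> m = S"
proof (intro equalityI subsetI)
  have SG: "S \<subseteq> carrier G" using assms family_carrier by blast
  have inv: "s \<otimes> k \<in> S" if "s \<in> S" "k \<in> M" for s k using assms(1) that unfolding family_def by auto
  have mG: "m \<in> carrier G" using assms MG by auto
  fix s
  show "s \<in> S #> m \<Longrightarrow> s \<in> S" using inv assms(2) unfolding r_coset_def by auto
  assume s: "s \<in> S"
  then have "s \<otimes> inv m \<in> S" using inv assms(2) subgroup.m_inv_closed[OF M(1)] by auto
  moreover have "s = s \<otimes> inv m \<otimes> m" using s SG mG by (simp add: m_assoc subset_iff)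
  ultimately show "s \<in> S #> m" unfolding r_coset_def by blast
qed

lemma ptsum_M:
  assumes "S \<in> family B M" "m \<in> M"
  shows "act m (ptsum S) = ptsum S"
  using ptsum_act[OF family_spaced(1)[OF assms(1)], of m] family_M[OF assms(1)] assms(2) MG
    subgroup.m_inv_closed[OF M(1)] by auto

lemma agree_M:
  assumes S: "S \<in> family B M" and A: "A \<subseteq> carrier G" and ag: "agree \<eta> A ((f ^^ m) (ptsum S)) z"
  shows "agree \<eta> (A <#> M) ((f ^^ m) (ptsum S)) z"
  unfolding agree_def
proof
  have Y: "ptsum S \<in> Y" using ptsum_in family_spaced(1)[OF S] by blast
  fix g assume "g \<in> A <#> M"
  then obtain a k where ak: "a \<in> A" "k \<in> M" "g = a \<otimes> k" by (rule set_multE)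
  have G: "a \<in> carrier G" "k \<in> carrier G" using ak A MG by auto
  have "act g ((f ^^ m) (ptsum S)) = act a ((f ^^ m) (act k (ptsum S)))"
    using ak(3) act_mult[OF G fn_in[OF Y]] fn_act[OF G(2) Y] by simp
  then have "act g ((f ^^ m) (ptsum S)) = act a ((f ^^ m) (ptsum S))" using ptsum_M[OF S ak(2)] by simp
  moreover have "act g z = act a z" using ak(3) G act_z by simp
  ultimately show "dist (act g ((f ^^ m) (ptsum S))) (act g z) \<le> \<eta>"
    using ag ak(1) unfolding agree_def by simp
qed

lemma off_region:
  assumes "S \<in> family B M" "g \<in> carrier G" "g \<notin> region UNIV"
  shows "dist (act g ((f ^^ m) (ptsum S))) z \<le> \<Delta>/2"
  using confinedD[OF conf family_spaced(2)[OF assms(1)] family_spaced(1)[OF assms(1)] assms(2)]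
    assms(3) region_UNIV by simp

lemma off_region_agree:
  assumes "S \<in> family B M" "S' \<in> family B M" "g \<in> carrier G" "g \<notin> region UNIV"
  shows "dist (act g ((f ^^ m) (ptsum S))) (act g ((f ^^ m') (ptsum S'))) \<le> \<Delta>"
  using off_region[OF assms(1,3,4), of m] off_region[OF assms(2,3,4), of m']
    dist_triangle2[of "act g ((f ^^ m) (ptsum S))" "act g ((f ^^ m') (ptsum S'))" z] by linarith

end

text \<open>Placing copies of an \<open>M\<close>-invariant wall \<open>V\<close> at multiples of a large \<open>k\<close> turns subsets \<open>A\<close> of the
  integers into points \<open>pt A\<close>. The wall keeps the \<open>c0\<close> levels on both sides of its centre at zero from
  time \<open>n\<close> on, and \<open>c0\<close> is the reach of \<open>f\<close>: no information crosses it any more. The spacing \<open>k\<close>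
  exceeds the sum of \<open>c0\<close>, the reach \<open>\<rho>\<close> of the first \<open>n\<close> steps, the extent \<open>2 * l\<close> of \<open>V\<close> and the
  extent \<open>\<kappa>\<close> of the cores. So distinct copies neither overlap nor interact before they are walls.\<close>

locale cyclic_walls = cyclic_step G Y act z f \<Delta> x \<delta> K C B M F T0 h u
  for G :: "('g, 'm) monoid_scheme" (structure) and Y :: "'x::metric_space set"
    and act z f \<Delta> x \<delta> K C B M F T0 h u +
  fixes V D :: "'g set" and n :: nat and c0 l k \<kappa> \<rho> :: int
  assumes V: "V \<in> family B M" "V \<subseteq> D <#> M" and D: "finite D" "D \<subseteq> carrier G"
    and wall0: "S \<in> family B M \<Longrightarrow> S \<inter> (D <#> M) = V \<Longrightarrow> n \<le> m \<Longrightarrow>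
      agree (\<Delta>/2) (region {-c0..c0}) ((f ^^ m) (ptsum S)) z"
    and l: "0 \<le> l" "b \<in> B \<Longrightarrow> b \<in> D <#> M \<Longrightarrow> \<bar>h b\<bar> \<le> l"
    and c0: "0 \<le> c0" "g \<in> region J \<Longrightarrow> w \<in> window \<Longrightarrow> w \<otimes> g \<in> F <#> B \<Longrightarrow> w \<otimes> g \<in> region (fat c0 J)"
    and \<rho>: "0 \<le> \<rho>" "S \<in> family B M \<Longrightarrow> S' \<in> family B M \<Longrightarrow> m \<le> n \<Longrightarrow>
      (\<And>s. s \<in> B \<Longrightarrow> h s \<in> fat \<rho> J \<Longrightarrow> s \<in> S \<longleftrightarrow> s \<in> S') \<Longrightarrow>
      agree (\<Delta>/8) (region J) ((f ^^ m) (ptsum S)) ((f ^^ m) (ptsum S'))"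
    and \<kappa>: "0 \<le> \<kappa>" "p \<in> core \<Longrightarrow> q \<in> core \<Longrightarrow> inv p \<otimes> q \<in> B \<Longrightarrow> \<bar>h (inv p \<otimes> q)\<bar> \<le> \<kappa>"
    and k: "c0 + \<rho> + 2 * l + \<kappa> < k"
begin

lemma k_pos: "0 < k"
  using k c0 l \<rho> \<kappa> by linarith

lemma V_height: "v \<in> V \<Longrightarrow> v \<in> B \<and> \<bar>h v\<bar> \<le> l"
  using V l(2) family_spaced(2)[OF V(1)] by blast

definition config :: "int set \<Rightarrow> 'g set" where
  "config A = (\<Union>a\<in>A. V #> up (k * a))"

definition pt :: "int set \<Rightarrow> 'x" where
  "pt A = ptsum (config A)"

lemma configI: "a \<in> A \<Longrightarrow> v \<in> V \<Longrightarrow> v \<otimes> up (k * a) \<in> config A"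
  unfolding config_def r_coset_def by blast

lemma configE:
  assumes "s \<in> config A"
  obtains a v where "a \<in> A" "v \<in> V" "s = v \<otimes> up (k * a)" "s \<in> B" "\<bar>h s - k * a\<bar> \<le> l"
proof -
  obtain a v where av: "a \<in> A" "v \<in> V" "s = v \<otimes> up (k * a)"
    using assms unfolding config_def r_coset_def by blast
  then have "s \<in> B" "h s = h v + k * a" using V_height up h_up h_mult B_closed by auto
  then show ?thesis using that av V_height[of v] by auto
qed

lemma multiples_apart: "\<bar>k * a - k * b\<bar> < k \<Longrightarrow> a = b"
proof -
  assume "\<bar>k * a - k * b\<bar> < k"
  then have "\<bar>k * (a - b)\<bar> < k" by (simp add: right_diff_distrib)
  then have "k * \<bar>a - b\<bar> < k * 1" using k_pos by (simp add: abs_mult)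
  then have "\<bar>a - b\<bar> < 1" using k_pos by (simp only: mult_less_cancel_left_pos)
  then show "a = b" by simp
qed

lemma config_mem:
  assumes s: "s \<in> B" "\<bar>h s - k * a\<bar> \<le> l"
  shows "s \<in> config A \<longleftrightarrow> a \<in> A \<and> s \<otimes> up (- (k * a)) \<in> V"
proof
  assume "s \<in> config A"
  then obtain b v where bv: "b \<in> A" "v \<in> V" "s = v \<otimes> up (k * b)" "\<bar>h s - k * b\<bar> \<le> l" by (rule configE)
  have "\<bar>k * a - k * b\<bar> \<le> 2 * l" using s(2) bv(4) by linarith
  then have "\<bar>k * a - k * b\<bar> < k" using k c0 \<rho> \<kappa> by linarith
  then have ab: "a = b" by (rule multiples_apart)
  have "s \<otimes> up (- (k * a)) = v" using bv(2,3) ab up V_height[of v] B_carrier by (simp add: m_assoc)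
  then show "a \<in> A \<and> s \<otimes> up (- (k * a)) \<in> V" using bv ab by auto
next
  assume a: "a \<in> A \<and> s \<otimes> up (- (k * a)) \<in> V"
  then have "s \<otimes> up (- (k * a)) \<otimes> up (k * a) \<in> config A" using configI by blast
  moreover have "s \<otimes> up (- (k * a)) \<otimes> up (k * a) = s" using s(1) up B_carrier by (simp add: m_assoc)
  ultimately show "s \<in> config A" by simp
qed

lemma V_shift_family: "V #> up j \<in> family B M"
  by (rule family_shift[OF B MG(1) M_norm V(1) up(1)])

lemma config_family: "config A \<in> family B M"
proof -
  have "spaced (config A)" unfolding spaced_def
  proof (intro conjI ballI impI)
    show "config A \<subseteq> carrier G" using configE BG by blast
    fix s t assume st: "s \<in> config A" "t \<in> config A" "s \<noteq> t"
    obtain a v where a: "a \<in> A" "v \<in> V" "s = v \<otimes> up (k * a)" "s \<in> B" "\<bar>h s - k * a\<bar> \<le> l"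
      using st(1) by (rule configE)
    obtain b w where b: "b \<in> A" "w \<in> V" "t = w \<otimes> up (k * b)" "t \<in> B" "\<bar>h t - k * b\<bar> \<le> l"
      using st(2) by (rule configE)
    show "(core #> s) \<inter> (core #> t) = {}"
    proof (rule ccontr)
      assume n: "(core #> s) \<inter> (core #> t) \<noteq> {}"
      obtain p q where pq: "p \<in> core" "q \<in> core" "s = inv p \<otimes> q \<otimes> t"
        using core_cosets_meet[OF B_carrier[OF a(4)] B_carrier[OF b(4)] n] by blast
      have G: "s \<in> carrier G" "t \<in> carrier G" "inv p \<otimes> q \<in> carrier G" using a b pq core B_carrier by auto
      have eq: "inv p \<otimes> q = s \<otimes> inv t" using pq(3) G by (simp add: m_assoc)
      then have "inv p \<otimes> q \<in> B" using a b B_closed by simp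
      then have "\<bar>h (s \<otimes> inv t)\<bar> \<le> \<kappa>" using \<kappa>(2) pq eq by metis
      then have "\<bar>h s - h t\<bar> \<le> \<kappa>" using h_mult h_inv a b B_closed by simp
      then have "\<bar>k * a - k * b\<bar> < k" using a(5) b(5) k c0 \<rho> by linarith
      then have "a = b" by (rule multiples_apart)
      then have "s \<in> V #> up (k * a)" "t \<in> V #> up (k * a)" using a b unfolding r_coset_def by auto
      then have "(core #> s) \<inter> (core #> t) = {}"
        using family_spaced(1)[OF V_shift_family[of "k * a"]] st(3) unfolding spaced_def by blast
      then show False using n by simp
    qed
  qed
  moreover have "s \<otimes> m \<in> config A" if "s \<in> config A" "m \<in> M" for s m
    using that V_shift_family unfolding config_def family_def by blast
  moreover have "config A \<subseteq> B" using configE by blast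
  ultimately show ?thesis unfolding family_def by blast
qed

lemma pt_in: "pt A \<in> Y"
  unfolding pt_def using ptsum_in family_spaced(1)[OF config_family] by blast

lemma fn_pt_in: "(f ^^ m) (pt A) \<in> Y"
  using fn_in pt_in by blast

lemma pt_empty: "pt {} = z"
  unfolding pt_def config_def using ptsum_empty by simp

lemma wall_at:
  assumes "a \<in> A" "n \<le> m"
  shows "agree (\<Delta>/2) (region {k * a - c0..k * a + c0}) ((f ^^ m) (pt A)) z"
proof -
  define S where "S = config A #> up (- (k * a))"
  have S: "S \<in> family B M" unfolding S_def
    by (rule family_shift[OF B MG(1) M_norm config_family up(1)])
  have mem: "s \<in> S \<longleftrightarrow> s \<in> V" if s: "s \<in> B" "\<bar>h s\<bar> \<le> l" for s
  proof -
    have sG: "s \<in> carrier G" using s B_carrier by auto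
    have "s \<in> S \<longleftrightarrow> s \<otimes> up (k * a) \<in> config A"
    proof
      assume "s \<in> S"
      then obtain t where t: "t \<in> config A" "s = t \<otimes> up (- (k * a))" unfolding S_def r_coset_def by blast
      moreover have "t \<in> carrier G" using t(1) config_family family_carrier by blast
      ultimately show "s \<otimes> up (k * a) \<in> config A" using up by (simp add: m_assoc)
    next
      assume t: "s \<otimes> up (k * a) \<in> config A"
      have "s = s \<otimes> up (k * a) \<otimes> up (- (k * a))" using sG up by (simp add: m_assoc)
      then show "s \<in> S" using t unfolding S_def r_coset_def by blast
    qed
    also have "\<dots> \<longleftrightarrow> a \<in> A \<and> s \<otimes> up (k * a) \<otimes> up (- (k * a)) \<in> V"
      using s h_mult[OF s(1) up(1)] h_up up(1) B_closed by (intro config_mem) auto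
    also have "\<dots> \<longleftrightarrow> s \<in> V" using assms(1) sG up by (simp add: m_assoc)
    finally show ?thesis .
  qed
  have "S \<inter> (D <#> M) = V"
  proof (intro equalityI subsetI)
    fix s assume s: "s \<in> S \<inter> (D <#> M)"
    then have "s \<in> B" "\<bar>h s\<bar> \<le> l" using family_spaced(2)[OF S] l(2) by auto
    then show "s \<in> V" using mem s by blast
  next
    fix s assume s: "s \<in> V"
    then show "s \<in> S \<inter> (D <#> M)" using mem V_height V(2) by blast
  qed
  then have w: "agree (\<Delta>/2) (region {-c0..c0}) ((f ^^ m) (ptsum S)) z" using wall0[OF S] assms(2) by blast
  have spA: "spaced (config A)" using family_spaced(1)[OF config_family] .
  have "act (up (k * a)) (ptsum (config A)) = ptsum S"
    using ptsum_act[OF spA, of "up (k * a)"] up unfolding S_def by simp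
  then have "(f ^^ m) (ptsum S) = act (up (k * a)) ((f ^^ m) (pt A))"
    using fn_act[OF up(2) ptsum_in[OF spA]] unfolding pt_def by metis
  then have "agree (\<Delta>/2) (region {-c0..c0}) (act (up (k * a)) ((f ^^ m) (pt A))) (act (up (k * a)) z)"
    using w act_z up by simp
  then have "agree (\<Delta>/2) (region {-c0..c0} #> up (k * a)) ((f ^^ m) (pt A)) z"
    using agree_act[OF up(2) fn_pt_in z_in region_carrier] by blast
  then have "agree (\<Delta>/2) (region ((\<lambda>j. j + k * a) ` {-c0..c0})) ((f ^^ m) (pt A)) z"
    using region_shift[OF up(1)] h_up by simp
  moreover have "{k * a - c0..k * a + c0} \<subseteq> (\<lambda>j. j + k * a) ` {-c0..c0}"
  proof
    fix j assume "j \<in> {k * a - c0..k * a + c0}"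
    then have "j - k * a \<in> {-c0..c0}" "j = (j - k * a) + k * a" by auto
    then show "j \<in> (\<lambda>j. j + k * a) ` {-c0..c0}" by blast
  qed
  ultimately show ?thesis using agree_mono[OF _ region_mono] by blast
qed

text \<open>Intervals of indices and the corresponding intervals of heights; \<open>None\<close> stands for an infinite end.\<close>

definition in_range :: "int option \<Rightarrow> int option \<Rightarrow> int \<Rightarrow> bool" where
  "in_range p q a \<longleftrightarrow> (\<forall>i. p = Some i \<longrightarrow> i \<le> a) \<and> (\<forall>i. q = Some i \<longrightarrow> a \<le> i)"

definition span :: "int option \<Rightarrow> int option \<Rightarrow> int set" where
  "span p q = {j. (\<forall>i. p = Some i \<longrightarrow> k * i - c0 \<le> j) \<and> (\<forall>i. q = Some i \<longrightarrow> j \<le> k * i + c0)}"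

lemma config_transfer:
  assumes "\<And>a. in_range p q a \<Longrightarrow> a \<in> A \<Longrightarrow> a \<in> A'"
    and s: "s \<in> config A" "h s \<in> fat \<rho> (span p q)"
  shows "s \<in> config A'"
proof -
  obtain a v where a: "a \<in> A" "v \<in> V" "s = v \<otimes> up (k * a)" "s \<in> B" "\<bar>h s - k * a\<bar> \<le> l"
    using s(1) by (rule configE)
  obtain j where j: "j \<in> span p q" "\<bar>h s - j\<bar> \<le> \<rho>" using s(2) unfolding fat_def by blast
  have "i \<le> a" if "p = Some i" for i
  proof -
    have "k * i - c0 \<le> j" using j(1) that unfolding span_def by blast
    then have "k * i - k < k * a" using j(2) a(5) k l \<kappa> by linarith
    then have "k * (i - 1) < k * a" by (simp add: right_diff_distrib)
    then have "i - 1 < a" using k_pos by (simp only: mult_less_cancel_left_pos)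
    then show ?thesis by simp
  qed
  moreover have "a \<le> i" if "q = Some i" for i
  proof -
    have "j \<le> k * i + c0" using j(1) that unfolding span_def by blast
    then have "k * a < k * i + k" using j(2) a(5) k l \<kappa> by linarith
    then have "k * a < k * (i + 1)" by (simp add: distrib_left)
    then have "a < i + 1" using k_pos by (simp only: mult_less_cancel_left_pos)
    then show ?thesis by simp
  qed
  ultimately have "a \<in> A'" using assms(1) a(1) unfolding in_range_def by blast
  then show ?thesis using a(2,3) configI by blast
qed

lemma pt_agree_window:
  assumes ag: "agree \<Delta> (region J) ((f ^^ m) (pt A)) ((f ^^ m) (pt A'))"
    and g: "c \<in> F" "b \<in> B" "fat c0 {h b} \<subseteq> J"
  shows "agree \<Delta> (window <#> {c \<otimes> b}) ((f ^^ m) (pt A)) ((f ^^ m) (pt A'))"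
  unfolding agree_def
proof
  fix a assume "a \<in> window <#> {c \<otimes> b}"
  then obtain w where w: "w \<in> window" "a = w \<otimes> (c \<otimes> b)" unfolding set_mult_def by blast
  have "w \<in> carrier G" "c \<in> carrier G" "b \<in> carrier G" using w window g F B_carrier by blast+
  then have aG: "a \<in> carrier G" using w by simp
  show "dist (act a ((f ^^ m) (pt A))) (act a ((f ^^ m) (pt A'))) \<le> \<Delta>"
  proof (cases "a \<in> region UNIV")
    case False
    then show ?thesis unfolding pt_def
      using off_region_agree[OF config_family config_family aG] by blast
  next
    case True
    have "c \<otimes> b \<in> region {h b}" using g by (auto intro: regionI)
    then have "a \<in> region (fat c0 {h b})" using c0(2) w True region_UNIV by blast
    then have "a \<in> region J" using region_mono[OF g(3)] by blast
    then show ?thesis using ag unfolding agree_def by blast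
  qed
qed

text \<open>Between two walls the future is determined by the initial state between them.\<close>

lemma pt_agree:
  assumes eq: "\<And>a. in_range p q a \<Longrightarrow> a \<in> A \<longleftrightarrow> a \<in> A'"
    and p: "\<And>i. p = Some i \<Longrightarrow> i \<in> A \<and> i \<in> A'" and q: "\<And>i. q = Some i \<Longrightarrow> i \<in> A \<and> i \<in> A'"
  shows "agree \<Delta> (region (span p q)) ((f ^^ m) (pt A)) ((f ^^ m) (pt A'))"
proof (induction m)
  case 0
  have "agree (\<Delta>/8) (region (span p q)) ((f ^^ 0) (pt A)) ((f ^^ 0) (pt A'))"
    unfolding pt_def
    by (rule \<rho>(2)[OF config_family config_family]) (use eq config_transfer in blast)+
  then show ?case using \<Delta>_pos by (auto intro: agree_mono)
next
  case (Suc m)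
  show ?case
  proof (cases "Suc m \<le> n")
    case True
    have "agree (\<Delta>/8) (region (span p q)) ((f ^^ Suc m) (pt A)) ((f ^^ Suc m) (pt A'))"
      unfolding pt_def
      by (rule \<rho>(2)[OF config_family config_family True]) (use eq config_transfer in blast)
    then show ?thesis using \<Delta>_pos by (auto intro: agree_mono)
  next
    case False
    then have nm: "n \<le> Suc m" by simp
    show ?thesis unfolding agree_def
    proof
      fix g assume g: "g \<in> region (span p q)"
      then obtain c b where cb: "c \<in> F" "b \<in> B" "h b \<in> span p q" "g = c \<otimes> b" by (rule regionE)
      have gG: "g \<in> carrier G" using g region_carrier by auto
      show "dist (act g ((f ^^ Suc m) (pt A))) (act g ((f ^^ Suc m) (pt A'))) \<le> \<Delta>"
      proof (cases "fat c0 {h b} \<subseteq> span p q")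
        case True
        have "agree \<Delta> (window <#> {g}) ((f ^^ m) (pt A)) ((f ^^ m) (pt A'))"
          using pt_agree_window[OF Suc.IH cb(1,2) True] cb(4) by simp
        then have "agree (\<Delta>/8) {g} (f ((f ^^ m) (pt A))) (f ((f ^^ m) (pt A')))"
          using agree_window(2)[OF fn_pt_in fn_pt_in, of "{g}"] gG by simp
        then show ?thesis using \<Delta>_pos unfolding agree_def by simp
      next
        case False
        then obtain i where i: "\<bar>i - h b\<bar> \<le> c0" "i \<notin> span p q" unfolding fat_def by auto
        have "\<exists>a. a \<in> A \<and> a \<in> A' \<and> h b \<in> {k * a - c0..k * a + c0}"
        proof (cases "\<exists>a. p = Some a \<and> i < k * a - c0")
          case True
          then obtain a where a: "p = Some a" "i < k * a - c0" by blast
          then have "k * a - c0 \<le> h b" using cb(3) unfolding span_def by blast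
          then have "h b \<in> {k * a - c0..k * a + c0}" using a(2) i(1) c0(1) by auto
          then show ?thesis using p[OF a(1)] by blast
        next
          case False
          then obtain a where a: "q = Some a" "k * a + c0 < i"
            using i(2) unfolding span_def by (auto simp: not_le)
          then have "h b \<le> k * a + c0" using cb(3) unfolding span_def by blast
          then have "h b \<in> {k * a - c0..k * a + c0}" using a(2) i(1) c0(1) by auto
          then show ?thesis using q[OF a(1)] by blast
        qed
        then obtain a where a: "a \<in> A" "a \<in> A'" "h b \<in> {k * a - c0..k * a + c0}" by blast
        then have "g \<in> region {k * a - c0..k * a + c0}" using cb by (auto intro: regionI)
        then have "dist (act g ((f ^^ Suc m) (pt A))) (act g z) \<le> \<Delta>/2"
          "dist (act g ((f ^^ Suc m) (pt A'))) (act g z) \<le> \<Delta>/2"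
          using wall_at[OF a(1) nm] wall_at[OF a(2) nm] unfolding agree_def by blast+
        then show ?thesis
          using dist_triangle2[of "act g ((f ^^ Suc m) (pt A))" "act g ((f ^^ Suc m) (pt A'))" "act g z"]
          by linarith
      qed
    qed
  qed
qed

lemma pt_agree_inside:
  assumes ag: "agree \<Delta> (region (span p q)) ((f ^^ m) (pt A)) ((f ^^ m) (pt A'))"
    and g: "c \<in> F" "b \<in> B" "fat c0 {h b} \<subseteq> span p q"
  shows "dist (act (c \<otimes> b) ((f ^^ m) (pt A))) (act (c \<otimes> b) ((f ^^ m) (pt A'))) \<le> \<Delta>/8"
proof -
  have "{c \<otimes> b} \<subseteq> carrier G" using g F B_carrier by auto
  from agree_window(1)[OF fn_pt_in fn_pt_in this pt_agree_window[OF ag g]]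
  show ?thesis unfolding agree_def by simp
qed

lemma dies_of_region:
  assumes "\<And>c b. c \<in> F \<Longrightarrow> b \<in> B \<Longrightarrow> dist (act (c \<otimes> b) ((f ^^ m) (pt A))) z \<le> \<Delta>"
  shows "(f ^^ m) (pt A) = z"
proof (rule dies_of_agree[OF pt_in])
  have "dist (act g ((f ^^ m) (pt A))) z \<le> \<Delta>" if g: "g \<in> carrier G" for g
  proof (cases "g \<in> region UNIV")
    case True
    then obtain c b where "c \<in> F" "b \<in> B" "g = c \<otimes> b" by (rule regionE)
    then show ?thesis using assms by blast
  next
    case False
    then have "dist (act g ((f ^^ m) (pt A))) z \<le> \<Delta>/2" unfolding pt_def by (rule off_region[OF config_family g])
    then show ?thesis using \<Delta>_pos by linarith
  qed
  then show "agree \<Delta> (carrier G) ((f ^^ m) (pt A)) z" unfolding agree_def using act_z by simp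
qed

text \<open>A periodic arrangement has only finitely many places up to its periods.\<close>

lemma periodic_dies:
  assumes p: "0 < p" and per: "\<And>a i. a \<in> A \<longleftrightarrow> a + p * i \<in> A"
  shows "\<exists>T. (f ^^ T) (pt A) = z"
proof -
  define M' where "M' = {m \<otimes> up (k * (p * i)) | m i. m \<in> M}"
  define c where "c = k * p"
  have cpos: "0 < c" unfolding c_def using k_pos p by simp
  have M'G: "M' \<subseteq> carrier G" unfolding M'_def using MG up by auto
  have spA: "spaced (config A)" using family_spaced(1)[OF config_family] .
  have shift: "config A #> up (k * (p * i)) = config A" for i
  proof -
    have sub: "config A #> up (k * (p * i)) \<subseteq> config A" for i
    proof
      fix s assume "s \<in> config A #> up (k * (p * i))"
      then obtain t where t: "t \<in> config A" "s = t \<otimes> up (k * (p * i))" unfolding r_coset_def by blast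
      obtain a v where a: "a \<in> A" "v \<in> V" "t = v \<otimes> up (k * a)" using t(1) by (rule configE)
      have "s = v \<otimes> up (k * (a + p * i))"
        using t(2) a(2,3) up V_height[of v] B_carrier by (simp add: m_assoc distrib_left)
      then show "s \<in> config A" using configI a(2) per[of a i] a(1) by auto
    qed
    have cG: "config A \<subseteq> carrier G" using config_family family_carrier by blast
    have "up (k * (p * (- i))) \<otimes> up (k * (p * i)) = \<one>"
      using up(3)[of "k * (p * (- i))" "k * (p * i)"] up(5) by simp
    then have "config A = (config A #> up (k * (p * (- i)))) #> up (k * (p * i))"
      using coset_mult_assoc[OF cG up(2) up(2)] coset_mult_one[OF cG] by metis
    also have "\<dots> \<subseteq> config A #> up (k * (p * i))" using sub[of "- i"] unfolding r_coset_def by blast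
    finally show ?thesis using sub by blast
  qed
  have fix_M': "act g (pt A) = pt A" if "g \<in> M'" for g
  proof -
    obtain m i where mi: "m \<in> M" "g = m \<otimes> up (k * (p * i))" using \<open>g \<in> M'\<close> unfolding M'_def by blast
    have "act (up (k * (p * i))) (pt A) = ptsum (config A #> up (k * (p * (- i))))"
      unfolding pt_def using ptsum_act[OF spA up(2)] up(4)[of "k * (p * i)"] by simp
    then have "act (up (k * (p * i))) (pt A) = pt A" using shift[of "- i"] unfolding pt_def by simp
    moreover have "act m (pt A) = pt A" unfolding pt_def by (rule ptsum_M[OF config_family mi(1)])
    ultimately show ?thesis using mi act_mult[OF _ up(2) pt_in] MG by auto
  qed
  have cover: "g \<in> (F <#> slab c) <#> M'" if g: "g \<in> region UNIV" for g
  proof -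
    obtain d b where db: "d \<in> F" "b \<in> B" "g = d \<otimes> b" using g by (rule regionE)
    define i where "i = h b div c"
    define b' where "b' = b \<otimes> up (- (c * i))"
    have G: "b \<in> carrier G" "d \<in> carrier G" using db F B_carrier by auto
    have b'B: "b' \<in> B" unfolding b'_def using db up B_closed by blast
    have "h b' = h b - c * i" unfolding b'_def using h_mult[OF db(2) up(1)] h_up by simp
    then have "h b' = h b mod c" unfolding i_def by (simp add: minus_mult_div_eq_mod)
    then have "\<bar>h b'\<bar> \<le> c" using cpos pos_mod_bound[of c "h b"] pos_mod_sign[of c "h b"] by linarith
    then have "b' \<in> slab c <#> M" using slab(3) b'B by blast
    then obtain t m where tm: "t \<in> slab c" "m \<in> M" "b' = t \<otimes> m" by (rule set_multE)
    have tmG: "t \<in> carrier G" "m \<in> carrier G" using tm slab(2) MG by auto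
    have "b = b' \<otimes> up (c * i)" unfolding b'_def using G up by (simp add: m_assoc)
    then have "g = (d \<otimes> t) \<otimes> (m \<otimes> up (k * (p * i)))"
      using db(3) tm(3) G tmG up by (simp add: m_assoc c_def mult.assoc)
    moreover have "m \<otimes> up (k * (p * i)) \<in> M'" unfolding M'_def using tm(2) by blast
    ultimately show ?thesis using db(1) tm(1) by (auto intro!: set_multI)
  qed
  show ?thesis
  proof (rule dies_of_bounded[OF pt_in F_slab M'G fix_M', of 0])
    fix m g assume g: "g \<in> carrier G" "g \<notin> (F <#> slab c) <#> M'"
    then have "g \<notin> region UNIV" using cover by blast
    then have "dist (act g ((f ^^ m) (pt A))) z \<le> \<Delta>/2" unfolding pt_def by (rule off_region[OF config_family g(1)])
    then show "dist (act g ((f ^^ m) (pt A))) z \<le> \<Delta>" using \<Delta>_pos by linarith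
  qed
qed

definition hole :: "int \<Rightarrow> int \<Rightarrow> int set" where
  "hole p q = {a. a \<le> p \<or> q \<le> a}"

text \<open>The arrangement with a single gap dies: seen from outside the gap it is the full arrangement, and
  seen from the gap it is the periodic arrangement with only such gaps.\<close>

lemma hole_dies:
  assumes pq: "p < q"
  shows "\<exists>T. (f ^^ T) (pt (hole p q)) = z"
proof -
  obtain T1 where T1: "(f ^^ T1) (pt UNIV) = z" using periodic_dies[of 1 UNIV] by auto
  define P where "P = {a. (q - p) dvd (a - p)}"
  have per: "a \<in> P \<longleftrightarrow> a + (q - p) * i \<in> P" for a i
  proof -
    have "a + (q - p) * i - p = (a - p) + (q - p) * i" by simp
    then show ?thesis unfolding P_def by (simp only: mem_Collect_eq dvd_add_times_triv_right_iff mult.commute)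
  qed
  obtain T2 where T2: "(f ^^ T2) (pt P) = z" using periodic_dies[of "q - p" P] per pq by auto
  define T where "T = max T1 T2"
  have T: "(f ^^ T) (pt UNIV) = z" "(f ^^ T) (pt P) = z"
    using fn_zero_mono[OF T1] fn_zero_mono[OF T2] unfolding T_def by auto
  have 1: "agree \<Delta> (region (span None (Some p))) ((f ^^ T) (pt (hole p q))) ((f ^^ T) (pt UNIV))"
    by (rule pt_agree) (auto simp: in_range_def hole_def)
  have 2: "agree \<Delta> (region (span (Some q) None)) ((f ^^ T) (pt (hole p q))) ((f ^^ T) (pt UNIV))"
    by (rule pt_agree) (auto simp: in_range_def hole_def)
  have Pin: "a \<in> P \<longleftrightarrow> a = p \<or> a = q" if "p \<le> a" "a \<le> q" for a
  proof
    assume "a \<in> P"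
    then have dvd: "(q - p) dvd (a - p)" unfolding P_def by simp
    show "a = p \<or> a = q"
    proof (rule ccontr)
      assume "\<not> (a = p \<or> a = q)"
      then have "0 < a - p" "a - p < q - p" using that by auto
      then show False using zdvd_not_zless dvd by blast
    qed
  qed (auto simp: P_def)
  have 3: "agree \<Delta> (region (span (Some p) (Some q))) ((f ^^ T) (pt (hole p q))) ((f ^^ T) (pt P))"
  proof (rule pt_agree)
    fix a assume "in_range (Some p) (Some q) a"
    then have "p \<le> a" "a \<le> q" unfolding in_range_def by auto
    then show "a \<in> hole p q \<longleftrightarrow> a \<in> P" using Pin unfolding hole_def by auto
  qed (use Pin pq in \<open>auto simp: hole_def\<close>)
  have "(f ^^ T) (pt (hole p q)) = z"
  proof (rule dies_of_region)
    fix c b assume cb: "c \<in> F" "b \<in> B"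
    have "h b \<in> span None (Some p) \<or> h b \<in> span (Some p) (Some q) \<or> h b \<in> span (Some q) None"
      unfolding span_def using c0 by auto
    then have "c \<otimes> b \<in> region (span None (Some p)) \<or> c \<otimes> b \<in> region (span (Some p) (Some q)) \<or>
        c \<otimes> b \<in> region (span (Some q) None)"
      using cb by (auto intro: regionI)
    moreover have "act (c \<otimes> b) z = z" using cb F B_carrier act_z by auto
    ultimately show "dist (act (c \<otimes> b) ((f ^^ T) (pt (hole p q)))) z \<le> \<Delta>"
      using 1 2 3 T unfolding agree_def by auto
  qed
  then show ?thesis by blast
qed

end

context cyclic_walls begin

lemma config_mono: "A \<subseteq> A' \<Longrightarrow> config A \<subseteq> config A'"
  unfolding config_def by blast

lemma scaled_ge: "0 \<le> a \<Longrightarrow> a \<le> k * a"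
proof -
  assume "0 \<le> a"
  then have "1 * a \<le> k * a" using k_pos by (intro mult_right_mono) auto
  then show ?thesis by simp
qed

text \<open>If two neighbouring walls do not die, then they emit something to one side; there they look like a
  half-line of walls, and for as long as desired like the arrangement with a very long hole.\<close>

lemma holes_wander:
  assumes alive: "\<And>T. (f ^^ T) (pt {0, 1}) \<noteq> z"
  shows "\<exists>m\<ge>m0. \<exists>c\<in>F. \<exists>b\<in>B. \<exists>p q. p < q \<and> \<Delta>/2 < dist (act (c \<otimes> b) ((f ^^ m) (pt (hole p q)))) z \<and>
    \<beta> < \<bar>k * p - h b\<bar> \<and> \<beta> < \<bar>k * q - h b\<bar>"
proof -
  define \<beta>' where "\<beta>' = \<bar>\<beta>\<bar> + k + c0 + 1"
  define A where "A = F <#> slab \<beta>'"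
  have A: "finite A" "A \<subseteq> carrier G" unfolding A_def by (fact F_slab)+
  have per: "act m (pt {0, 1}) = pt {0, 1}" if "m \<in> M" for m
    unfolding pt_def by (rule ptsum_M[OF config_family that])
  have "\<exists>m g. m0 \<le> m \<and> g \<in> carrier G \<and> g \<notin> A <#> M \<and> \<Delta> < dist (act g ((f ^^ m) (pt {0, 1}))) z"
  proof (rule ccontr)
    assume "\<not> ?thesis"
    then have "\<exists>T. (f ^^ T) (pt {0, 1}) = z"
      by (intro dies_of_bounded[OF pt_in A MG(1) per, of m0]) (auto simp: not_less)
    then show False using alive by blast
  qed
  then obtain m g where m: "m0 \<le> m" and g: "g \<in> carrier G" "g \<notin> A <#> M"
    and big: "\<Delta> < dist (act g ((f ^^ m) (pt {0, 1}))) z" by blast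
  have "g \<in> region UNIV"
  proof (rule ccontr)
    assume "g \<notin> region UNIV"
    then have "dist (act g ((f ^^ m) (pt {0, 1}))) z \<le> \<Delta>/2"
      unfolding pt_def by (rule off_region[OF config_family g(1)])
    then show False using big \<Delta>_pos by linarith
  qed
  then obtain c b where cb: "c \<in> F" "b \<in> B" "g = c \<otimes> b" by (rule regionE)
  have hb: "\<beta>' < \<bar>h b\<bar>"
  proof (rule ccontr)
    assume "\<not> \<beta>' < \<bar>h b\<bar>"
    then have "h b \<in> {-\<beta>'..\<beta>'}" by auto
    then have "g \<in> region {-\<beta>'..\<beta>'}" using cb by (auto intro: regionI)
    then show False using g(2) region_slab[of "{-\<beta>'..\<beta>'}" \<beta>'] unfolding A_def by blast
  qed
  have tri: "\<Delta>/2 < dist (act (c \<otimes> b) y'') z"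
    if "dist (act (c \<otimes> b) ((f ^^ m) (pt {0, 1}))) (act (c \<otimes> b) y') \<le> \<Delta>/8"
      "dist (act (c \<otimes> b) y') (act (c \<otimes> b) y'') \<le> \<Delta>/8" for y' y''
    using that big cb(3) \<Delta>_pos dist_triangle[of "act g ((f ^^ m) (pt {0, 1}))" z "act g y'"]
      dist_triangle[of "act g y'" z "act g y''"] by simp
  from agree_of_heights[of m] obtain r where r: "0 \<le> r"
    "\<forall>J. \<forall>S\<in>family B M. \<forall>S'\<in>family B M. (\<forall>s\<in>B. h s \<in> fat r J \<longrightarrow> (s \<in> S \<longleftrightarrow> s \<in> S')) \<longrightarrow>
      agree (\<Delta>/8) (region J) ((f ^^ m) (ptsum S)) ((f ^^ m) (ptsum S'))" by (elim exE conjE)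
  have in_reg: "c \<otimes> b \<in> region {h b}" using cb by (auto intro: regionI)
  \<comment> \<open>The hole extends to \<open>N\<close> or to \<open>- N\<close>: its far end cannot be noticed at height \<open>h b\<close> by time \<open>m\<close>.\<close>
  define N where "N = \<bar>h b\<bar> + r + l + \<bar>\<beta>\<bar> + 2"
  have N: "N \<le> k * N" "2 \<le> N" using scaled_ge[of N] r(1) l(1) unfolding N_def by auto
  have local: "dist (act (c \<otimes> b) ((f ^^ m) (pt A1))) (act (c \<otimes> b) ((f ^^ m) (pt A2))) \<le> \<Delta>/8"
    if sub: "A1 \<subseteq> A2" and far: "\<And>a. a \<in> A2 - A1 \<Longrightarrow> r + l < \<bar>k * a - h b\<bar>" for A1 A2
  proof -
    have "s \<in> config A1" if s: "s \<in> config A2" "h s \<in> fat r {h b}" for s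
    proof -
      obtain a v where a: "a \<in> A2" "v \<in> V" "s = v \<otimes> up (k * a)" "\<bar>h s - k * a\<bar> \<le> l"
        using s(1) by (rule configE)
      have "\<bar>h s - h b\<bar> \<le> r" using s(2) unfolding fat_def by simp
      then have "a \<in> A1" using far[of a] a(1,4) by force
      then show ?thesis using a configI by blast
    qed
    then have "agree (\<Delta>/8) (region {h b}) ((f ^^ m) (pt A1)) ((f ^^ m) (pt A2))"
      unfolding pt_def
      using config_mono[OF sub] by (intro r(2)[rule_format, OF config_family config_family] iffI) auto
    then show ?thesis using in_reg unfolding agree_def by blast
  qed
  show ?thesis
  proof (cases "0 < h b")
    case True
    then have hb': "\<beta>' < h b" using hb by simp
    have "agree \<Delta> (region (span (Some 1) None)) ((f ^^ m) (pt {0, 1})) ((f ^^ m) (pt {..1}))"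
      by (rule pt_agree) (auto simp: in_range_def)
    moreover have "fat c0 {h b} \<subseteq> span (Some 1) None"
      using hb' unfolding fat_def span_def \<beta>'_def by auto
    ultimately have 1: "dist (act (c \<otimes> b) ((f ^^ m) (pt {0, 1}))) (act (c \<otimes> b) ((f ^^ m) (pt {..1}))) \<le> \<Delta>/8"
      using pt_agree_inside cb by blast
    have "dist (act (c \<otimes> b) ((f ^^ m) (pt {..1}))) (act (c \<otimes> b) ((f ^^ m) (pt (hole 1 N)))) \<le> \<Delta>/8"
    proof (rule local)
      show "{..1} \<subseteq> hole 1 N" unfolding hole_def by auto
      fix a assume "a \<in> hole 1 N - {..1}"
      then have "N \<le> a" unfolding hole_def by auto
      then have "k * N \<le> k * a" using k_pos by (intro mult_left_mono) auto
      then have "N \<le> k * a" using N(1) by linarith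
      then show "r + l < \<bar>k * a - h b\<bar>" using True unfolding N_def by linarith
    qed
    then have "\<Delta>/2 < dist (act (c \<otimes> b) ((f ^^ m) (pt (hole 1 N)))) z" using tri[OF 1] by blast
    moreover have "\<beta> < \<bar>k * 1 - h b\<bar>" using hb' c0(1) unfolding \<beta>'_def by auto
    moreover have "\<beta> < \<bar>k * N - h b\<bar>" using N(1) True r(1) l(1) unfolding N_def by auto
    moreover have "1 < N" using N(2) by simp
    ultimately show ?thesis using m cb by blast
  next
    case False
    then have hb': "h b < - \<beta>'" using hb by simp
    have "agree \<Delta> (region (span None (Some 0))) ((f ^^ m) (pt {0, 1})) ((f ^^ m) (pt {0..}))"
      by (rule pt_agree) (auto simp: in_range_def)
    moreover have "fat c0 {h b} \<subseteq> span None (Some 0)"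
      using hb' k_pos unfolding fat_def span_def \<beta>'_def by auto
    ultimately have 1: "dist (act (c \<otimes> b) ((f ^^ m) (pt {0, 1}))) (act (c \<otimes> b) ((f ^^ m) (pt {0..}))) \<le> \<Delta>/8"
      using pt_agree_inside cb by blast
    have "dist (act (c \<otimes> b) ((f ^^ m) (pt {0..}))) (act (c \<otimes> b) ((f ^^ m) (pt (hole (- N) 0)))) \<le> \<Delta>/8"
    proof (rule local)
      show "{0..} \<subseteq> hole (- N) 0" unfolding hole_def by auto
      fix a assume "a \<in> hole (- N) 0 - {0..}"
      then have "a \<le> - N" unfolding hole_def by auto
      then have "k * a \<le> k * (- N)" using k_pos by (intro mult_left_mono) auto
      then have "k * a \<le> - N" using N(1) by simp
      then show "r + l < \<bar>k * a - h b\<bar>" using False unfolding N_def by auto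
    qed
    then have "\<Delta>/2 < dist (act (c \<otimes> b) ((f ^^ m) (pt (hole (- N) 0)))) z" using tri[OF 1] by blast
    moreover have "\<beta> < \<bar>k * 0 - h b\<bar>" using hb' c0(1) k_pos unfolding \<beta>'_def by auto
    moreover have "k * (- N) \<le> - N" using N(1) by simp
    then have "\<beta> < \<bar>k * (- N) - h b\<bar>" using False r(1) l(1) unfolding N_def by linarith
    moreover have "- N < 0" using N(2) by simp
    ultimately show ?thesis using m cb by blast
  qed
qed

text \<open>Once the full arrangement is dead, an arrangement with a hole lives only at the ends of the hole.\<close>

lemma spt_hole:
  assumes T: "(f ^^ T) (pt UNIV) = z" and \<delta>': "0 < \<delta>'"
  shows "\<exists>W r. finite W \<and> W \<subseteq> carrier G \<and> (\<forall>p q. p < q \<longrightarrow>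
    spt \<delta>' ((f ^^ T) (pt (hole p q))) \<subseteq> (\<lambda>g. inv g) ` W <#> region {j. \<bar>j - k * p\<bar> \<le> r \<or> \<bar>j - k * q\<bar> \<le> r})"
proof -
  obtain W where W: "finite W" "W \<subseteq> carrier G"
    "\<forall>x\<in>Y. \<forall>y\<in>Y. (\<forall>g\<in>W. dist (act g x) (act g y) \<le> \<Delta>) \<longrightarrow> dist x y < \<delta>'"
    using finite_window[OF \<delta>'] by blast
  from agree_of_heights[of T] obtain r where r: "0 \<le> r"
    "\<forall>J. \<forall>S\<in>family B M. \<forall>S'\<in>family B M. (\<forall>s\<in>B. h s \<in> fat r J \<longrightarrow> (s \<in> S \<longleftrightarrow> s \<in> S')) \<longrightarrow>
      agree (\<Delta>/8) (region J) ((f ^^ T) (ptsum S)) ((f ^^ T) (ptsum S'))" by (elim exE conjE)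
  have "spt \<delta>' ((f ^^ T) (pt (hole p q))) \<subseteq>
      (\<lambda>g. inv g) ` W <#> region {j. \<bar>j - k * p\<bar> \<le> r + l \<or> \<bar>j - k * q\<bar> \<le> r + l}" if pq: "p < q" for p q
  proof
    fix g assume "g \<in> spt \<delta>' ((f ^^ T) (pt (hole p q)))"
    then have g: "g \<in> carrier G" "\<delta>' \<le> dist (act g ((f ^^ T) (pt (hole p q)))) z"
      unfolding spt_def by auto
    define y where "y = (f ^^ T) (pt (hole p q))"
    have yY: "y \<in> Y" unfolding y_def by (rule fn_pt_in)
    have "\<exists>w\<in>W. \<Delta> < dist (act w (act g y)) (act w z)"
    proof (rule ccontr)
      assume "\<not> ?thesis"
      then have "\<forall>w\<in>W. dist (act w (act g y)) (act w z) \<le> \<Delta>" by (auto simp: not_less)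
      then have "dist (act g y) z < \<delta>'" using W(3) act_in[OF g(1) yY] z_in by blast
      then show False using g(2) y_def by simp
    qed
    then obtain w where w: "w \<in> W" "\<Delta> < dist (act w (act g y)) (act w z)" by blast
    have wG: "w \<in> carrier G" using w W by auto
    have big: "\<Delta> < dist (act (w \<otimes> g) y) z" using w act_mult[OF wG g(1) yY] act_z[OF wG] by simp
    have wgG: "w \<otimes> g \<in> carrier G" using wG g by simp
    have "w \<otimes> g \<in> region UNIV"
    proof (rule ccontr)
      assume "w \<otimes> g \<notin> region UNIV"
      then have "dist (act (w \<otimes> g) y) z \<le> \<Delta>/2"
        unfolding y_def pt_def by (rule off_region[OF config_family wgG])
      then show False using big \<Delta>_pos by linarith
    qed
    then obtain c b where cb: "c \<in> F" "b \<in> B" "w \<otimes> g = c \<otimes> b" by (rule regionE)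
    have reg: "w \<otimes> g \<in> region {h b}" using cb by (auto intro: regionI)
    have "\<bar>h b - k * p\<bar> \<le> r + l \<or> \<bar>h b - k * q\<bar> \<le> r + l"
    proof (rule ccontr)
      assume "\<not> ?thesis"
      then have far: "r + l < \<bar>h b - k * p\<bar>" "r + l < \<bar>h b - k * q\<bar>" by auto
      have kpq: "k * p < k * q" using pq k_pos by simp
      have "\<exists>A. (f ^^ T) (pt A) = z \<and> (\<forall>s\<in>B. h s \<in> fat r {h b} \<longrightarrow> (s \<in> config (hole p q) \<longleftrightarrow> s \<in> config A))"
      proof (cases "k * p < h b \<and> h b < k * q")
        case True
        have "s \<notin> config (hole p q)" if "h s \<in> fat r {h b}" for s
        proof
          assume "s \<in> config (hole p q)"
          then obtain a v where a: "a \<in> hole p q" "\<bar>h s - k * a\<bar> \<le> l" by (rule configE)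
          have "\<bar>h s - h b\<bar> \<le> r" using that unfolding fat_def by simp
          moreover have "k * a \<le> k * p \<or> k * q \<le> k * a" using a(1) k_pos unfolding hole_def by auto
          ultimately show False using a(2) far True by linarith
        qed
        moreover have "config {} = {}" unfolding config_def by simp
        ultimately show ?thesis using pt_empty fn_z by (intro exI[of _ "{}"]) auto
      next
        case False
        have "s \<in> config (hole p q)" if s: "h s \<in> fat r {h b}" "s \<in> config UNIV" for s
        proof -
          obtain a v where a: "v \<in> V" "s = v \<otimes> up (k * a)" "\<bar>h s - k * a\<bar> \<le> l"
            using s(2) by (rule configE)
          have "\<bar>h s - h b\<bar> \<le> r" using s(1) unfolding fat_def by simp
          then have "\<not> (k * p \<le> k * a \<and> k * a \<le> k * q)" using a(3) far False by linarith
          then have "a \<in> hole p q" using k_pos unfolding hole_def by auto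
          then show ?thesis using a configI by blast
        qed
        then show ?thesis using T config_mono[of "hole p q" UNIV] by (intro exI[of _ UNIV]) auto
      qed
      then obtain A where A: "(f ^^ T) (pt A) = z"
        "\<forall>s\<in>B. h s \<in> fat r {h b} \<longrightarrow> (s \<in> config (hole p q) \<longleftrightarrow> s \<in> config A)" by blast
      have "agree (\<Delta>/8) (region {h b}) y ((f ^^ T) (pt A))"
        unfolding y_def pt_def by (rule r(2)[rule_format, OF config_family config_family]) (use A(2) in blast)
      then have "dist (act (w \<otimes> g) y) z \<le> \<Delta>/8" using reg A(1) act_z[OF wgG] unfolding agree_def by auto
      then show False using big \<Delta>_pos by linarith
    qed
    then have "w \<otimes> g \<in> region {j. \<bar>j - k * p\<bar> \<le> r + l \<or> \<bar>j - k * q\<bar> \<le> r + l}"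
      using cb by (auto intro: regionI)
    from set_multI[OF imageI[OF w(1)] this]
    have "inv w \<otimes> (w \<otimes> g) \<in> (\<lambda>g. inv g) ` W <#> region {j. \<bar>j - k * p\<bar> \<le> r + l \<or> \<bar>j - k * q\<bar> \<le> r + l}" .
    moreover have "inv w \<otimes> (w \<otimes> g) = g" using wG g by (simp add: m_assoc[symmetric])
    ultimately show "g \<in> (\<lambda>g. inv g) ` W <#> region {j. \<bar>j - k * p\<bar> \<le> r + l \<or> \<bar>j - k * q\<bar> \<le> r + l}"
      by (simp only:)
  qed
  then show ?thesis using W(1,2) by blast
qed

text \<open>The pair of walls therefore dies: otherwise the arrangements with a hole, which all die, would
  wander.\<close>

lemma pair_dies: "\<exists>T. (f ^^ T) (pt {0, 1}) = z"
proof (rule ccontr)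
  assume "\<not> ?thesis"
  then have alive: "\<And>T. (f ^^ T) (pt {0, 1}) \<noteq> z" by blast
  obtain T where T: "(f ^^ T) (pt UNIV) = z" using periodic_dies[of 1 UNIV] by auto
  show False
  proof (rule no_wandering[OF glues_C C_Y MG F])
    fix D1 :: "'g set" and \<tau> :: nat and \<delta>' :: real
    assume D1: "finite D1" "D1 \<subseteq> carrier G" and \<delta>': "0 < \<delta>'"
    obtain W r where W: "finite W" "W \<subseteq> carrier G"
      and spt: "\<And>p q. p < q \<Longrightarrow> spt \<delta>' ((f ^^ T) (pt (hole p q))) \<subseteq>
        (\<lambda>g. inv g) ` W <#> region {j. \<bar>j - k * p\<bar> \<le> r \<or> \<bar>j - k * q\<bar> \<le> r}"
      using spt_hole[OF T \<delta>'] by blast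
    have iW: "finite ((\<lambda>g. inv g) ` W)" "(\<lambda>g. inv g) ` W \<subseteq> carrier G" using W by auto
    have "finite ((\<lambda>g. inv g) ` F <#> (W <#> D1))"
      using finite_set_mult[OF finite_imageI[OF F(1)] finite_set_mult[OF W(1) D1(1)]] .
    from height_bound[OF this] obtain r' where r': "0 \<le> r'"
      "\<And>b. b \<in> (\<lambda>g. inv g) ` F <#> (W <#> D1) \<Longrightarrow> b \<in> B \<Longrightarrow> \<bar>h b\<bar> \<le> r'" by blast
    obtain m c b p q where m: "\<tau> + T \<le> m" and cb: "c \<in> F" "b \<in> B" and pq: "p < q"
      and big: "\<Delta>/2 < dist (act (c \<otimes> b) ((f ^^ m) (pt (hole p q)))) z"
      and far: "r + r' < \<bar>k * p - h b\<bar>" "r + r' < \<bar>k * q - h b\<bar>"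
      using holes_wander[OF alive, of "\<tau> + T" "r + r'"] by blast
    define J where "J = {j. \<bar>j - k * p\<bar> \<le> r \<or> \<bar>j - k * q\<bar> \<le> r}"
    define J' where "J' = (\<lambda>j. j + h (inv b)) ` J"
    define y where "y = (f ^^ T) (pt (hole p q))"
    define e where "e = \<bar>k * p\<bar> + \<bar>k * q\<bar> + \<bar>r\<bar> + \<bar>h b\<bar>"
    have bG: "b \<in> carrier G" "c \<in> carrier G" using cb B_carrier F by auto
    have yY: "y \<in> Y" unfolding y_def by (rule fn_pt_in)
    have sp: "spaced (config (hole p q))" by (rule family_spaced(1)[OF config_family])
    have hinv: "h (inv b) = - h b" using h_inv cb by blast
    have J': "J' \<subseteq> {-e..e}"
    proof
      fix i assume "i \<in> J'"
      then have "i + h b \<in> J" unfolding J'_def using hinv by auto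
      then show "i \<in> {-e..e}" unfolding J_def e_def by auto
    qed
    have "spt \<delta>' (act b y) = spt \<delta>' y #> inv b" by (rule spt_act[OF bG(1) yY])
    also have "\<dots> \<subseteq> ((\<lambda>g. inv g) ` W <#> region J) #> inv b"
      using spt[OF pq] unfolding y_def J_def r_coset_def by blast
    also have "\<dots> = (\<lambda>g. inv g) ` W <#> (region J #> inv b)"
      using setmult_rcos_assoc[OF iW(2) region_carrier, of "inv b"] bG by simp
    also have "\<dots> = (\<lambda>g. inv g) ` W <#> region J'"
      unfolding J'_def using region_shift[of "inv b" J] cb B_closed by simp
    finally have sub: "spt \<delta>' (act b y) \<subseteq> (\<lambda>g. inv g) ` W <#> region J'" .
    define D' where "D' = (\<lambda>g. inv g) ` W <#> (F <#> slab e)"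
    have D': "finite D'" "D' \<subseteq> carrier G" unfolding D'_def
      using finite_set_mult[OF iW(1) F_slab(1)] set_mult_closed[OF iW(2) F_slab(2)] by auto
    have "(\<lambda>g. inv g) ` W <#> region J' \<subseteq> (\<lambda>g. inv g) ` W <#> ((F <#> slab e) <#> M)"
      by (rule mono_set_mult[OF subset_refl region_slab[OF J']])
    also have "\<dots> = D' <#> M" unfolding D'_def using set_mult_assoc[OF iW(2) F_slab(2) MG(1)] by simp
    finally have 1: "spt \<delta>' (act b y) \<subseteq> D' <#> M" using sub by blast
    have 2: "spt \<delta>' (act b y) \<inter> (D1 <#> M) = {}"
    proof (rule ccontr)
      assume "spt \<delta>' (act b y) \<inter> (D1 <#> M) \<noteq> {}"
      then obtain g where g: "g \<in> (\<lambda>g. inv g) ` W <#> region J'" "g \<in> D1 <#> M" using sub by blast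
      obtain w g' where w: "w \<in> W" "g' \<in> region J'" "g = inv w \<otimes> g'" using g(1) by (auto elim!: set_multE)
      obtain c' b' where c': "c' \<in> F" "b' \<in> B" "h b' \<in> J'" "g' = c' \<otimes> b'" using w(2) by (rule regionE)
      obtain d k' where d: "d \<in> D1" "k' \<in> M" "g = d \<otimes> k'" using g(2) by (rule set_multE)
      have G: "w \<in> carrier G" "c' \<in> carrier G" "b' \<in> carrier G" "d \<in> carrier G" "k' \<in> carrier G"
        using w c' d W F B_carrier D1 MG by auto
      have "c' \<otimes> b' = w \<otimes> (inv w \<otimes> (c' \<otimes> b'))" using G by (simp add: m_assoc[symmetric])
      also have "\<dots> = w \<otimes> (d \<otimes> k')" using w(3) c'(4) d(3) by simp
      finally have "b' = inv c' \<otimes> (w \<otimes> (d \<otimes> k'))" using G by (simp add: inv_solve_left m_assoc)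
      then have eq: "b' \<otimes> inv k' = inv c' \<otimes> (w \<otimes> d)" using G by (simp add: m_assoc)
      have k'B: "k' \<in> B" using d(2) M by auto
      have "inv c' \<otimes> (w \<otimes> d) \<in> (\<lambda>g. inv g) ` F <#> (W <#> D1)"
        using c'(1) w(1) d(1) by (intro set_multI) auto
      then have "\<bar>h (b' \<otimes> inv k')\<bar> \<le> r'" using r'(2) eq c'(2) k'B B_closed by metis
      then have "\<bar>h b'\<bar> \<le> r'" using h_mult h_inv c'(2) k'B B_closed h_M[OF d(2)] by simp
      moreover have "h b' + h b \<in> J" using c'(3) hinv unfolding J'_def by auto
      ultimately show False using far unfolding J_def by auto
    qed
    have 3: "act b y \<in> C"
    proof -
      have "act b y = (f ^^ T) (act b (pt (hole p q)))" unfolding y_def using fn_act[OF bG(1) pt_in] by simp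
      also have "\<dots> = (f ^^ T) (ptsum (config (hole p q) #> inv b))"
        unfolding pt_def using ptsum_act[OF sp bG(1)] by simp
      finally show ?thesis using glued_ptsum(2)[OF spaced_shift[OF sp]] bG by simp
    qed
    have fy: "(f ^^ i) (act b y) = act b ((f ^^ (i + T)) (pt (hole p q)))" for i
      using fn_act[OF bG(1) yY] unfolding y_def by (simp add: funpow_add)
    obtain T' where T': "(f ^^ T') (pt (hole p q)) = z" using hole_dies[OF pq] by blast
    have 4: "(f ^^ T') (act b y) = z" unfolding fy using fn_zero_mono[OF T'] act_z[OF bG(1)] by simp
    have 5: "\<not> agree (\<Delta>/2) F ((f ^^ (m - T)) (act b y)) z"
    proof
      assume "agree (\<Delta>/2) F ((f ^^ (m - T)) (act b y)) z"
      then have "dist (act c ((f ^^ (m - T)) (act b y))) (act c z) \<le> \<Delta>/2" using cb(1) unfolding agree_def by blast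
      moreover have "(f ^^ (m - T)) (act b y) = act b ((f ^^ m) (pt (hole p q)))" unfolding fy using m by simp
      ultimately have "dist (act (c \<otimes> b) ((f ^^ m) (pt (hole p q)))) z \<le> \<Delta>/2"
        using act_mult[OF bG(2,1) fn_pt_in] act_z[OF bG(2)] by simp
      then show False using big by simp
    qed
    show "\<exists>r\<in>C. \<exists>m\<ge>\<tau>. \<exists>T D'. (f ^^ T) r = z \<and> finite D' \<and> D' \<subseteq> carrier G \<and> spt \<delta>' r \<subseteq> D' <#> M \<and>
        spt \<delta>' r \<inter> (D1 <#> M) = {} \<and> \<not> agree (\<Delta>/2) F ((f ^^ m) r) z"
      using 1 2 3 4 5 D' m by (intro bexI[of _ "act b y"] exI[of _ "m - T"] conjI exI[of _ T'] exI[of _ D']) auto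
  qed
qed

text \<open>The pair is a wall that dies, so \<open>z\<close> is stable for sums with periods \<open>M\<close>. A sum over a set of bounded
  height therefore keeps a support of bounded height, which is finite modulo \<open>M\<close>.\<close>

lemma bounded_sum_dies:
  assumes S: "S \<in> family B M" and e: "\<And>s. s \<in> S \<Longrightarrow> \<bar>h s\<bar> \<le> e"
  shows "\<exists>T. (f ^^ T) (ptsum S) = z"
proof -
  obtain T where T: "(f ^^ T) (ptsum (config {0, 1})) = z" using pair_dies unfolding pt_def by blast
  have U: "config {0, 1} \<subseteq> slab (k + l) <#> M"
  proof
    fix s assume "s \<in> config {0, 1}"
    then obtain a v where a: "a \<in> {0, 1}" "s \<in> B" "\<bar>h s - k * a\<bar> \<le> l" by (rule configE)
    then have "\<bar>h s\<bar> \<le> k + l" using k_pos by auto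
    then show "s \<in> slab (k + l) <#> M" using slab(3) a(2) by blast
  qed
  have V0: "config {0, 1} \<inter> (D <#> M) = V"
  proof -
    have mem: "s \<in> config {0, 1} \<longleftrightarrow> s \<in> V" if "s \<in> B" "\<bar>h s\<bar> \<le> l" for s
      using config_mem[of s 0 "{0, 1}"] that up B_carrier by simp
    show ?thesis
    proof (intro equalityI subsetI)
      fix s assume s: "s \<in> config {0, 1} \<inter> (D <#> M)"
      then have "s \<in> B" using family_spaced(2)[OF config_family] by blast
      then show "s \<in> V" using mem l(2) s by blast
    next
      fix s assume "s \<in> V"
      then show "s \<in> config {0, 1} \<inter> (D <#> M)" using mem V_height V(2) by blast
    qed
  qed
  have Freg: "F \<subseteq> region {-c0..c0}"
  proof
    fix c assume c: "c \<in> F"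
    then have "c \<otimes> \<one> \<in> region {-c0..c0}" using B_closed h_one c0(1) by (intro regionI) auto
    then show "c \<in> region {-c0..c0}" using c F by (simp add: subset_iff)
  qed
  have wall: "agree (\<Delta>/2) F ((f ^^ m) (ptsum S')) z"
    if "S' \<in> family B M" "S' \<inter> (D <#> M) = config {0, 1} \<inter> (D <#> M)" "n \<le> m" for S' m
    using agree_mono[OF wall0[OF that(1) _ that(3)] Freg] that(2) V0 by simp
  have "\<exists>D'. finite D' \<and> D' \<subseteq> carrier G \<and> (\<forall>S\<in>family B M. S \<inter> (D' <#> M) = {} \<longrightarrow>
      (\<forall>m. agree (\<Delta>/2) F ((f ^^ m) (ptsum S)) z))"
    by (rule stable_of_dying_wall[OF MG BG config_family U slab(1,2) T D subset_refl F]) (rule wall)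
  then obtain D' where D'0: "finite D'" "D' \<subseteq> carrier G" "\<forall>S\<in>family B M. S \<inter> (D' <#> M) = {} \<longrightarrow>
      (\<forall>m. agree (\<Delta>/2) F ((f ^^ m) (ptsum S)) z)" by (elim exE conjE)
  have D': "finite D'" "D' \<subseteq> carrier G" "\<And>S m. S \<in> family B M \<Longrightarrow> S \<inter> (D' <#> M) = {} \<Longrightarrow>
      agree (\<Delta>/2) F ((f ^^ m) (ptsum S)) z"
    using D'0(1,2) by simp_all (rule D'0(3)[rule_format])
  obtain r where r: "0 \<le> r" "\<And>b. b \<in> D' \<inter> B \<Longrightarrow> \<bar>h b\<bar> \<le> r" using height_bound[OF D'(1)] by blast
  define A where "A = F <#> slab (r + e)"
  have A: "finite A" "A \<subseteq> carrier G" unfolding A_def by (fact F_slab)+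
  have Sin: "ptsum S \<in> Y" using ptsum_in family_spaced(1)[OF S] by blast
  show ?thesis
  proof (rule dies_of_bounded[OF Sin A MG(1) ptsum_M[OF S], of 0])
    fix m g assume g: "g \<in> carrier G" "g \<notin> A <#> M"
    show "dist (act g ((f ^^ m) (ptsum S))) z \<le> \<Delta>"
    proof (rule ccontr)
      assume "\<not> ?thesis"
      then have "\<Delta>/2 < dist (act g ((f ^^ m) (ptsum S))) z" using \<Delta>_pos by linarith
      from support_of_stable[OF B M(2) conf M_norm MG(1) D'(2,3) S g(1) this]
      obtain c j d s where *: "c \<in> F" "j \<in> M" "d \<in> D' \<inter> B" "s \<in> S" "g = c \<otimes> (inv j \<otimes> (inv d \<otimes> s))" by blast
      have in_B: "j \<in> B" "d \<in> B" "s \<in> B" using * M family_spaced(2)[OF S] by auto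
      have "h (inv j \<otimes> (inv d \<otimes> s)) = - h d + h s"
        using h_mult h_inv in_B B_closed h_M[OF *(2)] by simp
      then have "h (inv j \<otimes> (inv d \<otimes> s)) \<in> {-(r + e)..r + e}" using r(2)[OF *(3)] e[OF *(4)] by auto
      then have "g \<in> region {-(r + e)..r + e}" using * in_B B_closed by (auto intro: regionI)
      then show False using g(2) region_slab[of "{-(r + e)..r + e}" "r + e"] unfolding A_def by blast
    qed
  qed
qed

end

context cyclic_step begin

text \<open>The constants are chosen in the order in which they depend on each other: the reach \<open>c0\<close> of \<open>f\<close> tells how
  thick a wall is needed, the wall comes with a time \<open>n\<close>, and \<open>n\<close> determines \<open>\<rho>\<close>.\<close>

theorem periodic_sum_dies:
  assumes S: "S \<in> family B M" and e: "\<And>s. s \<in> S \<Longrightarrow> \<bar>h s\<bar> \<le> e"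
  shows "\<exists>T. (f ^^ T) (ptsum S) = z"
proof -
  obtain c0 where c0: "0 \<le> c0" "\<And>J g w. g \<in> region J \<Longrightarrow> w \<in> window \<Longrightarrow> w \<otimes> g \<in> F <#> B \<Longrightarrow>
      w \<otimes> g \<in> region (fat c0 J)"
    using region_spread[OF window(1,2)] by blast
  from wall_exists[OF M(1) F_slab[of c0], of B]
  obtain V D n where V: "V \<in> family B M" and D: "finite D" "D \<subseteq> carrier G" and VD: "V \<subseteq> D <#> M"
    and wall1: "\<forall>S\<in>family B M. S \<inter> (D <#> M) = V \<longrightarrow>
      (\<forall>m\<ge>n. agree (\<Delta>/2) (F <#> slab c0) ((f ^^ m) (ptsum S)) z)" by (elim exE conjE)
  have wall: "agree (\<Delta>/2) (F <#> slab c0) ((f ^^ m) (ptsum S)) z"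
    if "S \<in> family B M" "S \<inter> (D <#> M) = V" "n \<le> m" for S m
    using wall1[rule_format, OF that] .
  have wall0: "agree (\<Delta>/2) (region {-c0..c0}) ((f ^^ m) (ptsum S)) z"
    if "S \<in> family B M" "S \<inter> (D <#> M) = V" "n \<le> m" for S m
    by (rule agree_mono[OF agree_M[OF that(1) F_slab(2) wall[OF that]] region_slab[OF subset_refl] order_refl])
  obtain l where l: "0 \<le> l" "\<And>b. b \<in> D \<inter> B \<Longrightarrow> \<bar>h b\<bar> \<le> l" using height_bound[OF D(1)] by blast
  have l': "\<bar>h b\<bar> \<le> l" if b: "b \<in> B" "b \<in> D <#> M" for b
  proof -
    obtain d m where dm: "d \<in> D" "m \<in> M" "b = d \<otimes> m" using b(2) by (rule set_multE)
    have G: "d \<in> carrier G" "m \<in> carrier G" "m \<in> B" using dm D MG M by auto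
    have "d = b \<otimes> inv m" using dm(3) G by (simp add: m_assoc)
    then have "d \<in> B" using b(1) G(3) B_closed by simp
    then show ?thesis using l(2)[of d] dm h_mult[of d m] G(3) h_M[OF dm(2)] by simp
  qed
  from agree_of_heights_upto[of n] obtain \<rho> where \<rho>0: "0 \<le> \<rho>"
    "\<forall>J. \<forall>S\<in>family B M. \<forall>S'\<in>family B M. (\<forall>s\<in>B. h s \<in> fat \<rho> J \<longrightarrow> (s \<in> S \<longleftrightarrow> s \<in> S')) \<longrightarrow>
     (\<forall>m\<le>n. agree (\<Delta>/8) (region J) ((f ^^ m) (ptsum S)) ((f ^^ m) (ptsum S')))" by (elim exE conjE)
  have \<rho>: "0 \<le> \<rho>" "\<And>J S S' m. S \<in> family B M \<Longrightarrow> S' \<in> family B M \<Longrightarrow>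
      (\<And>s. s \<in> B \<Longrightarrow> h s \<in> fat \<rho> J \<Longrightarrow> s \<in> S \<longleftrightarrow> s \<in> S') \<Longrightarrow> m \<le> n \<Longrightarrow>
      agree (\<Delta>/8) (region J) ((f ^^ m) (ptsum S)) ((f ^^ m) (ptsum S'))"
    using \<rho>0(1) by simp (rule \<rho>0(2)[rule_format]; simp)
  have "finite ((\<lambda>g. inv g) ` core <#> core)" by (rule finite_set_mult[OF inv_core(1) core(1)])
  from height_bound[OF this] obtain \<kappa> where \<kappa>: "0 \<le> \<kappa>"
    "\<And>b. b \<in> (\<lambda>g. inv g) ` core <#> core \<Longrightarrow> b \<in> B \<Longrightarrow> \<bar>h b\<bar> \<le> \<kappa>" by blast
  interpret cyclic_walls G Y act z f \<Delta> x \<delta> K C B M F T0 h u V D n c0 l "c0 + \<rho> + 2 * l + \<kappa> + 1" \<kappa> \<rho>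
  proof
    show "V \<in> family B M" "V \<subseteq> D <#> M" "finite D" "D \<subseteq> carrier G" by (fact V VD D)+
    show "0 \<le> l" "0 \<le> c0" "0 \<le> \<rho>" "0 \<le> \<kappa>" by (fact l c0 \<rho> \<kappa>)+
    show "agree (\<Delta>/2) (region {-c0..c0}) ((f ^^ m) (ptsum S)) z"
      if "S \<in> family B M" "S \<inter> (D <#> M) = V" "n \<le> m" for S m using wall0 that .
    show "\<bar>h b\<bar> \<le> l" if "b \<in> B" "b \<in> D <#> M" for b using l' that .
    show "w \<otimes> g \<in> region (fat c0 J)" if "g \<in> region J" "w \<in> window" "w \<otimes> g \<in> F <#> B" for g J w
      using c0(2) that .
    show "agree (\<Delta>/8) (region J) ((f ^^ m) (ptsum S)) ((f ^^ m) (ptsum S'))"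
      if "S \<in> family B M" "S' \<in> family B M" "m \<le> n"
        "\<And>s. s \<in> B \<Longrightarrow> h s \<in> fat \<rho> J \<Longrightarrow> s \<in> S \<longleftrightarrow> s \<in> S'" for S S' m J
      using \<rho>(2)[OF that(1,2,4,3)] .
    show "\<bar>h (inv p \<otimes> q)\<bar> \<le> \<kappa>" if "p \<in> core" "q \<in> core" "inv p \<otimes> q \<in> B" for p q
      using \<kappa>(2) that by (auto intro: set_multI)
    show "c0 + \<rho> + 2 * l + \<kappa> < c0 + \<rho> + 2 * l + \<kappa> + 1" by simp
  qed
  show ?thesis by (rule bounded_sum_dies[OF S e])
qed

end

section \<open>Descent along cyclic and finite quotients\<close>

context nil_sums begin

lemma confined_mono:
  assumes "confined F B" "F \<subseteq> F'" "finite F'" "F' \<subseteq> carrier G"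
  shows "confined F' B"
proof -
  have "F <#> B \<subseteq> F' <#> B" by (rule mono_set_mult[OF assms(2) subset_refl])
  then have sub: "carrier G - (F' <#> B) \<subseteq> carrier G - (F <#> B)" by blast
  show ?thesis unfolding confined_def
  proof (intro conjI allI impI)
    show "finite F'" "F' \<subseteq> carrier G" by (fact assms)+
    fix S m assume "S \<subseteq> B" "spaced S"
    then have "agree (\<Delta>/2) (carrier G - (F <#> B)) ((f ^^ m) (ptsum S)) z"
      using assms(1) unfolding confined_def by blast
    then show "agree (\<Delta>/2) (carrier G - (F' <#> B)) ((f ^^ m) (ptsum S)) z"
      by (rule agree_mono[OF _ sub order_refl])
  qed
qed

text \<open>A finite wall is repeated along a finite index subgroup of the kernel, where residual finiteness
  provides one that keeps the copies apart. The resulting periodic wall dies, and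
  it separates \<open>B\<close> into the cosets of the kernel.\<close>

theorem confined_kernel:
  fixes h :: "'g \<Rightarrow> int"
  assumes B: "subgroup B G" and conf0: "confined F0 B"
    and h_mult: "\<And>a b. a \<in> B \<Longrightarrow> b \<in> B \<Longrightarrow> h (a \<otimes> b) = h a + h b"
    and u: "u \<in> B" "h u = 1"
    and B1: "B1 = {b \<in> B. h b = 0}"
    and rf: "residually_finite G"
  shows "\<exists>F. confined F B1"
proof -
  define F where "F = insert \<one> F0"
  have F: "finite F" "F \<subseteq> carrier G" "\<one> \<in> F" using conf0 unfolding F_def confined_def by auto
  have conf: "confined F B" by (rule confined_mono[OF conf0 _ F(1,2)]) (auto simp: F_def)
  have BG: "B \<subseteq> carrier G" using subgroup.subset[OF B] .
  have B_closed: "a \<otimes> b \<in> B" "inv a \<in> B" if "a \<in> B" "b \<in> B" for a b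
    using subgroup.m_closed[OF B] subgroup.m_inv_closed[OF B] that by auto
  have one_B: "\<one> \<in> B" using subgroup.one_closed[OF B] .
  have h_one: "h \<one> = 0" using h_mult[OF one_B one_B] by simp
  have h_inv: "h (inv a) = - h a" if "a \<in> B" for a
    using h_mult[of "inv a" a] B_closed[OF that that] that BG h_one by auto
  have triv: "subgroup {\<one>} G" by (rule triv_subgroup)
  have set_one: "A <#> {\<one>} = A" if "A \<subseteq> carrier G" for A
    using that unfolding set_mult_def by force
  from wall_exists[OF triv F(1,2), of B]
  obtain U D n where U: "U \<in> family B {\<one>}" and D: "finite D" "D \<subseteq> carrier G" and UD0: "U \<subseteq> D <#> {\<one>}"
    and wall0: "\<forall>S\<in>family B {\<one>}. S \<inter> (D <#> {\<one>}) = U \<longrightarrow>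
      (\<forall>m\<ge>n. agree (\<Delta>/2) F ((f ^^ m) (ptsum S)) z)" by (elim exE conjE)
  have UD: "U \<subseteq> D" using UD0 set_one[OF D(2)] by simp
  have wall: "agree (\<Delta>/2) F ((f ^^ m) (ptsum S)) z"
    if "S \<in> family B {\<one>}" "S \<inter> D = U" "n \<le> m" for S m
    using wall0[rule_format, of S m] that set_one[OF D(2)] by simp
  have Ufin: "finite U" "U \<subseteq> carrier G" using UD D finite_subset by auto
  have UB: "U \<subseteq> B" "spaced U" using U unfolding family_def by auto
  define iU where "iU = (\<lambda>g. inv g) ` U"
  have iU: "finite iU" "iU \<subseteq> carrier G" unfolding iU_def using Ufin by auto
  \<comment> \<open>Avoiding the first part of \<open>A\<close> keeps the copies of \<open>U\<close> apart, avoiding the second keeps them out of \<open>D\<close>.\<close>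
  define A where "A = (iU <#> (((\<lambda>g. inv g) ` core <#> core) <#> U)) \<union> (iU <#> D)"
  have cc: "finite ((\<lambda>g. inv g) ` core <#> core)" "(\<lambda>g. inv g) ` core <#> core \<subseteq> carrier G"
    by (rule finite_set_mult[OF inv_core(1) core(1)], rule set_mult_closed[OF inv_core(2) core(2)])
  have ccU: "finite (((\<lambda>g. inv g) ` core <#> core) <#> U)" "((\<lambda>g. inv g) ` core <#> core) <#> U \<subseteq> carrier G"
    by (rule finite_set_mult[OF cc(1) Ufin(1)], rule set_mult_closed[OF cc(2) Ufin(2)])
  have A: "finite A" "A \<subseteq> carrier G" unfolding A_def
    using finite_set_mult[OF iU(1) ccU(1)] finite_set_mult[OF iU(1) D(1)]
      set_mult_closed[OF iU(2) ccU(2)] set_mult_closed[OF iU(2) D(2)] by auto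
  from residually_finite_avoid[OF rf A] obtain N T where N: "N \<lhd> G" and T: "finite T" "T \<subseteq> carrier G" "carrier G \<subseteq> T <#> N"
    and NA: "N \<inter> A \<subseteq> {\<one>}" by (elim exE conjE)
  have Nsub: "subgroup N G" using N by (rule normal_imp_subgroup)
  have B1sub: "subgroup B1 G"
  proof (rule subgroupI)
    show "B1 \<subseteq> carrier G" "B1 \<noteq> {}" using BG B1 one_B h_one by auto
    show "inv a \<in> B1" if "a \<in> B1" for a using that B1 B_closed h_inv by auto
    show "a \<otimes> b \<in> B1" if "a \<in> B1" "b \<in> B1" for a b using that B1 B_closed h_mult by auto
  qed
  have B1_conj: "inv b \<otimes> m \<otimes> b \<in> B1" if "b \<in> B" "m \<in> B1" for b m
    using that B1 B_closed h_mult h_inv by simp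
  define M where "M = N \<inter> B1"
  have M: "subgroup M G" unfolding M_def by (rule subgroups_Inter_pair[OF Nsub B1sub])
  have MB: "M \<subseteq> B" "M \<subseteq> B1" "M \<subseteq> N" unfolding M_def B1 by auto
  have MG: "M \<subseteq> carrier G" "\<one> \<in> M" using subgroup.subset[OF M] subgroup.one_closed[OF M] by auto
  have M_norm: "inv b \<otimes> m \<otimes> b \<in> M" if "b \<in> B" "m \<in> M" for b m
    using that B1_conj normal.inv_op_closed1[OF N] BG unfolding M_def by auto
  define rep where "rep t = (SOME b. b \<in> B1 \<and> b \<in> {t} <#> N)" for t
  define T0 where "T0 = rep ` {t \<in> T. \<exists>b. b \<in> B1 \<and> b \<in> {t} <#> N}"
  have rep: "rep t \<in> B1 \<and> rep t \<in> {t} <#> N" if "\<exists>b. b \<in> B1 \<and> b \<in> {t} <#> N" for t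
    unfolding rep_def using someI_ex[OF that] .
  have T0: "finite T0" "T0 \<subseteq> B" unfolding T0_def using T(1) rep B1 by auto
  have T0cover: "b \<in> T0 <#> M" if b: "b \<in> B1" for b
  proof -
    have bG: "b \<in> carrier G" using b B1 BG by auto
    then have "b \<in> T <#> N" using T(3) by blast
    then obtain t k where tk: "t \<in> T" "k \<in> N" "b = t \<otimes> k" by (rule set_multE)
    then have ex: "\<exists>b. b \<in> B1 \<and> b \<in> {t} <#> N" using b set_multI[of t "{t}" k N] by auto
    obtain k' where k': "k' \<in> N" "rep t = t \<otimes> k'" using rep[OF ex] by (auto elim!: set_multE)
    have G: "t \<in> carrier G" "k \<in> carrier G" "k' \<in> carrier G"
      using tk k' T(2) subgroup.subset[OF Nsub] by auto
    have "inv (rep t) \<otimes> b = inv k' \<otimes> (inv t \<otimes> (t \<otimes> k))"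
      using k'(2) tk(3) G by (simp add: inv_mult_group m_assoc)
    also have "\<dots> = inv k' \<otimes> k" using G by (simp add: m_assoc[symmetric])
    also have "\<dots> \<in> N" using k'(1) tk(2) Nsub by (simp add: subgroup.m_closed subgroup.m_inv_closed)
    finally have "inv (rep t) \<otimes> b \<in> N" .
    moreover have "inv (rep t) \<otimes> b \<in> B1" using rep[OF ex] b B1sub
      by (simp add: subgroup.m_closed subgroup.m_inv_closed)
    ultimately have "inv (rep t) \<otimes> b \<in> M" unfolding M_def by blast
    moreover have "rep t \<in> T0" unfolding T0_def using ex tk(1) by blast
    ultimately have "rep t \<otimes> (inv (rep t) \<otimes> b) \<in> T0 <#> M" by (intro set_multI)
    moreover have "rep t \<otimes> (inv (rep t) \<otimes> b) = b"
      using k'(2) G bG by (simp add: m_assoc[symmetric])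
    ultimately show ?thesis by (simp only:)
  qed
  have UM_spaced: "spaced (U <#> M)" unfolding spaced_def
  proof (intro conjI ballI impI)
    show "U <#> M \<subseteq> carrier G" by (rule set_mult_closed[OF Ufin(2) MG(1)])
    fix s t assume st: "s \<in> U <#> M" "t \<in> U <#> M" "s \<noteq> t"
    obtain a i where a: "a \<in> U" "i \<in> M" "s = a \<otimes> i" using st(1) by (rule set_multE)
    obtain b j where b: "b \<in> U" "j \<in> M" "t = b \<otimes> j" using st(2) by (rule set_multE)
    have G: "a \<in> carrier G" "b \<in> carrier G" "i \<in> carrier G" "j \<in> carrier G" using a b Ufin MG by auto
    show "(core #> s) \<inter> (core #> t) = {}"
    proof (rule ccontr)
      assume "(core #> s) \<inter> (core #> t) \<noteq> {}"
      then obtain p q where pq: "p \<in> core" "q \<in> core" "p \<otimes> s = q \<otimes> t" unfolding r_coset_def by blast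
      have pqG: "p \<in> carrier G" "q \<in> carrier G" using pq core by auto
      have "p \<otimes> a \<otimes> i = q \<otimes> b \<otimes> j" using pq(3) a(3) b(3) G pqG by (simp add: m_assoc)
      then have "p \<otimes> a \<otimes> (i \<otimes> inv j) = q \<otimes> b" using G pqG by (simp add: m_assoc[symmetric] inv_solve_right')
      then have "inv a \<otimes> (inv p \<otimes> (p \<otimes> a \<otimes> (i \<otimes> inv j))) = inv a \<otimes> (inv p \<otimes> (q \<otimes> b))" by simp
      moreover have "inv a \<otimes> (inv p \<otimes> (p \<otimes> a \<otimes> (i \<otimes> inv j))) = inv (p \<otimes> a) \<otimes> (p \<otimes> a \<otimes> (i \<otimes> inv j))"
        using G pqG by (simp add: inv_mult_group m_assoc)
      moreover have "\<dots> = (inv (p \<otimes> a) \<otimes> (p \<otimes> a)) \<otimes> (i \<otimes> inv j)"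
        using G pqG by (intro m_assoc[symmetric]) auto
      moreover have "\<dots> = i \<otimes> inv j" using G pqG by simp
      ultimately have eq: "i \<otimes> inv j = inv a \<otimes> ((inv p \<otimes> q) \<otimes> b)" using G pqG by (simp add: m_assoc)
      have "inv a \<otimes> ((inv p \<otimes> q) \<otimes> b) \<in> A" unfolding A_def iU_def
        using a(1) b(1) pq(1,2) by (intro UnI1 set_multI) auto
      moreover have "i \<otimes> inv j \<in> N" using a(2) b(2) MB(3) Nsub
        by (meson subgroup.m_closed subgroup.m_inv_closed subsetD)
      ultimately have "i \<otimes> inv j = \<one>" using NA eq by auto
      then have ij: "i = j" using G by (metis inv_equality inv_inv inv_closed)
      then have "p \<otimes> a = q \<otimes> b" using \<open>p \<otimes> a \<otimes> i = q \<otimes> b \<otimes> j\<close> G pqG by simp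
      then have "(core #> a) \<inter> (core #> b) \<noteq> {}" using pq(1,2) unfolding r_coset_def by blast
      then have "a = b" using UB(2) a(1) b(1) unfolding spaced_def by blast
      then show False using st(3) a(3) b(3) ij by simp
    qed
  qed
  have UM_D: "(U <#> M) \<inter> D = U"
  proof (intro equalityI subsetI)
    fix s assume s: "s \<in> (U <#> M) \<inter> D"
    then obtain a i where a: "a \<in> U" "i \<in> M" "s = a \<otimes> i" by (auto elim!: set_multE)
    have G: "a \<in> carrier G" "i \<in> carrier G" using a Ufin MG by auto
    have "i = inv a \<otimes> s" using a(3) G by (simp add: m_assoc[symmetric])
    moreover have "inv a \<otimes> s \<in> A" unfolding A_def iU_def using a(1) s by (intro UnI2 set_multI) auto
    ultimately have "i = \<one>" using NA a(2) MB(3) by auto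
    then show "s \<in> U" using a G by simp
  next
    fix s assume "s \<in> U"
    then show "s \<in> (U <#> M) \<inter> D" using UD subset_set_mult_right[OF MG(2) Ufin(2)] by blast
  qed
  have UM_family: "U <#> M \<in> family B M"
  proof -
    have "U <#> M \<subseteq> B" using UB(1) MB(1) B_closed by (auto elim!: set_multE)
    moreover have "s \<otimes> m \<in> U <#> M" if s: "s \<in> U <#> M" and m: "m \<in> M" for s m
    proof -
      obtain a i where a: "a \<in> U" "i \<in> M" "s = a \<otimes> i" using s by (rule set_multE)
      then have "s \<otimes> m = a \<otimes> (i \<otimes> m)" using Ufin MG m by (simp add: m_assoc subset_iff)
      then show ?thesis using a m subgroup.m_closed[OF M] by (auto intro: set_multI)
    qed
    ultimately show ?thesis using UM_spaced unfolding family_def by blast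
  qed
  have UM_family1: "U <#> M \<in> family B {\<one>}"
    using UM_family family_carrier[OF UM_family] unfolding family_def by auto
  interpret cyc: cyclic_step G Y act z f \<Delta> x \<delta> K C B M F T0 h u
  proof (intro cyclic_step.intro nil_sums_axioms cyclic_step_axioms.intro)
    show "b \<in> T0 <#> M" if "b \<in> B" "h b = 0" for b using T0cover that B1 by blast
    show "h m = 0" if "m \<in> M" for m using that MB(2) B1 by blast
    show "h (a \<otimes> b) = h a + h b" if "a \<in> B" "b \<in> B" for a b by (rule h_mult[OF that])
    show "inv b \<otimes> m \<otimes> b \<in> M" if "b \<in> B" "m \<in> M" for b m by (rule M_norm[OF that])
  qed (fact B M MB(1) u T0 conf F(3))+
  obtain e where e: "\<And>b. b \<in> U \<inter> B \<Longrightarrow> \<bar>h b\<bar> \<le> e" using cyc.height_bound[OF Ufin(1)] by blast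
  have he: "\<bar>h s\<bar> \<le> e" if "s \<in> U <#> M" for s
  proof -
    obtain a i where a: "a \<in> U" "i \<in> M" "s = a \<otimes> i" using \<open>s \<in> U <#> M\<close> by (rule set_multE)
    then have "a \<in> B" "i \<in> B" using UB(1) MB(1) by auto
    then show ?thesis using e[of a] a h_mult[of a i] cyc.h_M[OF a(2)] by simp
  qed
  obtain T' where T': "(f ^^ T') (ptsum (U <#> M)) = z" using cyc.periodic_sum_dies[OF UM_family he] by blast
  have "\<exists>D'. finite D' \<and> D' \<subseteq> carrier G \<and> (\<forall>S\<in>family B {\<one>}. S \<inter> (D' <#> M) = {} \<longrightarrow>
      (\<forall>m. agree (\<Delta>/2) F ((f ^^ m) (ptsum S)) z))"
  proof (rule stable_of_dying_wall[OF MG BG UM_family1 subset_refl Ufin T' D _ F(1,2)])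
    show "D \<subseteq> D <#> M" by (rule subset_set_mult_right[OF MG(2) D(2)])
    show "agree (\<Delta>/2) F ((f ^^ m) (ptsum S)) z"
      if "S \<in> family B {\<one>}" "S \<inter> D = (U <#> M) \<inter> D" "n \<le> m" for S m
      using wall[OF that(1) _ that(3)] that(2) UM_D by simp
  qed
  then obtain D' where D': "finite D'" "D' \<subseteq> carrier G"
    and st0: "\<forall>S\<in>family B {\<one>}. S \<inter> (D' <#> M) = {} \<longrightarrow> (\<forall>m. agree (\<Delta>/2) F ((f ^^ m) (ptsum S)) z)"
    by (elim exE conjE)
  define F' where "F' = F <#> (\<lambda>d. inv d) ` (D' \<inter> B)"
  have "(\<lambda>d. inv d) ` (D' \<inter> B) \<subseteq> carrier G" using D' by auto
  then have F': "finite F'" "F' \<subseteq> carrier G" unfolding F'_def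
    using finite_set_mult[OF F(1), of "(\<lambda>d. inv d) ` (D' \<inter> B)"] set_mult_closed[OF F(2)] D'(1) by auto
  have "dist (act g ((f ^^ m) (ptsum S))) z \<le> \<Delta>/2"
    if S: "S \<subseteq> B1" "spaced S" and g: "g \<in> carrier G" "g \<notin> F' <#> B1" for S m g
  proof (rule ccontr)
    assume "\<not> ?thesis"
    then have big: "\<Delta>/2 < dist (act g ((f ^^ m) (ptsum S))) z" by simp
    have SF: "S \<in> family B {\<one>}" using S B1 spaced_carrier[OF S(2)] unfolding family_def by auto
    have "\<exists>c\<in>F. \<exists>k\<in>M. \<exists>d\<in>D' \<inter> B. \<exists>s\<in>S. g = c \<otimes> (inv k \<otimes> (inv d \<otimes> s))"
    proof (rule support_of_stable[OF B MB(1) conf _ _ D'(2) _ SF g(1) big])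
      show "inv b \<otimes> m \<otimes> b \<in> {\<one>}" if "b \<in> B" "m \<in> {\<one>}" for b m using that BG by auto
      show "agree (\<Delta>/2) F ((f ^^ m) (ptsum S)) z"
        if "S \<in> family B {\<one>}" "S \<inter> (D' <#> M) = {}" for S m using st0[rule_format, OF that] .
    qed auto
    then obtain c k d s where *: "c \<in> F" "k \<in> M" "d \<in> D' \<inter> B" "s \<in> S" "g = c \<otimes> (inv k \<otimes> (inv d \<otimes> s))"
      by blast
    have in_B: "k \<in> B" "d \<in> B" "s \<in> B" "k \<in> B1" "s \<in> B1" using * MB S(1) B1 by auto
    have G: "c \<in> carrier G" "k \<in> carrier G" "d \<in> carrier G" "s \<in> carrier G" using in_B BG * F(2) by auto
    define v where "v = (inv (inv d) \<otimes> inv k \<otimes> inv d) \<otimes> s"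
    have "v \<in> B1" unfolding v_def
      using B1_conj[of "inv d" "inv k"] in_B B_closed B1sub
      by (simp add: subgroup.m_closed subgroup.m_inv_closed)
    moreover have "g = (c \<otimes> inv d) \<otimes> v" unfolding v_def using *(5) G by (simp add: m_assoc inv_solve_left)
    moreover have "c \<otimes> inv d \<in> F'" unfolding F'_def using * by (intro set_multI) auto
    ultimately have "g \<in> F' <#> B1" by (simp only: set_multI)
    then show False using g(2) by blast
  qed
  then have "confined F' B1" unfolding confined_def agree_def using F' act_z by auto
  then show ?thesis by blast
qed

end

context nil_sums begin

lemma mult_swap:
  assumes "m \<in> carrier G" "p \<in> carrier G" "n \<in> carrier G" "q \<in> carrier G"
  shows "(m \<otimes> p) \<otimes> (n \<otimes> q) = (m \<otimes> (p \<otimes> n \<otimes> inv p)) \<otimes> (p \<otimes> q)"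
proof -
  have "inv p \<otimes> (p \<otimes> q) = q" using assms by (simp add: m_assoc[symmetric])
  then show ?thesis using assms by (simp add: m_assoc)
qed

text \<open>For a cyclic quotient of \<open>B\<close>, either some power of the generator lies in \<open>B1\<close> and the index is finite, or
  the exponent of the generator is a homomorphism onto the integers with kernel \<open>B1\<close>.\<close>

lemma confined_cyclic:
  assumes B: "subgroup B G" and B1: "subgroup B1 G" "B1 \<subseteq> B" and w: "w \<in> B"
    and norm: "\<And>b m. b \<in> B \<Longrightarrow> m \<in> B1 \<Longrightarrow> inv b \<otimes> m \<otimes> b \<in> B1"
    and gen: "\<And>b. b \<in> B \<Longrightarrow> \<exists>m\<in>B1. \<exists>i::int. b = m \<otimes> w [^] i"
    and conf: "confined F B"
    and rf: "residually_finite G"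
  shows "\<exists>F. confined F B1"
proof -
  have G: "B \<subseteq> carrier G" "B1 \<subseteq> carrier G" "w \<in> carrier G" using subgroup.subset B B1 w by auto
  have closed: "a \<otimes> b \<in> B1" "inv a \<in> B1" if "a \<in> B1" "b \<in> B1" for a b
    using that B1 by (auto simp: subgroup.m_closed subgroup.m_inv_closed)
  have wB: "w [^] (i::int) \<in> B" for i using B w by (rule subgroup_int_pow_closed)
  have conj: "w [^] (i::int) \<otimes> m \<otimes> inv (w [^] i) \<in> B1" if "m \<in> B1" for m i
    using norm[of "inv (w [^] i)" m] that wB B G by (simp add: subgroup.m_inv_closed)
  have pow1: "(w [^] (j::int)) [^] (i::int) \<in> B1" if "w [^] j \<in> B1" for i j
    using B1(1) that by (rule subgroup_int_pow_closed)
  show ?thesis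
  proof (cases "\<exists>j::int. 0 < j \<and> w [^] j \<in> B1")
    case True
    then obtain j :: int where j: "0 < j" "w [^] j \<in> B1" by blast
    define T where "T = (\<lambda>i::int. w [^] i) ` {0..<j}"
    have T: "finite T" "T \<subseteq> carrier G" unfolding T_def using G by auto
    have "b \<in> T <#> B1" if b: "b \<in> B" for b
    proof -
      obtain m i where mi: "m \<in> B1" "b = m \<otimes> w [^] (i::int)" using gen[OF b] by blast
      have mG: "m \<in> carrier G" using mi G by auto
      define r where "r = i mod j"
      have "i = r + j * (i div j)" unfolding r_def by simp
      then have wi: "w [^] i = w [^] r \<otimes> (w [^] j) [^] (i div j)"
        using G by (metis int_pow_mult int_pow_pow)
      have "inv (w [^] i) \<otimes> m \<otimes> w [^] i \<in> B1" by (rule norm[OF wB mi(1)])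
      then have in_B1: "(w [^] j) [^] (i div j) \<otimes> (inv (w [^] i) \<otimes> m \<otimes> w [^] i) \<in> B1"
        using closed pow1[OF j(2)] by blast
      have "b = w [^] i \<otimes> (inv (w [^] i) \<otimes> m \<otimes> w [^] i)"
        using mi(2) mG G by (simp add: m_assoc[symmetric])
      also have "\<dots> = w [^] r \<otimes> ((w [^] j) [^] (i div j) \<otimes> (inv (w [^] i) \<otimes> m \<otimes> w [^] i))"
        using wi mG G by (simp add: m_assoc)
      finally have eq: "b = w [^] r \<otimes> ((w [^] j) [^] (i div j) \<otimes> (inv (w [^] i) \<otimes> m \<otimes> w [^] i))" .
      have "w [^] r \<in> T" unfolding T_def r_def using j(1) by auto
      from set_multI[OF this in_B1] show ?thesis using eq by (simp only:)
    qed
    then have "B \<subseteq> T <#> B1" by blast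
    then show ?thesis using confined_finite_index[OF conf B1(2) G(2) T] by blast
  next
    case False
    have zero: "i = 0" if "w [^] (i::int) \<in> B1" for i
    proof (rule ccontr)
      assume "i \<noteq> 0"
      moreover have "w [^] (- i) \<in> B1" using closed(2)[OF that that] G by (simp add: int_pow_neg)
      ultimately show False using False that by (metis neg_0_less_iff_less not_less_iff_gr_or_eq)
    qed
    define h where "h b = (THE i. b \<otimes> inv (w [^] (i::int)) \<in> B1)" for b
    have h: "h (m \<otimes> w [^] i) = i" if m: "m \<in> B1" for m and i :: int
      unfolding h_def
    proof (rule the_equality)
      have mG: "m \<in> carrier G" using m G by auto
      show "m \<otimes> w [^] i \<otimes> inv (w [^] i) \<in> B1" using m mG G by (simp add: m_assoc)
      fix j :: int assume j: "m \<otimes> w [^] i \<otimes> inv (w [^] j) \<in> B1"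
      have "w [^] (i - j) = inv m \<otimes> (m \<otimes> w [^] i \<otimes> inv (w [^] j))"
        using mG G by (simp add: int_pow_diff m_assoc[symmetric])
      also have "\<dots> \<in> B1" using closed j m by blast
      finally show "j = i" using zero by force
    qed
    have h_mult: "h (a \<otimes> b) = h a + h b" if ab: "a \<in> B" "b \<in> B" for a b
    proof -
      obtain m i where a: "m \<in> B1" "a = m \<otimes> w [^] (i::int)" using gen[OF ab(1)] by blast
      obtain m' j where b: "m' \<in> B1" "b = m' \<otimes> w [^] (j::int)" using gen[OF ab(2)] by blast
      have mG: "m \<in> carrier G" "m' \<in> carrier G" using a b G by auto
      have "a \<otimes> b = (m \<otimes> (w [^] i \<otimes> m' \<otimes> inv (w [^] i))) \<otimes> w [^] (i + j)"
        unfolding a(2) b(2) int_pow_mult[OF G(3)] by (rule mult_swap) (use mG G in auto)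
      moreover have "m \<otimes> (w [^] i \<otimes> m' \<otimes> inv (w [^] i)) \<in> B1" using closed a(1) conj[OF b(1)] by blast
      ultimately show ?thesis using h a b by simp
    qed
    have "h w = 1"
      using h[OF subgroup.one_closed[OF B1(1)], of 1] G by simp
    moreover have "B1 = {b \<in> B. h b = 0}"
    proof (intro equalityI subsetI CollectI conjI)
      fix b assume b: "b \<in> B1"
      then show "b \<in> B" using B1 by auto
      show "h b = 0" using h[OF b, of 0] b G by auto
    next
      fix b assume b: "b \<in> {b \<in> B. h b = 0}"
      then obtain m i where m: "m \<in> B1" "b = m \<otimes> w [^] (i::int)" using gen by blast
      then have "i = 0" using b h by simp
      then show "b \<in> B1" using m G by auto
    qed
    ultimately show ?thesis using confined_kernel[OF B conf h_mult w _ _ rf] by blast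
  qed
qed

text \<open>All subgroups between \<open>J\<close> and \<open>L1\<close> are normal in \<open>L1\<close>, so the generators in \<open>U\<close> can be dropped one after
  the other, each time with a cyclic quotient.\<close>

lemma confined_abelian:
  assumes L1: "subgroup L1 G" and J: "subgroup J G" "J \<subseteq> L1"
    and comm: "\<And>a b. a \<in> L1 \<Longrightarrow> b \<in> L1 \<Longrightarrow> inv a \<otimes> (inv b \<otimes> (a \<otimes> b)) \<in> J"
    and rf: "residually_finite G"
    and U: "finite U" "U \<subseteq> L1" and conf: "confined F (generate G (U \<union> J))"
  shows "\<exists>F. confined F J"
  using U conf
proof (induction U arbitrary: F rule: finite_induct)
  case empty
  have "generate G J = J" using J(1) by (rule generateI[OF _ subset_refl, symmetric])
      (use subgroup.subset[OF J(1)] in auto)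
  then show ?case using empty by auto
next
  case (insert w U)
  have LG: "L1 \<subseteq> carrier G" using subgroup.subset[OF L1] .
  define B where "B = generate G (insert w U \<union> J)"
  define B1 where "B1 = generate G (U \<union> J)"
  have sub: "insert w U \<union> J \<subseteq> L1" "U \<union> J \<subseteq> L1" using insert.prems J by auto
  have subG: "insert w U \<union> J \<subseteq> carrier G" "U \<union> J \<subseteq> carrier G" using sub LG by auto
  have B: "subgroup B G" "subgroup B1 G" unfolding B_def B1_def using generate_is_subgroup subG by auto
  have "B1 \<subseteq> B" unfolding B1_def B_def by (rule mono_generate) auto
  have BL: "B \<subseteq> L1" unfolding B_def using generate_subgroup_incl[OF sub(1) L1] .
  have B1L: "B1 \<subseteq> L1" using BL \<open>B1 \<subseteq> B\<close> by blast
  have JB1: "J \<subseteq> B1" unfolding B1_def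
    by (rule subsetI, rule generate.incl) simp
  have wB: "w \<in> B" unfolding B_def by (rule generate.incl) simp
  have wL: "w \<in> L1" "w \<in> carrier G" using insert.prems LG by auto
  have norm: "inv b \<otimes> m \<otimes> b \<in> B1" if b: "b \<in> L1" and m: "m \<in> B1" for b m
  proof -
    have mG: "b \<in> carrier G" "m \<in> carrier G" using b m B1L LG by auto
    have "m \<otimes> (inv m \<otimes> (inv b \<otimes> (m \<otimes> b))) \<in> B1"
      using comm[of m b] m b B1L JB1 B(2) by (blast intro: subgroup.m_closed)
    moreover have "m \<otimes> (inv m \<otimes> (inv b \<otimes> (m \<otimes> b))) = (m \<otimes> inv m) \<otimes> (inv b \<otimes> (m \<otimes> b))"
      using mG by (intro m_assoc[symmetric]) auto
    moreover have "(m \<otimes> inv m) \<otimes> (inv b \<otimes> (m \<otimes> b)) = inv b \<otimes> m \<otimes> b"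
      using mG by (simp add: m_assoc)
    ultimately show ?thesis by simp
  qed
  have wpowL: "w [^] (i::int) \<in> L1" for i using L1 wL(1) by (rule subgroup_int_pow_closed)
  have gen: "\<exists>m\<in>B1. \<exists>i::int. b = m \<otimes> w [^] i" if b: "b \<in> B" for b
    using b unfolding B_def
  proof (induction b rule: generate.induct)
    case one
    show ?case by (rule bexI[of _ \<one>], rule exI[of _ 0]) (use subgroup.one_closed[OF B(2)] in auto)
  next
    case (incl a)
    show ?case
    proof (cases "a = w")
      case True
      have "w = \<one> \<otimes> w [^] (1::int)" using wL by simp
      then show ?thesis using True subgroup.one_closed[OF B(2)] by blast
    next
      case False
      then have a: "a \<in> B1" unfolding B1_def using incl by (intro generate.incl) auto
      then have "a = a \<otimes> w [^] (0::int)" using B1L LG by auto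
      then show ?thesis using a by blast
    qed
  next
    case (inv a)
    show ?case
    proof (cases "a = w")
      case True
      have "inv w = \<one> \<otimes> w [^] (- 1::int)" using wL by (simp add: int_pow_neg)
      then show ?thesis using True subgroup.one_closed[OF B(2)] by blast
    next
      case False
      then have a: "inv a \<in> B1" unfolding B1_def using inv by (intro generate.inv) auto
      then have "inv a = inv a \<otimes> w [^] (0::int)" using B1L LG by auto
      then show ?thesis using a by blast
    qed
  next
    case (eng a b)
    then obtain m m' and i j :: int where mi: "m \<in> B1" "a = m \<otimes> w [^] i" "m' \<in> B1" "b = m' \<otimes> w [^] j" by blast
    have mG: "m \<in> carrier G" "m' \<in> carrier G" using mi B1L LG by auto
    have "inv (inv (w [^] i)) \<otimes> m' \<otimes> inv (w [^] i) \<in> B1"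
      using norm[OF _ mi(3)] wpowL L1 by (simp add: subgroup.m_inv_closed)
    then have "m \<otimes> (w [^] i \<otimes> m' \<otimes> inv (w [^] i)) \<in> B1"
      using mi(1) B(2) wL by (simp add: subgroup.m_closed)
    moreover have "a \<otimes> b = (m \<otimes> (w [^] i \<otimes> m' \<otimes> inv (w [^] i))) \<otimes> w [^] (i + j)"
      unfolding mi(2,4) int_pow_mult[OF wL(2)] by (rule mult_swap) (use mG wL in auto)
    ultimately show ?case by blast
  qed
  obtain F' where "confined F' B1"
    using confined_cyclic[OF B \<open>B1 \<subseteq> B\<close> wB norm gen _ rf] BL insert.prems(2) unfolding B_def by blast
  then show ?case using insert.IH insert.prems unfolding B1_def by blast
qed

end

context nil_sums begin

text \<open>One step of the subnormal series. The factor need not be finitely generated: confinement is first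
  passed on to a finitely generated subgroup, on which the factor is virtually abelian.\<close>

lemma confined_factor:
  fixes L :: "('l, 'k) monoid_scheme"
  assumes \<psi>: "\<psi> \<in> hom G L" and L: "group L" and H1: "subgroup H1 L"
    and H0: "H0 \<lhd> L\<lparr>carrier := H1\<rparr>"
    and lva: "locally_virtually_abelian ((L\<lparr>carrier := H1\<rparr>) Mod H0)"
    and B: "subgroup B G" and \<psi>B: "\<psi> ` B \<subseteq> H1" and conf: "confined F B"
    and rf: "residually_finite G"
  shows "\<exists>J F. subgroup J G \<and> \<psi> ` J \<subseteq> H0 \<and> confined F J"
proof -
  interpret L: group L by (rule L)
  interpret \<psi>: group_hom G L \<psi> by (unfold_locales) (rule \<psi>)
  define P where "P = L\<lparr>carrier := H1\<rparr>"
  interpret P: group P unfolding P_def by (rule L.subgroup_imp_group[OF H1])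
  have N0: "H0 \<lhd> P" using H0 unfolding P_def .
  interpret N: normal H0 P by (rule N0)
  have H0P: "subgroup H0 P" by (rule normal_imp_subgroup[OF N0])
  have H0L: "subgroup H0 L" by (rule L.incl_subgroup[OF H1]) (use H0P in \<open>simp add: P_def\<close>)
  have BG: "B \<subseteq> carrier G" using subgroup.subset[OF B] .
  define Q where "Q = P Mod H0"
  have Q: "group Q" unfolding Q_def by (rule N.factorgroup_is_group)
  define c where "c g = H0 #>\<^bsub>P\<^esub> \<psi> g" for g
  have \<psi>P: "\<psi> g \<in> carrier P" if "g \<in> B" for g using that \<psi>B unfolding P_def by auto
  have c_in: "c g \<in> carrier Q" if "g \<in> B" for g
    using \<psi>P[OF that] unfolding Q_def c_def FactGroup_def RCOSETS_def by auto
  have c_mult: "c (g \<otimes> g') = c g \<otimes>\<^bsub>Q\<^esub> c g'" if g: "g \<in> B" "g' \<in> B" for g g'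
  proof -
    have "g \<in> carrier G" "g' \<in> carrier G" using g BG by auto
    then have "\<psi> (g \<otimes> g') = \<psi> g \<otimes>\<^bsub>P\<^esub> \<psi> g'" unfolding P_def by simp
    then show ?thesis using N.rcos_sum[OF \<psi>P[OF g(1)] \<psi>P[OF g(2)]] unfolding c_def Q_def by simp
  qed
  have c_ker: "\<psi> g \<in> H0" if g: "g \<in> B" "c g = \<one>\<^bsub>Q\<^esub>" for g
    using P.coset_join1[OF _ \<psi>P[OF g(1)] H0P] g(2) unfolding c_def Q_def by simp
  obtain U F1 where U: "finite U" "U \<subseteq> B"
    and F1: "\<forall>B1. U \<subseteq> B1 \<longrightarrow> B1 \<subseteq> B \<longrightarrow> subgroup B1 G \<longrightarrow> confined F1 B1"
    using confined_local[OF B conf] by blast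
  have UG: "U \<subseteq> carrier G" using U BG by auto
  have genB: "generate G U \<subseteq> B" using generate_subgroup_incl[OF U(2) B] .
  have conf1: "confined F1 (generate G U)"
  proof -
    have "U \<subseteq> generate G U" by (rule subsetI, rule generate.incl)
    then show ?thesis using F1 genB generate_is_subgroup[OF UG] by blast
  qed
  have va: "virtually_abelian (Q\<lparr>carrier := generate Q (c ` U)\<rparr>)"
    using lva U c_in unfolding locally_virtually_abelian_def Q_def P_def by blast
  have "\<exists>L1 T. subgroup L1 G \<and> L1 \<subseteq> generate G U \<and> finite T \<and> T \<subseteq> carrier G \<and> generate G U \<subseteq> T <#> L1 \<and>
    (\<forall>a\<in>L1. \<forall>b\<in>L1. c (inv a \<otimes> (inv b \<otimes> (a \<otimes> b))) = \<one>\<^bsub>Q\<^esub>)"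
    by (rule virtually_abelian_pullback[OF B Q _ _ U(2) va]) (fact c_in c_mult)+
  then obtain L1 T where L1: "subgroup L1 G" "L1 \<subseteq> generate G U" and T: "finite T" "T \<subseteq> carrier G"
    "generate G U \<subseteq> T <#> L1" and comm: "\<forall>a\<in>L1. \<forall>b\<in>L1. c (inv a \<otimes> (inv b \<otimes> (a \<otimes> b))) = \<one>\<^bsub>Q\<^esub>"
    by (elim exE conjE)
  have L1G: "L1 \<subseteq> carrier G" using subgroup.subset[OF L1(1)] .
  have L1B: "L1 \<subseteq> B" using L1(2) genB by blast
  have conf2: "confined (F1 <#> T) L1" by (rule confined_finite_index[OF conf1 L1(2) L1G T])
  define J where "J = {g \<in> L1. \<psi> g \<in> H0}"
  have JL: "J \<subseteq> L1" unfolding J_def by auto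
  have closed: "a \<otimes> b \<in> L1" "inv a \<in> L1" "\<one> \<in> L1" if "a \<in> L1" "b \<in> L1" for a b
    using that L1(1) by (auto simp: subgroup.m_closed subgroup.m_inv_closed subgroup.one_closed)
  have J: "subgroup J G"
  proof (rule subgroupI)
    show "J \<subseteq> carrier G" using JL L1G by blast
    have "\<one> \<in> J" unfolding J_def using subgroup.one_closed[OF L1(1)] subgroup.one_closed[OF H0L] by simp
    then show "J \<noteq> {}" by blast
    show "inv a \<in> J" if "a \<in> J" for a
    proof -
      have "a \<in> L1" "a \<in> carrier G" "\<psi> a \<in> H0" using that L1G unfolding J_def by blast+
      then show ?thesis using closed(2)[of a a] subgroup.m_inv_closed[OF H0L, of "\<psi> a"]
        unfolding J_def by simp
    qed
    show "a \<otimes> b \<in> J" if "a \<in> J" "b \<in> J" for a b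
    proof -
      have "a \<in> L1" "a \<in> carrier G" "\<psi> a \<in> H0" "b \<in> L1" "b \<in> carrier G" "\<psi> b \<in> H0"
        using that L1G unfolding J_def by blast+
      then show ?thesis using closed(1)[of a b] subgroup.m_closed[OF H0L, of "\<psi> a" "\<psi> b"]
        unfolding J_def by simp
    qed
  qed
  have commJ: "inv a \<otimes> (inv b \<otimes> (a \<otimes> b)) \<in> J" if ab: "a \<in> L1" "b \<in> L1" for a b
  proof -
    define g where "g = inv a \<otimes> (inv b \<otimes> (a \<otimes> b))"
    have gL: "g \<in> L1" unfolding g_def
      by (intro closed(1) closed(2)[OF ab(1) ab(1)] closed(2)[OF ab(2) ab(2)] ab)
    have "c g = \<one>\<^bsub>Q\<^esub>" unfolding g_def using comm ab by simp
    moreover have "g \<in> B" using gL L1B by (rule subsetD[rotated])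
    ultimately have "\<psi> g \<in> H0" using c_ker by simp
    then show ?thesis using gL unfolding J_def g_def by simp
  qed
  obtain V F2 where V: "finite V" "V \<subseteq> L1"
    and F2: "\<forall>B1. V \<subseteq> B1 \<longrightarrow> B1 \<subseteq> L1 \<longrightarrow> subgroup B1 G \<longrightarrow> confined F2 B1"
    using confined_local[OF L1(1) conf2] by blast
  have VJ: "V \<union> J \<subseteq> L1" using V JL by blast
  have conf3: "confined F2 (generate G (V \<union> J))"
  proof -
    have "V \<subseteq> generate G (V \<union> J)" by (rule subsetI, rule generate.incl) simp
    moreover have "generate G (V \<union> J) \<subseteq> L1" by (rule generate_subgroup_incl[OF VJ L1(1)])
    moreover have "subgroup (generate G (V \<union> J)) G" by (rule generate_is_subgroup) (use VJ L1G in blast)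
    ultimately show ?thesis using F2 by blast
  qed
  have "\<exists>F. confined F J"
    by (rule confined_abelian[OF L1(1) J JL _ rf V conf3]) (rule commJ)
  moreover have "\<psi> ` J \<subseteq> H0" unfolding J_def by auto
  ultimately show ?thesis using J by blast
qed

text \<open>The series lives in a group \<open>L\<close> of which \<open>G\<close> is an extension with finite kernel. The descent ends in this
  kernel.\<close>

theorem x_dies_of_series:
  fixes L :: "('l, 'k) monoid_scheme"
  assumes \<psi>: "\<psi> \<in> hom G L" and L: "group L" and ker: "finite {g \<in> carrier G. \<psi> g = \<one>\<^bsub>L\<^esub>}"
    and series: "subnormal_series L n H"
    and lva: "\<And>k. k < n \<Longrightarrow> locally_virtually_abelian ((L\<lparr>carrier := H (Suc k)\<rparr>) Mod (H k))"
    and rf: "residually_finite G"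
  shows "\<exists>T. (f ^^ T) x = z"
proof -
  have ser: "H 0 = {\<one>\<^bsub>L\<^esub>}" "H n = carrier L" "\<And>k. k \<le> n \<Longrightarrow> subgroup (H k) L"
    "\<And>k. k < n \<Longrightarrow> H k \<lhd> L\<lparr>carrier := H (Suc k)\<rparr>"
    using series unfolding subnormal_series_def by auto
  have "\<exists>B F. subgroup B G \<and> \<psi> ` B \<subseteq> H (n - k) \<and> confined F B" if "k \<le> n" for k
    using that
  proof (induction k)
    case 0
    have "\<psi> ` carrier G \<subseteq> H n" using \<psi> ser(2) unfolding hom_def by auto
    then show ?case using subgroup_self confined_carrier by auto
  next
    case (Suc k)
    then obtain B F where B: "subgroup B G" "\<psi> ` B \<subseteq> H (n - k)" "confined F B" by auto
    have k: "Suc (n - Suc k) = n - k" "n - Suc k < n" using Suc.prems by auto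
    show ?case
    proof (rule confined_factor[OF \<psi> L _ _ _ B(1) _ B(3) rf])
      show "subgroup (H (Suc (n - Suc k))) L" using ser(3) k by auto
      show "H (n - Suc k) \<lhd> L\<lparr>carrier := H (Suc (n - Suc k))\<rparr>" using ser(4)[OF k(2)] .
      show "locally_virtually_abelian ((L\<lparr>carrier := H (Suc (n - Suc k))\<rparr>) Mod (H (n - Suc k)))"
        using lva[OF k(2)] .
      show "\<psi> ` B \<subseteq> H (Suc (n - Suc k))" using B(2) k(1) by simp
    qed
  qed
  from this[of n] obtain B F where B: "subgroup B G" "\<psi> ` B \<subseteq> {\<one>\<^bsub>L\<^esub>}" "confined F B"
    using ser(1) by auto
  have BG: "B \<subseteq> carrier G" using subgroup.subset[OF B(1)] .
  then have "B \<subseteq> {g \<in> carrier G. \<psi> g = \<one>\<^bsub>L\<^esub>}" using B(2) by auto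
  then have "finite B" using ker finite_subset by blast
  then show ?thesis using x_dies_of_confined_finite[OF B(3) _ BG subgroup.one_closed[OF B(1)]] by blast
qed

end

section \<open>Tiered systems\<close>

locale etds =
  fixes S :: "('t, 'g, 'x::metric_space) tds" and f :: "'x \<Rightarrow> 'x"
  assumes tds: "is_tds S" and evolution: "evolution S f" and stabilizing: "stabilizing S f"
    and gluing: "weakly_zero_gluing S" and dense: "weakly_dense_homoclinic S"
    and nilpotent: "asymptotically_nilpotent S f"
begin

abbreviation "z \<equiv> origin S"

lemma ambient: "compact (ambient S)" "x \<in> ambient S \<Longrightarrow> f x \<in> ambient S"
  using tds evolution unfolding is_tds_def evolution_def by auto

lemma ambient_fn: "x \<in> ambient S \<Longrightarrow> (f ^^ m) x \<in> ambient S"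
  by (induction m) (auto simp: ambient(2))

lemma fn_continuous: "continuous_on (ambient S) (f ^^ m)"
proof (induction m)
  case 0
  have "(f ^^ 0) = (\<lambda>x. x)" by auto
  then show ?case by simp
next
  case (Suc m)
  have "continuous_on (ambient S) f" using evolution unfolding evolution_def by auto
  then have "continuous_on (ambient S) (\<lambda>x. f ((f ^^ m) x))"
    by (rule continuous_on_compose2[OF _ Suc]) (use ambient_fn in auto)
  then show ?case by (simp add: comp_def)
qed

lemma directed: "directed_with_least (tiers S) (tle S) (base S)"
  using tds unfolding is_tds_def by (elim conjE)

lemma tle_refl: "t \<in> tiers S \<Longrightarrow> tle S t t"
  using directed unfolding directed_with_least_def by simp

lemma tle_trans:
  assumes "t \<in> tiers S" "t' \<in> tiers S" "t'' \<in> tiers S" "tle S t t'" "tle S t' t''"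
  shows "tle S t t''"
proof -
  have "\<forall>t\<in>tiers S. \<forall>t'\<in>tiers S. \<forall>t''\<in>tiers S. tle S t t' \<longrightarrow> tle S t' t'' \<longrightarrow> tle S t t''"
    using directed unfolding directed_with_least_def by (elim conjE)
  then show ?thesis using assms by meson
qed

lemma tle_directed:
  assumes "t \<in> tiers S" "t' \<in> tiers S"
  shows "\<exists>r\<in>tiers S. tle S t r \<and> tle S t' r"
proof -
  have "\<forall>t\<in>tiers S. \<forall>t'\<in>tiers S. \<exists>r\<in>tiers S. tle S t r \<and> tle S t' r"
    using directed unfolding directed_with_least_def by (elim conjE)
  then show ?thesis using assms by meson
qed

lemma base: "base S \<in> tiers S" "t \<in> tiers S \<Longrightarrow> tle S (base S) t"
proof -
  show "base S \<in> tiers S" using directed unfolding directed_with_least_def by (elim conjE)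
  have "\<forall>t\<in>tiers S. tle S (base S) t" using directed unfolding directed_with_least_def by (elim conjE)
  then show "t \<in> tiers S \<Longrightarrow> tle S (base S) t" by (rule bspec)
qed

lemma tier:
  assumes "t \<in> tiers S"
  shows "tier S t \<subseteq> ambient S" "compact (tier S t)" "group_action (grp S t) (tier S t) (act S t)"
    "g \<in> carrier (grp S t) \<Longrightarrow> continuous_on (tier S t) (act S t g)"
    "z \<in> tier S t" "g \<in> carrier (grp S t) \<Longrightarrow> act S t g z = z" "expansive (grp S t) (tier S t) (act S t)"
proof -
  have "\<forall>t\<in>tiers S. tier S t \<subseteq> ambient S \<and> pointed_system (grp S t) (tier S t) (act S t) z \<and>
      expansive (grp S t) (tier S t) (act S t)"
    using tds unfolding is_tds_def by (elim conjE)
  then have *: "tier S t \<subseteq> ambient S" "pointed_system (grp S t) (tier S t) (act S t) z"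
    "expansive (grp S t) (tier S t) (act S t)" using assms by simp_all
  then show "tier S t \<subseteq> ambient S" "expansive (grp S t) (tier S t) (act S t)" by simp_all
  show "compact (tier S t)" "group_action (grp S t) (tier S t) (act S t)"
    "g \<in> carrier (grp S t) \<Longrightarrow> continuous_on (tier S t) (act S t g)"
    "z \<in> tier S t" "g \<in> carrier (grp S t) \<Longrightarrow> act S t g z = z"
    using *(2) unfolding pointed_system_def by simp_all
qed

lemma tier_group: "t \<in> tiers S \<Longrightarrow> group (grp S t)"
  using tier(3) group_action.group_hom group_hom.axioms(1) by blast

lemma tier_act_in: "t \<in> tiers S \<Longrightarrow> g \<in> carrier (grp S t) \<Longrightarrow> x \<in> tier S t \<Longrightarrow> act S t g x \<in> tier S t"
  using group_action.element_image[OF tier(3)] by blast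

lemma conn:
  assumes "t \<in> tiers S" "t' \<in> tiers S" "tle S t t'"
  shows "tier S t \<subseteq> tier S t'" "conn S t t' \<in> hom (grp S t') (grp S t)"
    "conn S t t' ` carrier (grp S t') = carrier (grp S t)"
    "h \<in> carrier (grp S t) \<Longrightarrow> finite {g \<in> carrier (grp S t'). conn S t t' g = h}"
    "g \<in> carrier (grp S t') \<Longrightarrow> x \<in> tier S t \<Longrightarrow> act S t (conn S t t' g) x = act S t' g x"
    "g \<in> carrier (grp S t') \<Longrightarrow> conn S t t' g \<in> carrier (grp S t)"
proof -
  have "\<forall>t\<in>tiers S. \<forall>t'\<in>tiers S. tle S t t' \<longrightarrow>
        tier S t \<subseteq> tier S t' \<and>
        conn S t t' \<in> hom (grp S t') (grp S t) \<and>
        conn S t t' ` carrier (grp S t') = carrier (grp S t) \<and>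
        (\<forall>h\<in>carrier (grp S t). finite {g \<in> carrier (grp S t'). conn S t t' g = h}) \<and>
        (\<forall>g\<in>carrier (grp S t'). \<forall>x\<in>tier S t. act S t (conn S t t' g) x = act S t' g x)"
    using tds unfolding is_tds_def by (elim conjE)
  note * = this[rule_format, OF assms]
  show "tier S t \<subseteq> tier S t'" "conn S t t' \<in> hom (grp S t') (grp S t)"
    "conn S t t' ` carrier (grp S t') = carrier (grp S t)"
    "h \<in> carrier (grp S t) \<Longrightarrow> finite {g \<in> carrier (grp S t'). conn S t t' g = h}"
    "g \<in> carrier (grp S t') \<Longrightarrow> x \<in> tier S t \<Longrightarrow> act S t (conn S t t' g) x = act S t' g x"
    using * by simp_all
  then show "g \<in> carrier (grp S t') \<Longrightarrow> conn S t t' g \<in> carrier (grp S t)" by auto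
qed

lemma conn_finite:
  assumes "t \<in> tiers S" "t' \<in> tiers S" "tle S t t'" "finite E" "E \<subseteq> carrier (grp S t)"
  shows "finite {g \<in> carrier (grp S t'). conn S t t' g \<in> E}"
proof -
  have "{g \<in> carrier (grp S t'). conn S t t' g \<in> E} = (\<Union>h\<in>E. {g \<in> carrier (grp S t'). conn S t t' g = h})"
    by auto
  then show ?thesis using conn(4)[OF assms(1-3)] assms(4,5) by auto
qed

lemma tier_act_in_lower:
  assumes "t \<in> tiers S" "t' \<in> tiers S" "tle S t t'" "g \<in> carrier (grp S t')" "x \<in> tier S t"
  shows "act S t' g x \<in> tier S t"
  using conn(5,6)[OF assms(1-3)] tier_act_in[OF assms(1)] assms(4,5) by metis

lemma tier_fn_act:
  assumes \<tau>: "\<tau> \<in> tiers S" and g: "g \<in> carrier (grp S \<tau>)" and y: "\<And>m. (f ^^ m) y \<in> tier S \<tau>"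
  shows "(f ^^ m) (act S \<tau> g y) = act S \<tau> g ((f ^^ m) y)"
proof (induction m)
  case (Suc m)
  have "\<forall>t\<in>tiers S. \<forall>g\<in>carrier (grp S t). conn S t t g = g"
    using tds unfolding is_tds_def by (elim conjE)
  then have id: "conn S \<tau> \<tau> g = g" using \<tau> g by simp
  have "f ((f ^^ m) y) \<in> tier S \<tau>" using y[of "Suc m"] by simp
  then have "f (act S \<tau> (conn S \<tau> \<tau> g) ((f ^^ m) y)) = act S \<tau> g (f ((f ^^ m) y))"
    using evolution \<tau> g y[of m] tle_refl[OF \<tau>] unfolding evolution_def by simp
  then show ?case using Suc id by simp
qed simp

text \<open>An evolution commutes with the group of a tier only at points of the tier whose image is again in
  this tier.\<close>

definition orbits_in :: "'t \<Rightarrow> 'x set" where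
  "orbits_in \<tau> = {y \<in> tier S \<tau>. \<forall>m. (f ^^ m) y \<in> tier S \<tau>}"

lemma nil_system_tier:
  assumes \<tau>: "\<tau> \<in> tiers S"
  shows "\<exists>\<Delta>. nil_system (grp S \<tau>) (orbits_in \<tau>) (act S \<tau>) z f \<Delta>"
proof -
  obtain \<Delta> where \<Delta>: "0 < \<Delta>" "\<forall>x\<in>tier S \<tau>. \<forall>y\<in>tier S \<tau>.
      (\<forall>g\<in>carrier (grp S \<tau>). dist (act S \<tau> g x) (act S \<tau> g y) \<le> \<Delta>) \<longrightarrow> x = y"
    using tier(7)[OF \<tau>] unfolding expansive_def by blast
  note sub = tier(1)[OF \<tau>]
  have "(\<lambda>n. (f ^^ n) z) \<longlonglongrightarrow> z" "z \<in> ambient S" "continuous_on (ambient S) f"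
    using nilpotent evolution sub tier(5)[OF \<tau>] unfolding asymptotically_nilpotent_def evolution_def by blast+
  then have fz: "f z = z" using fixed_point_of_limit[of "ambient S" f z] ambient(2) by blast
  have fnz: "(f ^^ m) z = z" for m by (induction m) (auto simp: fz)
  have comp: "compact (orbits_in \<tau>)"
  proof -
    have cl: "closed (tier S \<tau>)" using tier(2)[OF \<tau>] by (rule compact_imp_closed)
    have "closed (tier S \<tau> \<inter> (f ^^ m) -` tier S \<tau>)" for m
      by (rule continuous_on_closed_vimage[THEN iffD1, rule_format, OF cl _ cl, unfolded Int_commute[of "_ -` _"]])
        (rule continuous_on_subset[OF fn_continuous sub])
    then have "closed (\<Inter>m. tier S \<tau> \<inter> (f ^^ m) -` tier S \<tau>)" by blast
    then have "compact (tier S \<tau> \<inter> (\<Inter>m. tier S \<tau> \<inter> (f ^^ m) -` tier S \<tau>))"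
      using tier(2)[OF \<tau>] by (rule compact_Int_closed[rotated])
    moreover have "orbits_in \<tau> = tier S \<tau> \<inter> (\<Inter>m. tier S \<tau> \<inter> (f ^^ m) -` tier S \<tau>)"
      unfolding orbits_in_def by auto
    ultimately show ?thesis by simp
  qed
  interpret grp: group "grp S \<tau>" by (rule tier_group[OF \<tau>])
  interpret ga: group_action "grp S \<tau>" "tier S \<tau>" "act S \<tau>" by (rule tier(3)[OF \<tau>])
  have inT: "y \<in> tier S \<tau>" "(f ^^ m) y \<in> tier S \<tau>" if "y \<in> orbits_in \<tau>" for y m
    using that unfolding orbits_in_def by auto
  have "nil_system (grp S \<tau>) (orbits_in \<tau>) (act S \<tau>) z f \<Delta>"
  proof (intro nil_system.intro grp.group_axioms nil_system_axioms.intro comp)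
    show "z \<in> orbits_in \<tau>" unfolding orbits_in_def using fnz tier(5)[OF \<tau>] by simp
    show "act S \<tau> g y \<in> orbits_in \<tau>" if "g \<in> carrier (grp S \<tau>)" "y \<in> orbits_in \<tau>" for g y
    proof -
      have "(f ^^ m) (act S \<tau> g y) \<in> tier S \<tau>" for m
        using tier_fn_act[OF \<tau> that(1) inT(2)[OF that(2)]] tier_act_in[OF \<tau> that(1) inT(2)[OF that(2)]] by metis
      then show ?thesis unfolding orbits_in_def using tier_act_in[OF \<tau> that(1) inT(1)[OF that(2)]] by simp
    qed
    show "act S \<tau> (g \<otimes>\<^bsub>grp S \<tau>\<^esub> h) y = act S \<tau> g (act S \<tau> h y)"
      if "g \<in> carrier (grp S \<tau>)" "h \<in> carrier (grp S \<tau>)" "y \<in> orbits_in \<tau>" for g h y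
      using ga.composition_rule[OF inT(1)[OF that(3)] that(1,2)] .
    show "act S \<tau> \<one>\<^bsub>grp S \<tau>\<^esub> y = y" if "y \<in> orbits_in \<tau>" for y
      using ga.id_eq_one inT(1)[OF that] by (metis restrict_apply')
    show "continuous_on (orbits_in \<tau>) (act S \<tau> g)" if "g \<in> carrier (grp S \<tau>)" for g
      using tier(4)[OF \<tau> that] by (rule continuous_on_subset) (auto simp: orbits_in_def)
    show "act S \<tau> g z = z" if "g \<in> carrier (grp S \<tau>)" for g using tier(6)[OF \<tau> that] .
    show "f y \<in> orbits_in \<tau>" if "y \<in> orbits_in \<tau>" for y
    proof -
      have "(f ^^ m) (f y) \<in> tier S \<tau>" for m using inT(2)[OF that, of "Suc m"] by (simp add: funpow_swap1)
      then show ?thesis unfolding orbits_in_def using inT(2)[OF that, of 1] by simp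
    qed
    have "continuous_on (ambient S) f" using evolution unfolding evolution_def by auto
    then show "continuous_on (orbits_in \<tau>) f"
      by (rule continuous_on_subset) (use sub in \<open>auto simp: orbits_in_def\<close>)
    show "f (act S \<tau> g y) = act S \<tau> g (f y)" if "g \<in> carrier (grp S \<tau>)" "y \<in> orbits_in \<tau>" for g y
      using tier_fn_act[OF \<tau> that(1) inT(2)[OF that(2)], of 1] by simp
    show "(\<lambda>n. (f ^^ n) y) \<longlonglongrightarrow> z" if "y \<in> orbits_in \<tau>" for y
      using nilpotent inT(1)[OF that] sub unfolding asymptotically_nilpotent_def by blast
    show "0 < \<Delta>" by (rule \<Delta>(1))
    show "x = y" if "x \<in> orbits_in \<tau>" "y \<in> orbits_in \<tau>"
      "\<And>g. g \<in> carrier (grp S \<tau>) \<Longrightarrow> dist (act S \<tau> g x) (act S \<tau> g y) \<le> \<Delta>" for x y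
      using \<Delta>(2) inT(1) that by blast
  qed
  then show ?thesis by blast
qed

definition glues_to :: "'t \<Rightarrow> 't \<Rightarrow> bool" where
  "glues_to t w \<longleftrightarrow> t \<in> tiers S \<and> w \<in> tiers S \<and> tle S t w \<and>
    (\<forall>\<epsilon>>0. \<exists>\<delta>>0. \<exists>E. finite E \<and> E \<subseteq> carrier (grp S w) \<and>
       (\<forall>(I :: 'g set set) A x.
          de_designation (grp S w) (tier S w) (act S w) z \<delta> E I A x \<and> (\<forall>i\<in>I. x i \<in> tier S t) \<longrightarrow>
          (\<exists>y. realization (tier S w) (act S w) \<epsilon> I A x y)))"

lemma glues_to_exists: "t \<in> tiers S \<Longrightarrow> \<exists>w. glues_to t w"
proof -
  assume t: "t \<in> tiers S"
  from gluing[unfolded weakly_zero_gluing_def, THEN bspec, OF t]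
  obtain w where w: "w \<in> tiers S" "tle S t w" and gl: "\<forall>\<epsilon>>0. \<exists>\<delta>>0. \<exists>E. finite E \<and> E \<subseteq> carrier (grp S w) \<and>
       (\<forall>(I :: 'g set set) A x.
          de_designation (grp S w) (tier S w) (act S w) z \<delta> E I A x \<and> (\<forall>i\<in>I. x i \<in> tier S t) \<longrightarrow>
          (\<exists>y. realization (tier S w) (act S w) \<epsilon> I A x y))"
    by (elim bexE conjE)
  have "glues_to t w" unfolding glues_to_def by (intro conjI t w gl)
  then show ?thesis by (rule exI)
qed

text \<open>Gluing at level \<open>w\<close>, seen at a higher level \<open>\<tau>\<close>: the cells are made invariant under the finite kernel
  of the connecting map, so that they descend to a designation of the group at level \<open>w\<close>.\<close>

lemma glue_at:
  assumes gl: "glues_to t w" and \<tau>: "\<tau> \<in> tiers S" "tle S w \<tau>"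
    and stay: "\<And>m. (f ^^ m) ` tier S w \<subseteq> tier S \<tau>"
    and sys: "nil_system (grp S \<tau>) (orbits_in \<tau>) (act S \<tau>) z f \<Delta>" and \<epsilon>: "0 < \<epsilon>"
  shows "\<exists>\<delta>>0. \<exists>K. \<delta> \<le> \<epsilon> \<and> finite K \<and> K \<subseteq> carrier (grp S \<tau>) \<and> \<one>\<^bsub>grp S \<tau>\<^esub> \<in> K \<and>
    (\<forall>P\<subseteq>tier S t. nil_system.separated (grp S \<tau>) (act S \<tau>) z \<delta> K P \<longrightarrow>
       (\<exists>y\<in>tier S w. nil_system.glued (grp S \<tau>) (orbits_in \<tau>) (act S \<tau>) z \<epsilon> \<delta> K P y))"
proof -
  interpret nil_system "grp S \<tau>" "orbits_in \<tau>" "act S \<tau>" z f \<Delta> by (rule sys)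
  define W where "W = grp S w"
  define \<phi> where "\<phi> = conn S w \<tau>"
  have t: "t \<in> tiers S" and w: "w \<in> tiers S" and tw: "tle S t w"
    using gl unfolding glues_to_def by - (elim conjE, assumption)+
  interpret W: group W unfolding W_def by (rule tier_group[OF w])
  note c = conn[OF w \<tau>, folded \<phi>_def]
  have \<phi>: "\<phi> g \<in> carrier W" "act S w (\<phi> g) x = act S \<tau> g x"
    if "g \<in> carrier (grp S \<tau>)" "x \<in> tier S w" for g x
    using c that unfolding W_def by auto
  have \<phi>_mult: "\<phi> (g \<otimes>\<^bsub>grp S \<tau>\<^esub> h) = \<phi> g \<otimes>\<^bsub>W\<^esub> \<phi> h" if "g \<in> carrier (grp S \<tau>)" "h \<in> carrier (grp S \<tau>)" for g h
    using c(2) that unfolding hom_def W_def by auto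
  have \<phi>_one: "\<phi> \<one>\<^bsub>grp S \<tau>\<^esub> = \<one>\<^bsub>W\<^esub>"
    using hom_one[OF c(2) is_group] W.is_group unfolding W_def by simp
  have "\<forall>\<epsilon>>0. \<exists>\<delta>>0. \<exists>E. finite E \<and> E \<subseteq> carrier (grp S w) \<and>
       (\<forall>(I :: 'g set set) A x.
          de_designation (grp S w) (tier S w) (act S w) z \<delta> E I A x \<and> (\<forall>i\<in>I. x i \<in> tier S t) \<longrightarrow>
          (\<exists>y. realization (tier S w) (act S w) \<epsilon> I A x y))"
    using gl unfolding glues_to_def by (elim conjE)
  from this[THEN spec, THEN mp, OF \<epsilon>] obtain \<delta>0 E0 where \<delta>0: "0 < \<delta>0" and E0: "finite E0" "E0 \<subseteq> carrier W"
    and real: "\<forall>(I :: 'g set set) A x. de_designation W (tier S w) (act S w) z \<delta>0 E0 I A x \<and>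
        (\<forall>i\<in>I. x i \<in> tier S t) \<longrightarrow> (\<exists>y. realization (tier S w) (act S w) \<epsilon> I A x y)"
    unfolding W_def by (elim exE conjE)
  define \<delta> where "\<delta> = min \<delta>0 \<epsilon>"
  define E where "E = insert \<one>\<^bsub>W\<^esub> E0"
  have E: "finite E" "E \<subseteq> carrier W" using E0 unfolding E_def by auto
  define K where "K = {g \<in> carrier (grp S \<tau>). \<phi> g \<in> E}"
  have K: "finite K" "K \<subseteq> carrier (grp S \<tau>)" "\<one>\<^bsub>grp S \<tau>\<^esub> \<in> K"
    using conn_finite[OF w \<tau> E(1)] E(2) \<phi>_one unfolding K_def \<phi>_def[symmetric] W_def E_def by auto
  have tsub: "tier S t \<subseteq> tier S w" using conn(1)[OF t w tw] .
  have orb: "tier S w \<subseteq> orbits_in \<tau>" unfolding orbits_in_def using stay c(1) by blast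
  have main: "\<exists>y\<in>tier S w. glued \<epsilon> \<delta> K P y" if P: "P \<subseteq> tier S t" and sep: "separated \<delta> K P" for P
  proof -
    define spw where "spw p = {g \<in> carrier W. \<delta> \<le> dist (act S w g p) z}" for p
    define cw where "cw p = E <#>\<^bsub>W\<^esub> spw p" for p
    have Pw: "p \<in> tier S w" if "p \<in> P" for p using that P tsub by blast
    have cwG: "cw p \<subseteq> carrier W" for p
      unfolding cw_def by (rule W.set_mult_closed[OF E(2)]) (auto simp: spw_def)
    have cell_iff: "\<phi> a \<in> cw p \<longleftrightarrow> a \<in> cell \<delta> K p" if p: "p \<in> P" and a: "a \<in> carrier (grp S \<tau>)" for a p
    proof
      assume "\<phi> a \<in> cw p"
      then obtain e s where es: "e \<in> E" "s \<in> spw p" "\<phi> a = e \<otimes>\<^bsub>W\<^esub> s" unfolding cw_def set_mult_def by auto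
      then have "e \<in> \<phi> ` carrier (grp S \<tau>)" using c(3) E(2) unfolding W_def by blast
      then obtain k where k: "k \<in> carrier (grp S \<tau>)" "\<phi> k = e" by blast
      have kK: "k \<in> K" unfolding K_def using k es by simp
      define g where "g = inv\<^bsub>grp S \<tau>\<^esub> k \<otimes>\<^bsub>grp S \<tau>\<^esub> a"
      have gG: "g \<in> carrier (grp S \<tau>)" unfolding g_def using k a by simp
      have akg: "a = k \<otimes>\<^bsub>grp S \<tau>\<^esub> g" unfolding g_def using k a by (simp add: m_assoc[symmetric])
      have sG: "s \<in> carrier W" "e \<in> carrier W" using es E(2) unfolding spw_def by auto
      have "e \<otimes>\<^bsub>W\<^esub> \<phi> g = e \<otimes>\<^bsub>W\<^esub> s" using \<phi>_mult[OF k(1) gG] akg k(2) es(3) by simp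
      then have "\<phi> g = s" using sG \<phi>(1)[OF gG Pw[OF p]] by simp
      then have "\<delta> \<le> dist (act S \<tau> g p) z" using es(2) \<phi>(2)[OF gG Pw[OF p]] unfolding spw_def by simp
      then have "g \<in> spt \<delta> p" using gG unfolding spt_def by simp
      then show "a \<in> cell \<delta> K p" unfolding cell_def akg using kK by (intro set_multI)
    next
      assume "a \<in> cell \<delta> K p"
      then obtain k g where kg: "k \<in> K" "g \<in> spt \<delta> p" "a = k \<otimes>\<^bsub>grp S \<tau>\<^esub> g"
        unfolding cell_def by (rule set_multE)
      have G: "k \<in> carrier (grp S \<tau>)" "g \<in> carrier (grp S \<tau>)" using kg K spt_subset by auto
      have "\<phi> g \<in> spw p" unfolding spw_def using kg(2) \<phi>[OF G(2) Pw[OF p]] unfolding spt_def by simp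
      moreover have "\<phi> k \<in> E" using kg(1) unfolding K_def by simp
      ultimately show "\<phi> a \<in> cw p" unfolding cw_def kg(3) \<phi>_mult[OF G] by (intro W.set_multI)
    qed
    have cw_disj: "p = q" if pq: "p \<in> P" "q \<in> P" "h \<in> cw p" "h \<in> cw q" for p q h
    proof -
      have "h \<in> \<phi> ` carrier (grp S \<tau>)" using c(3) cwG pq(3) unfolding W_def by blast
      then obtain a where "a \<in> carrier (grp S \<tau>)" "h = \<phi> a" by blast
      then have "a \<in> cell \<delta> K p" "a \<in> cell \<delta> K q" using cell_iff pq by auto
      then show ?thesis using sep pq(1,2) unfolding separated_def by blast
    qed
    define R where "R = carrier W - (\<Union>p\<in>P. cw p)"
    define I0 where "I0 = {cw p | p. p \<in> P \<and> cw p \<noteq> {}}"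
    define pk where "pk i = (if i \<in> I0 then SOME p. p \<in> P \<and> cw p = i else z)" for i
    have pk: "pk (cw p) = p" if p: "p \<in> P" "cw p \<noteq> {}" for p
    proof -
      have "cw p \<in> I0" unfolding I0_def using p by blast
      moreover have "(SOME q. q \<in> P \<and> cw q = cw p) = p"
        by (rule some_equality) (use p cw_disj in blast)+
      ultimately show ?thesis unfolding pk_def by simp
    qed
    have R_not: "R \<notin> I0" unfolding I0_def R_def by blast
    have pkR: "pk R = z" unfolding pk_def using R_not by simp
    define I where "I = insert R I0"
    have pk_in: "pk i \<in> tier S t" if iI: "i \<in> I" for i
    proof (cases "i = R")
      case True then show ?thesis using pkR tier(5)[OF t] by simp
    next
      case False
      then obtain p where "p \<in> P" "i = cw p" "cw p \<noteq> {}" using iI unfolding I_def I0_def by blast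
      then show ?thesis using pk P by auto
    qed
    have des: "de_designation W (tier S w) (act S w) z \<delta>0 E0 I id pk"
      unfolding de_designation_def designation_def
    proof (intro conjI ballI)
      show "disjoint_family_on id I"
        unfolding disjoint_family_on_def I_def I0_def R_def using cw_disj by auto
      have "(\<Union>i\<in>I0. id i) = (\<Union>p\<in>P. cw p)" unfolding I0_def by auto
      then show "(\<Union>i\<in>I. id i) = carrier W" unfolding I_def R_def using cwG by auto
      show "pk i \<in> tier S w" if "i \<in> I" for i using pk_in[OF that] tsub by blast
      fix i g assume i: "i \<in> I" and g: "g \<in> boundary W E0 (id i)"
      have gG: "g \<in> i" "\<not> E0 #>\<^bsub>W\<^esub> g \<subseteq> i" using g unfolding boundary_def by auto
      show "dist (act S w g (pk i)) z < \<delta>0"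
      proof (cases "i = R")
        case True
        then have "g \<in> carrier (grp S w)" using gG(1) unfolding R_def W_def by auto
        then show ?thesis using True pkR tier(6)[OF w] \<delta>0 by simp
      next
        case False
        then obtain p where p: "p \<in> P" "i = cw p" "cw p \<noteq> {}" using i unfolding I_def I0_def by blast
        show ?thesis
        proof (rule ccontr)
          assume "\<not> ?thesis"
          then have "\<delta> \<le> dist (act S w g p) z" using pk[OF p(1,3)] p(2) unfolding \<delta>_def by auto
          then have "g \<in> spw p" unfolding spw_def using gG(1) p(2) cwG by auto
          then have "E0 #>\<^bsub>W\<^esub> g \<subseteq> cw p" unfolding cw_def E_def r_coset_def set_mult_def by auto
          then show False using gG(2) p(2) by simp
        qed
      qed
    qed
    have "\<exists>y. realization (tier S w) (act S w) \<epsilon> I id pk y"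
      by (rule real[THEN spec, THEN spec, THEN spec, THEN mp]) (use des pk_in in blast)
    then obtain y where y: "y \<in> tier S w" "\<And>i g. i \<in> I \<Longrightarrow> g \<in> i \<Longrightarrow> dist (act S w g y) (act S w g (pk i)) < \<epsilon>"
      unfolding realization_def by auto
    have "glued \<epsilon> \<delta> K P y" unfolding glued_def
    proof (intro conjI ballI impI)
      show "y \<in> orbits_in \<tau>" using y(1) orb by blast
    next
      fix p g assume p: "p \<in> P" and g: "g \<in> cell \<delta> K p"
      have gG: "g \<in> carrier (grp S \<tau>)" using g cell_subset[OF K(2)] by blast
      have in_cw: "\<phi> g \<in> cw p" using cell_iff[OF p gG] g by simp
      then have ne: "cw p \<noteq> {}" by blast
      then have "cw p \<in> I" unfolding I_def I0_def using p by blast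
      then have "dist (act S w (\<phi> g) y) (act S w (\<phi> g) p) < \<epsilon>"
        using y(2)[of "cw p" "\<phi> g"] in_cw pk[OF p ne] by simp
      then show "dist (act S \<tau> g y) (act S \<tau> g p) \<le> \<epsilon>"
        using \<phi>(2)[OF gG y(1)] \<phi>(2)[OF gG Pw[OF p]] by simp
    next
      fix g assume gG: "g \<in> carrier (grp S \<tau>)" and "\<forall>p\<in>P. g \<notin> cell \<delta> K p"
      then have "\<phi> g \<in> R" unfolding R_def using cell_iff \<phi>(1)[OF gG y(1)] by blast
      then have "dist (act S w (\<phi> g) y) (act S w (\<phi> g) (pk R)) < \<epsilon>" using y(2) unfolding I_def by blast
      then show "dist (act S \<tau> g y) z \<le> \<epsilon>"
        using pkR \<phi>(2)[OF gG y(1)] tier(6)[OF w] \<phi>(1)[OF gG y(1)] unfolding W_def by simp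
    qed
    then show ?thesis using y(1) by blast
  qed
  have "0 < \<delta>" "\<delta> \<le> \<epsilon>" unfolding \<delta>_def using \<delta>0 \<epsilon> by auto
  then show ?thesis using K main by blast
qed

end

context etds begin

lemma stabilize:
  assumes "t \<in> tiers S"
  obtains s where "s \<in> tiers S" "tle S t s" "\<And>m. (f ^^ m) ` tier S t \<subseteq> tier S s"
proof -
  from stabilizing[unfolded stabilizing_def, THEN bspec, OF assms]
  obtain s where "s \<in> tiers S" "tle S t s" "\<forall>m. (f ^^ m) ` tier S t \<subseteq> tier S s" by (elim bexE conjE)
  then show thesis using that by blast
qed

lemma orbits_inI: "\<tau> \<in> tiers S \<Longrightarrow> x \<in> tier S w \<Longrightarrow> (\<And>m. (f ^^ m) ` tier S w \<subseteq> tier S \<tau>) \<Longrightarrow> x \<in> orbits_in \<tau>"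
proof -
  assume "x \<in> tier S w" and sub: "\<And>m. (f ^^ m) ` tier S w \<subseteq> tier S \<tau>"
  then have "(f ^^ m) x \<in> tier S \<tau>" for m by blast
  then show ?thesis unfolding orbits_in_def using \<open>(f ^^ _) x \<in> tier S \<tau>\<close>[of 0] by simp
qed

text \<open>Homoclinicity passes to higher tiers, as the connecting maps are finite-to-one.\<close>

lemma homoclinic_spt:
  assumes t: "t \<in> tiers S" and \<tau>: "\<tau> \<in> tiers S" "tle S t \<tau>" and \<delta>: "0 < \<delta>"
    and hom: "homoclinic (grp S t) (tier S t) (act S t) z x"
  shows "finite {g \<in> carrier (grp S \<tau>). \<delta> \<le> dist (act S \<tau> g x) z}"
proof -
  have x: "x \<in> tier S t" using hom unfolding homoclinic_def by simp
  obtain E where E: "finite E" "E \<subseteq> carrier (grp S t)"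
    "\<forall>g\<in>carrier (grp S t) - E. dist (act S t g x) z < \<delta>"
    using hom \<delta> unfolding homoclinic_def by blast
  have "{g \<in> carrier (grp S \<tau>). \<delta> \<le> dist (act S \<tau> g x) z} \<subseteq> {g \<in> carrier (grp S \<tau>). conn S t \<tau> g \<in> E}"
  proof
    fix g assume g: "g \<in> {g \<in> carrier (grp S \<tau>). \<delta> \<le> dist (act S \<tau> g x) z}"
    then have gG: "g \<in> carrier (grp S \<tau>)" by simp
    have "conn S t \<tau> g \<in> carrier (grp S t)" by (rule conn(6)[OF t \<tau> gG])
    moreover have "\<not> dist (act S t (conn S t \<tau> g) x) z < \<delta>" using g conn(5)[OF t \<tau> gG x] by simp
    ultimately show "g \<in> {g \<in> carrier (grp S \<tau>). conn S t \<tau> g \<in> E}" using E(3) gG by blast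
  qed
  then show ?thesis using conn_finite[OF t \<tau> E(1,2)] finite_subset by blast
qed

text \<open>Every homoclinic point dies. Two gluings are nested: sums of translates, and sums of images of these.
  Hence it suffices to climb a fixed number of levels in the directed set.\<close>

lemma homoclinic_dies:
  fixes L :: "('l, 'k) monoid_scheme"
  assumes t: "t \<in> tiers S" and hom: "homoclinic (grp S t) (tier S t) (act S t) z x"
    and rf: "\<And>t. t \<in> tiers S \<Longrightarrow> residually_finite (grp S t)"
    and L: "group L" "L \<cong> grp S (base S)" and series: "subnormal_series L n H"
    and lva: "\<And>k. k < n \<Longrightarrow> locally_virtually_abelian ((L\<lparr>carrier := H (Suc k)\<rparr>) Mod (H k))"
  shows "\<exists>T. (f ^^ T) x = z"
proof -
  obtain w where gl1: "glues_to t w" using glues_to_exists[OF t] by (rule exE)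
  then have w: "w \<in> tiers S" "tle S t w" unfolding glues_to_def by - (elim conjE, assumption)+
  obtain s where s: "s \<in> tiers S" "tle S w s" "\<And>m. (f ^^ m) ` tier S w \<subseteq> tier S s"
    using stabilize[OF w(1)] by blast
  obtain v where gl2: "glues_to s v" using glues_to_exists[OF s(1)] by (rule exE)
  then have v: "v \<in> tiers S" "tle S s v" unfolding glues_to_def by - (elim conjE, assumption)+
  obtain \<tau> where \<tau>: "\<tau> \<in> tiers S" "tle S v \<tau>" "\<And>m. (f ^^ m) ` tier S v \<subseteq> tier S \<tau>"
    using stabilize[OF v(1)] by blast
  have s\<tau>: "tle S s \<tau>" by (rule tle_trans[OF s(1) v(1) \<tau>(1) v(2) \<tau>(2)])
  have w\<tau>: "tle S w \<tau>" by (rule tle_trans[OF w(1) s(1) \<tau>(1) s(2) s\<tau>])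
  have t\<tau>: "tle S t \<tau>" by (rule tle_trans[OF t w(1) \<tau>(1) w(2) w\<tau>])
  have stay1: "(f ^^ m) ` tier S w \<subseteq> tier S \<tau>" for m
    using s(3)[of m] conn(1)[OF s(1) \<tau>(1) s\<tau>] by blast
  obtain \<Delta> where sys: "nil_system (grp S \<tau>) (orbits_in \<tau>) (act S \<tau>) z f \<Delta>"
    using nil_system_tier[OF \<tau>(1)] by (rule exE)
  interpret nil_system "grp S \<tau>" "orbits_in \<tau>" "act S \<tau>" z f \<Delta> by (rule sys)
  have "0 < \<Delta>/16" using \<Delta>_pos by simp
  from glue_at[OF gl1 \<tau>(1) w\<tau> stay1 sys this]
  obtain \<delta> K where \<delta>: "0 < \<delta>" "\<delta> \<le> \<Delta>/16" and K: "finite K" "K \<subseteq> carrier (grp S \<tau>)" "\<one>\<^bsub>grp S \<tau>\<^esub> \<in> K"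
    and glue: "\<forall>P\<subseteq>tier S t. separated \<delta> K P \<longrightarrow> (\<exists>y\<in>tier S w. glued (\<Delta>/16) \<delta> K P y)"
    by (elim exE conjE)
  have xt: "x \<in> tier S t" using hom unfolding homoclinic_def by simp
  have xw: "x \<in> tier S w" using xt conn(1)[OF t w] by blast
  interpret nil_sums "grp S \<tau>" "orbits_in \<tau>" "act S \<tau>" z f \<Delta> x \<delta> K "tier S s"
  proof (intro nil_sums.intro sys nil_sums_axioms.intro)
    show "x \<in> orbits_in \<tau>" by (rule orbits_inI[OF \<tau>(1) xw stay1])
    show "0 < \<delta>" "\<delta> \<le> \<Delta>/16" "finite K" "K \<subseteq> carrier (grp S \<tau>)" "\<one>\<^bsub>grp S \<tau>\<^esub> \<in> K" by (fact \<delta> K)+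
    show "finite (spt \<delta> x)" unfolding spt_def by (rule homoclinic_spt[OF t \<tau>(1) t\<tau> \<delta>(1) hom])
    show "tier S s \<subseteq> orbits_in \<tau>"
    proof
      fix y assume "y \<in> tier S s"
      then have "y \<in> tier S v" using conn(1)[OF s(1) v] by blast
      then show "y \<in> orbits_in \<tau>" by (rule orbits_inI[OF \<tau>(1) _ \<tau>(3)])
    qed
    show "\<exists>y. glued (\<Delta>/16) \<delta> K ((\<lambda>s. act S \<tau> (inv\<^bsub>grp S \<tau>\<^esub> s) x) ` A) y \<and> (\<forall>m. (f ^^ m) y \<in> tier S s)"
      if A: "A \<subseteq> carrier (grp S \<tau>)" "separated \<delta> K ((\<lambda>s. act S \<tau> (inv\<^bsub>grp S \<tau>\<^esub> s) x) ` A)" for A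
    proof -
      have "(\<lambda>s. act S \<tau> (inv\<^bsub>grp S \<tau>\<^esub> s) x) ` A \<subseteq> tier S t"
        using tier_act_in_lower[OF t \<tau>(1) t\<tau> _ xt] A(1) by auto
      then have "\<exists>y\<in>tier S w. glued (\<Delta>/16) \<delta> K ((\<lambda>s. act S \<tau> (inv\<^bsub>grp S \<tau>\<^esub> s) x) ` A) y"
        using glue A(2) by simp
      then obtain y where y: "y \<in> tier S w"
        "glued (\<Delta>/16) \<delta> K ((\<lambda>s. act S \<tau> (inv\<^bsub>grp S \<tau>\<^esub> s) x) ` A) y" by (rule bexE)
      have "(f ^^ m) y \<in> tier S s" for m using s(3)[of m] y(1) by (rule subsetD[OF _ imageI])
      then show ?thesis using y(2) by blast
    qed
    show "glues (tier S s)" unfolding glues_def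
    proof (intro allI impI)
      fix \<epsilon> :: real assume \<epsilon>: "0 < \<epsilon>"
      from glue_at[OF gl2 \<tau>(1,2) \<tau>(3) sys \<epsilon>]
      show "\<exists>\<delta>>0. \<exists>K. \<delta> \<le> \<epsilon> \<and> finite K \<and> K \<subseteq> carrier (grp S \<tau>) \<and> \<one>\<^bsub>grp S \<tau>\<^esub> \<in> K \<and>
          (\<forall>P\<subseteq>tier S s. separated \<delta> K P \<longrightarrow> (\<exists>y. glued \<epsilon> \<delta> K P y))"
        by (elim ex_forward conj_forward all_forward imp_forward) blast+
    qed
  qed
  interpret bg: group "grp S (base S)" by (rule tier_group[OF base(1)])
  note b\<tau> = base(2)[OF \<tau>(1)]
  obtain i where "i \<in> iso L (grp S (base S))" using L(2) unfolding is_iso_def by blast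
  then have "inv_into (carrier L) i \<in> iso (grp S (base S)) L" by (rule group.iso_set_sym[OF L(1)])
  then obtain j where j: "j \<in> hom (grp S (base S)) L" "inj_on j (carrier (grp S (base S)))"
    unfolding iso_iff by blast
  define \<psi> where "\<psi> = j \<circ> conn S (base S) \<tau>"
  have \<psi>: "\<psi> \<in> hom (grp S \<tau>) L"
    unfolding \<psi>_def using conn(2)[OF base(1) \<tau>(1) b\<tau>] j(1) by (rule Group.hom_compose)
  have j1: "j \<one>\<^bsub>grp S (base S)\<^esub> = \<one>\<^bsub>L\<^esub>" by (rule hom_one[OF j(1) bg.is_group L(1)])
  have "{g \<in> carrier (grp S \<tau>). \<psi> g = \<one>\<^bsub>L\<^esub>} \<subseteq>
      {g \<in> carrier (grp S \<tau>). conn S (base S) \<tau> g \<in> {\<one>\<^bsub>grp S (base S)\<^esub>}}"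
  proof
    fix g assume g: "g \<in> {g \<in> carrier (grp S \<tau>). \<psi> g = \<one>\<^bsub>L\<^esub>}"
    then have "conn S (base S) \<tau> g \<in> carrier (grp S (base S))" using conn(6)[OF base(1) \<tau>(1) b\<tau>] by simp
    moreover have "j (conn S (base S) \<tau> g) = j \<one>\<^bsub>grp S (base S)\<^esub>" using g j1 unfolding \<psi>_def by simp
    ultimately have "conn S (base S) \<tau> g = \<one>\<^bsub>grp S (base S)\<^esub>" using j(2) by (simp add: inj_on_eq_iff)
    then show "g \<in> {g \<in> carrier (grp S \<tau>). conn S (base S) \<tau> g \<in> {\<one>\<^bsub>grp S (base S)\<^esub>}}" using g by simp
  qed
  moreover have "finite {g \<in> carrier (grp S \<tau>). conn S (base S) \<tau> g \<in> {\<one>\<^bsub>grp S (base S)\<^esub>}}"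
    by (rule conn_finite[OF base(1) \<tau>(1) b\<tau>]) auto
  ultimately have ker: "finite {g \<in> carrier (grp S \<tau>). \<psi> g = \<one>\<^bsub>L\<^esub>}" using finite_subset by blast
  show ?thesis
    by (rule x_dies_of_series[OF \<psi> L(1) ker series _ rf[OF \<tau>(1)]]) (rule lva)
qed

text \<open>If homoclinic points die, then \<open>z\<close> is stable: by the Baire category theorem, all points near some
  homoclinic point \<open>w\<close> stay near \<open>z\<close> from a time on, and \<open>w\<close> can be glued to any point that is near \<open>z\<close>
  on a large finite set without changing its future. As every point comes near \<open>z\<close>, compactness makes
  the convergence uniform, and expansiveness turns this into nilpotency.\<close>

theorem nilpotent_of_homoclinic_dies:
  assumes t: "t \<in> tiers S"
    and dies: "\<And>t x. t \<in> tiers S \<Longrightarrow> homoclinic (grp S t) (tier S t) (act S t) z x \<Longrightarrow> \<exists>T. (f ^^ T) x = z"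
  shows "nilpotent_on S f (tier S t)"
proof -
  obtain \<sigma> where \<sigma>: "\<sigma> \<in> tiers S" "tle S t \<sigma>" "\<And>m. (f ^^ m) ` tier S t \<subseteq> tier S \<sigma>"
    using stabilize[OF t] by blast
  obtain \<eta> where \<eta>: "0 < \<eta>" "\<forall>x\<in>tier S \<sigma>. \<forall>y\<in>tier S \<sigma>.
      (\<forall>g\<in>carrier (grp S \<sigma>). dist (act S \<sigma> g x) (act S \<sigma> g y) \<le> \<eta>) \<longrightarrow> x = y"
    using tier(7)[OF \<sigma>(1)] unfolding expansive_def by blast
  define V where "V = closure (\<Union>(tier S ` tiers S))"
  have clA: "closed (ambient S)" using ambient(1) by (rule compact_imp_closed)
  have VA: "V \<subseteq> ambient S" unfolding V_def by (rule closure_minimal[OF _ clA]) (rule UN_least, rule tier(1))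
  have Vcl: "closed V" unfolding V_def by simp
  have tV: "tier S r \<subseteq> V" if "r \<in> tiers S" for r
  proof -
    have "tier S r \<subseteq> \<Union>(tier S ` tiers S)" using that by (rule UN_upper)
    also have "\<dots> \<subseteq> V" unfolding V_def by (rule closure_subset)
    finally show ?thesis .
  qed
  define Cn where "Cn n = {y \<in> V. \<forall>m\<ge>n. dist ((f ^^ m) y) z \<le> \<eta>/2}" for n
  have "closed (Cn n)" for n
  proof -
    have "closed (V \<inter> (f ^^ m) -` cball z (\<eta>/2))" for m
      by (rule continuous_closed_preimage[OF continuous_on_subset[OF fn_continuous VA] Vcl]) simp
    then have "closed (V \<inter> (\<Inter>m\<in>{n..}. V \<inter> (f ^^ m) -` cball z (\<eta>/2)))" using Vcl by blast
    moreover have "Cn n = V \<inter> (\<Inter>m\<in>{n..}. V \<inter> (f ^^ m) -` cball z (\<eta>/2))"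
      unfolding Cn_def by (auto simp: dist_commute)
    ultimately show ?thesis by simp
  qed
  then have Ccl: "closedin (top_of_set V) (Cn n)" for n
    by (rule closed_subset[rotated]) (auto simp: Cn_def)
  have CU: "(\<Union>n. Cn n) = V"
  proof
    show "(\<Union>n. Cn n) \<subseteq> V" unfolding Cn_def by auto
    show "V \<subseteq> (\<Union>n. Cn n)"
    proof
      fix y assume y: "y \<in> V"
      then have "(\<lambda>n. (f ^^ n) y) \<longlonglongrightarrow> z" using nilpotent VA unfolding asymptotically_nilpotent_def by blast
      moreover have "0 < \<eta>/2" using \<eta>(1) by simp
      ultimately obtain n where "\<forall>m\<ge>n. dist ((f ^^ m) y) z < \<eta>/2" unfolding lim_sequentially by blast
      then have "y \<in> Cn n" unfolding Cn_def using y by (auto intro: less_imp_le)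
      then show "y \<in> (\<Union>n. Cn n)" by blast
    qed
  qed
  have "\<exists>n. top_of_set V interior_of Cn n \<noteq> {}"
  proof (rule ccontr)
    assume "\<not> ?thesis"
    then have none: "top_of_set V interior_of Cn n = {}" for n by blast
    have "compact V" using ambient(1) VA Vcl by (meson closed_subset closedin_compact compact_Int_closed inf.absorb_iff2)
    then have "compact_space (top_of_set V)" by (simp add: compact_space_subtopology)
    then have lc: "locally_compact_space (top_of_set V)" by (rule compact_imp_locally_compact_space)
    have "metrizable_space (top_of_set V)" by (simp add: metrizable_space_euclidean metrizable_space_subtopology)
    then have "regular_space (top_of_set V)" by (rule metrizable_imp_regular_space)
    then have "top_of_set V interior_of \<Union>(range Cn) = {}"
      using lc none Ccl by (intro Baire_category_alt) auto
    then have "top_of_set V interior_of topspace (top_of_set V) = {}" using CU by simp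
    then have "V = {}" using interior_of_topspace[of "top_of_set V"] by simp
    then show False using tV[OF t] tier(5)[OF t] by blast
  qed
  then obtain n z0 where z0: "z0 \<in> top_of_set V interior_of Cn n" by blast
  obtain U where U: "open U" "top_of_set V interior_of Cn n = V \<inter> U"
    using openin_interior_of[of "top_of_set V" "Cn n"] unfolding openin_open by blast
  have UC: "V \<inter> U \<subseteq> Cn n" using interior_of_subset[of "top_of_set V" "Cn n"] U(2) by simp
  have "U \<inter> closure (\<Union>(tier S ` tiers S)) \<noteq> {}" using z0 U(2) unfolding V_def by blast
  then have "U \<inter> \<Union>(tier S ` tiers S) \<noteq> {}" using open_Int_closure_eq_empty[OF U(1)] by blast
  then obtain z1 t1 where z1: "z1 \<in> U" "t1 \<in> tiers S" "z1 \<in> tier S t1" by blast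
  obtain \<rho> where \<rho>: "0 < \<rho>" "ball z1 \<rho> \<subseteq> U" using U(1) z1(1) open_contains_ball by blast
  have "0 < \<rho>/2" using \<rho> by simp
  from dense[unfolded weakly_dense_homoclinic_def, THEN bspec, OF z1(2), THEN bspec, OF z1(3), THEN spec,
      THEN mp, OF this]
  obtain t' w where t': "t' \<in> tiers S" and w: "homoclinic (grp S t') (tier S t') (act S t') z w"
    and dw: "dist z1 w < \<rho>/2" by (elim bexE conjE exE)
  have wt': "w \<in> tier S t'" using w unfolding homoclinic_def by simp
  obtain T where T: "(f ^^ T) w = z" using dies[OF t' w] by (rule exE)
  obtain r where r: "r \<in> tiers S" "tle S t' r" "tle S \<sigma> r" using tle_directed[OF t' \<sigma>(1)] by (elim bexE conjE)
  obtain v where gl: "glues_to r v" using glues_to_exists[OF r(1)] by (rule exE)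
  then have v: "v \<in> tiers S" "tle S r v" unfolding glues_to_def by - (elim conjE, assumption)+
  obtain \<tau> where \<tau>: "\<tau> \<in> tiers S" "tle S v \<tau>" "\<And>m. (f ^^ m) ` tier S v \<subseteq> tier S \<tau>"
    using stabilize[OF v(1)] by blast
  have t'\<tau>: "tle S t' \<tau>"
    by (rule tle_trans[OF t' v(1) \<tau>(1) tle_trans[OF t' r(1) v(1) r(2) v(2)] \<tau>(2)])
  have rv: "tier S r \<subseteq> tier S v" by (rule conn(1)[OF r(1) v])
  have \<sigma>r: "tier S \<sigma> \<subseteq> tier S r" by (rule conn(1)[OF \<sigma>(1) r(1,3)])
  have wr: "w \<in> tier S r" using wt' conn(1)[OF t' r(1,2)] by blast
  have orb: "tier S v \<subseteq> orbits_in \<tau>" using orbits_inI[OF \<tau>(1) _ \<tau>(3)] by blast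
  obtain \<Delta> where sys: "nil_system (grp S \<tau>) (orbits_in \<tau>) (act S \<tau>) z f \<Delta>"
    using nil_system_tier[OF \<tau>(1)] by (rule exE)
  interpret nil_system "grp S \<tau>" "orbits_in \<tau>" "act S \<tau>" z f \<Delta> by (rule sys)
  define \<epsilon> where "\<epsilon> = min (\<Delta>/16) (\<rho>/8)"
  have \<epsilon>: "0 < \<epsilon>" "2 * \<epsilon> \<le> \<Delta>" "2 * \<epsilon> < \<rho>/2" unfolding \<epsilon>_def using \<Delta>_pos \<rho>(1) by auto
  from glue_at[OF gl \<tau>(1,2) \<tau>(3) sys \<epsilon>(1)]
  obtain \<delta> K where \<delta>: "0 < \<delta>" "\<delta> \<le> \<epsilon>" and K: "finite K" "K \<subseteq> carrier (grp S \<tau>)" "\<one>\<^bsub>grp S \<tau>\<^esub> \<in> K"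
    and glue: "\<forall>P\<subseteq>tier S r. separated \<delta> K P \<longrightarrow> (\<exists>y\<in>tier S v. glued \<epsilon> \<delta> K P y)"
    by (elim exE conjE)
  define T' where "T' = max n T"
  define Q where "Q = insert \<one>\<^bsub>grp S \<tau>\<^esub> (cell \<delta> K w)"
  have "finite (spt \<delta> w)" unfolding spt_def by (rule homoclinic_spt[OF t' \<tau>(1) t'\<tau> \<delta>(1) w])
  then have Q: "finite Q" "Q \<subseteq> carrier (grp S \<tau>)"
    unfolding Q_def using finite_set_mult[OF K(1)] cell_subset[OF K(2), of \<delta> w] by (auto simp: cell_def)
  define A where "A = halo T' <#>\<^bsub>grp S \<tau>\<^esub> Q"
  have A: "finite A" "A \<subseteq> carrier (grp S \<tau>)" unfolding A_def
    using finite_set_mult[OF halo(1) Q(1)] set_mult_closed[OF halo(2) Q(2)] by auto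
  have QA: "Q \<subseteq> A" unfolding A_def by (rule subset_set_mult[OF halo(3) Q(2)])
  define R where "R = (\<lambda>k. inv\<^bsub>grp S \<tau>\<^esub> k) ` K <#>\<^bsub>grp S \<tau>\<^esub> A"
  have iK: "(\<lambda>k. inv\<^bsub>grp S \<tau>\<^esub> k) ` K \<subseteq> carrier (grp S \<tau>)" using K by auto
  have R: "finite R" "R \<subseteq> carrier (grp S \<tau>)" unfolding R_def
    using finite_set_mult[OF finite_imageI[OF K(1)] A(1)] set_mult_closed[OF iK A(2)] by auto
  have key: "dist ((f ^^ m) y) z \<le> \<eta>/2"
    if y: "y \<in> tier S \<sigma>" "spt \<delta> y \<inter> R = {}" and m: "T' \<le> m" for y m
  proof -
    have yr: "y \<in> tier S r" using y(1) \<sigma>r by blast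
    have disj: "cell \<delta> K y \<inter> A = {}"
      by (rule cell_disjoint[OF A(2) K(2)]) (use y(2) in \<open>simp add: R_def\<close>)
    then have disj': "cell \<delta> K y \<inter> cell \<delta> K w = {}" "\<one>\<^bsub>grp S \<tau>\<^esub> \<notin> cell \<delta> K y" using QA unfolding Q_def by auto
    have "separated \<delta> K {w, y}" unfolding separated_def using disj'(1) by auto
    moreover have "{w, y} \<subseteq> tier S r" using wr yr by simp
    ultimately have "\<exists>u\<in>tier S v. glued \<epsilon> \<delta> K {w, y} u" using glue by simp
    then obtain u where u: "u \<in> tier S v" "glued \<epsilon> \<delta> K {w, y} u" by (rule bexE)
    have uY: "u \<in> orbits_in \<tau>" "w \<in> orbits_in \<tau>" "y \<in> orbits_in \<tau>" using u(1) wr yr rv orb by auto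
    have "dist u w \<le> 2 * \<epsilon>"
    proof (cases "\<one>\<^bsub>grp S \<tau>\<^esub> \<in> cell \<delta> K w")
      case True
      then have "dist (act S \<tau> \<one>\<^bsub>grp S \<tau>\<^esub> u) (act S \<tau> \<one>\<^bsub>grp S \<tau>\<^esub> w) \<le> \<epsilon>" using u(2) unfolding glued_def by auto
      then show ?thesis using act_one uY \<epsilon>(1) by simp
    next
      case False
      then have 1: "dist u z \<le> \<epsilon>" using u(2) disj'(2) act_one[OF uY(1)] unfolding glued_def by force
      have "\<one>\<^bsub>grp S \<tau>\<^esub> \<notin> spt \<delta> w" using False spt_subset_cell[OF K(3)] by blast
      then have "dist w z < \<delta>" using act_one[OF uY(2)] unfolding spt_def by auto
      then show ?thesis using 1 \<delta>(2) dist_triangle2[of u w z] by linarith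
    qed
    then have "dist z1 u < \<rho>" using dw \<epsilon>(3) dist_triangle[of z1 u w] by (simp add: dist_commute)
    then have "u \<in> U" using \<rho>(2) by (auto simp: subset_iff)
    moreover have "u \<in> V" using tV[OF v(1)] u(1) by (rule subsetD)
    ultimately have "u \<in> Cn n" using UC by blast
    then have close: "dist ((f ^^ m) u) z \<le> \<eta>/2" using m unfolding Cn_def T'_def by auto
    have "(f ^^ T') u = (f ^^ T') y"
    proof (rule merge[OF _ _ _ _ \<epsilon>(2) K(2), where P' = "{y}" and P'' = "{w}"])
      show "glued \<epsilon> \<delta> K ({y} \<union> {w}) u" using u(2) by (simp add: insert_commute)
      show "glued \<epsilon> \<delta> K {y} y" "glued \<epsilon> \<delta> K {w} w" using glued_single uY \<delta> \<epsilon>(1) K(3) by auto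
      show "(f ^^ T') w = z" using fn_zero_mono[OF T] unfolding T'_def by simp
      fix p q assume "p \<in> {w}" "q \<in> {y}"
      moreover have "halo T' <#>\<^bsub>grp S \<tau>\<^esub> cell \<delta> K w \<subseteq> A"
        unfolding A_def by (rule mono_set_mult) (auto simp: Q_def)
      ultimately show "cell \<delta> K q \<inter> (halo T' <#>\<^bsub>grp S \<tau>\<^esub> cell \<delta> K p) = {}" using disj by auto
    qed (use \<epsilon>(1) in simp)
    then have "(f ^^ m) u = (f ^^ m) y" using fn_split[OF m] by simp
    then show ?thesis using close by simp
  qed
  have ts: "tier S t \<subseteq> orbits_in \<tau>" using conn(1)[OF t \<sigma>(1,2)] \<sigma>r rv orb by blast
  define G where "G j = {y \<in> tier S t. \<forall>g\<in>R. dist (act S \<tau> g ((f ^^ j) y)) z < \<delta>}" for j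
  have Gopen: "openin (top_of_set (tier S t)) (G j)" for j
  proof -
    have "openin (top_of_set (tier S t)) (tier S t \<inter> (\<lambda>y. dist (act S \<tau> g ((f ^^ j) y)) z) -` {..<\<delta>})"
      if g: "g \<in> R" for g
    proof (rule continuous_openin_preimage_gen)
      have 1: "continuous_on (tier S t) (f ^^ j)" by (rule continuous_on_subset[OF fn_continuous tier(1)[OF t]])
      have "(f ^^ j) ` tier S t \<subseteq> orbits_in \<tau>" using ts fn_in by blast
      then have "continuous_on (tier S t) (\<lambda>y. act S \<tau> g ((f ^^ j) y))"
        using act_cont g R(2) by (intro continuous_on_compose2[OF _ 1]) auto
      then show "continuous_on (tier S t) (\<lambda>y. dist (act S \<tau> g ((f ^^ j) y)) z)" by (intro continuous_intros)
    qed simp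
    then have "openin (top_of_set (tier S t))
        ((\<Inter>g\<in>R. tier S t \<inter> (\<lambda>y. dist (act S \<tau> g ((f ^^ j) y)) z) -` {..<\<delta>}) \<inter> topspace (top_of_set (tier S t)))"
      using R(1) by (intro openin_INT) auto
    moreover have "(\<Inter>g\<in>R. tier S t \<inter> (\<lambda>y. dist (act S \<tau> g ((f ^^ j) y)) z) -` {..<\<delta>}) \<inter> topspace (top_of_set (tier S t)) = G j"
      unfolding G_def by auto
    ultimately show ?thesis by simp
  qed
  have "tier S t \<subseteq> \<Union>(range G)"
  proof
    fix y assume y: "y \<in> tier S t"
    have "0 < \<delta>/2" using \<delta> by simp
    from eventually_agree_z[OF R subsetD[OF ts y] this]
    obtain j where "agree (\<delta>/2) R ((f ^^ j) y) z" by blast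
    then have "dist (act S \<tau> g ((f ^^ j) y)) z \<le> \<delta>/2" if "g \<in> R" for g
      using that R(2) act_z[of g] unfolding agree_def by force
    then have "y \<in> G j" unfolding G_def using y \<delta>(1) by force
    then show "y \<in> \<Union>(range G)" by blast
  qed
  then have "\<exists>D\<subseteq>range G. finite D \<and> tier S t \<subseteq> \<Union>D"
    using tier(2)[OF t] Gopen unfolding compact_eq_openin_cover by auto
  then obtain D where D: "D \<subseteq> range G" "finite D" "tier S t \<subseteq> \<Union>D" by blast
  obtain N where N: "finite N" "D = G ` N" using D(1,2) by (meson finite_subset_image)
  define J where "J = Max (insert 0 N)"
  define m where "m = J + T'"
  have small: "dist ((f ^^ m) y) z \<le> \<eta>/2" if y: "y \<in> tier S t" for y
  proof -
    obtain j where j: "j \<in> N" "y \<in> G j" using D(3) N(2) y by blast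
    have "j \<le> J" unfolding J_def using N(1) j(1) by simp
    then have le: "j \<le> m" "T' \<le> m - j" unfolding m_def by auto
    have "(f ^^ j) y \<in> tier S \<sigma>" using \<sigma>(3) y by blast
    moreover have "spt \<delta> ((f ^^ j) y) \<inter> R = {}" using j(2) unfolding G_def spt_def by force
    ultimately have "dist ((f ^^ (m - j)) ((f ^^ j) y)) z \<le> \<eta>/2" using key le(2) by blast
    then show ?thesis using fn_split[OF le(1)] by simp
  qed
  have "(f ^^ m) y = z" if y: "y \<in> tier S t" for y
  proof -
    have orbit: "(f ^^ i) y \<in> tier S \<sigma>" for i using \<sigma>(3) y by blast
    have "dist (act S \<sigma> g ((f ^^ m) y)) (act S \<sigma> g z) \<le> \<eta>" if g: "g \<in> carrier (grp S \<sigma>)" for g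
    proof -
      have "act S \<sigma> g y \<in> tier S t" by (rule tier_act_in_lower[OF t \<sigma>(1,2) g y])
      then have "dist ((f ^^ m) (act S \<sigma> g y)) z \<le> \<eta>/2" by (rule small)
      then show ?thesis using tier_fn_act[OF \<sigma>(1) g orbit] tier(6)[OF \<sigma>(1) g] \<eta>(1) by simp
    qed
    then show ?thesis using \<eta>(2) orbit tier(5)[OF \<sigma>(1)] by blast
  qed
  then show ?thesis unfolding nilpotent_on_def by blast
qed

end

theorem theorem11p1:
  fixes G :: "'a monoid" and H :: "nat \<Rightarrow> 'a set" and n :: nat
  assumes "group G"
    and "residually_finite G"
    and "subnormal_series G n H"
    and "\<And>k. k < n \<Longrightarrow> locally_virtually_abelian ((G\<lparr>carrier := H (Suc k)\<rparr>) Mod (H k))"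
  shows "nil_rigid G (class_C3 :: (('t, 'g, 'x::metric_space) tds \<times> ('x \<Rightarrow> 'x)) set)"
proof -
  have "\<forall>t\<in>tiers S. nilpotent_on S f (tier S t)"
    if C3: "(S, f) \<in> class_C3" and iso: "G \<cong> grp S (base S)" and nil: "asymptotically_nilpotent S f"
    for S :: "('t, 'g, 'x) tds" and f
  proof
    have C2: "(S, f) \<in> class_C2" and rf: "\<And>t. t \<in> tiers S \<Longrightarrow> residually_finite (grp S t)"
      using C3 unfolding class_C3_def by auto
    interpret etds S f
      using C2 nil unfolding class_C2_def by unfold_locales auto
    fix t assume t: "t \<in> tiers S"
    show "nilpotent_on S f (tier S t)"
    proof (rule nilpotent_of_homoclinic_dies[OF t])
      fix r x assume r: "r \<in> tiers S" "homoclinic (grp S r) (tier S r) (act S r) (origin S) x"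
      show "\<exists>T. (f ^^ T) x = origin S"
        by (rule homoclinic_dies[OF r _ assms(1) iso assms(3)]) (fact rf assms(4))+
    qed
  qed
  then show ?thesis unfolding nil_rigid_def by auto
qed

end
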